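(* For every $q>10$ there is a constant $C_q$ such that for all $\theta_1,\theta_2\in\mathbb{R}$, \[\|S_{\theta_1}-S_{\theta_2}\|_{S^q}\le C_q|\theta_1-\theta_2|^{\frac14-\frac5{2q}},\] where $S^q$ is the Schatten $q$-norm of operators on $L^2(\mathrm{SU}(2))$. Moreover, $C_q\le C(q-10)^{-\frac1q}$ for some universal constant $C$.
   Context: $\mathrm{SU}(2)$ carries normalized Haar measure, $\lambda$ is its left-regular representation on $L^2(\mathrm{SU}(2))$. For $\theta\in\mathbb{R}$, $d_\theta=\mathrm{diag}(e^{i\theta},e^{-i\theta})$, $u_\theta=\frac1{\sqrt2}\begin{pmatrix}e^{i\theta}&-1\\1&e^{-i\theta}\end{pmatrix}$, and $S_\theta\xi=\frac1{2\pi}\int_0^{2\pi}\lambda(d_\varphi u_\theta d_{-\varphi})\xi\,d\varphi$. *)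

theory Defs
  imports "HOL-Analysis.Analysis"
begin

type_synonym mat2 = "complex ^ 2 ^ 2"

definition cadj :: "mat2 \<Rightarrow> mat2" where
  "cadj U = (\<chi> i j. cnj (U $ j $ i))"

definition SU2 :: "mat2 set" where
  "SU2 = {U. cadj U ** U = mat 1 \<and> U ** cadj U = mat 1 \<and> det U = 1}"

text \<open>Normalized Haar measure on SU(2): a left-invariant Borel probability measure
  on SU(2) (unique by the uniqueness of Haar measure).\<close>
definition is_haar_SU2 :: "mat2 measure \<Rightarrow> bool" where
  "is_haar_SU2 M \<longleftrightarrow> emeasure M (space M) = 1 \<and> sets M = sets (restrict_space borel SU2) \<and>
     (\<forall>g\<in>SU2. distr M M (\<lambda>x. g ** x) = M)"

definition dmat :: "real \<Rightarrow> mat2" where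
  "dmat \<theta> = vector [vector [cis \<theta>, 0], vector [0, cis (-\<theta>)]]"

definition umat :: "real \<Rightarrow> mat2" where
  "umat \<theta> = (let c = complex_of_real (1 / sqrt 2) in
     vector [vector [c * cis \<theta>, c * (-1)], vector [c * 1, c * cis (-\<theta>)]])"

text \<open>Left regular representation: (lambda(g) xi)(x) = xi(g^{-1} x); on SU(2), g^{-1} = g^*.\<close>
definition lreg :: "mat2 \<Rightarrow> (mat2 \<Rightarrow> complex) \<Rightarrow> (mat2 \<Rightarrow> complex)" where
  "lreg g \<xi> = (\<lambda>x. \<xi> (cadj g ** x))"

definition Sop :: "real \<Rightarrow> (mat2 \<Rightarrow> complex) \<Rightarrow> (mat2 \<Rightarrow> complex)" where
  "Sop \<theta> \<xi> = (\<lambda>x. complex_of_real (1 / (2 * pi)) *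
      set_lebesgue_integral lborel {0..2*pi}
        (\<lambda>\<phi>. lreg (dmat \<phi> ** umat \<theta> ** dmat (-\<phi>)) \<xi> x))"

definition epow :: "ennreal \<Rightarrow> real \<Rightarrow> ennreal" where
  "epow x p = (if x = \<infinity> then \<infinity> else ennreal (enn2real x powr p))"

definition L2 :: "'a measure \<Rightarrow> ('a \<Rightarrow> complex) \<Rightarrow> bool" where
  "L2 M f \<longleftrightarrow> f \<in> borel_measurable M \<and> (\<integral>\<^sup>+x. ennreal ((cmod (f x))\<^sup>2) \<partial>M) < \<infinity>"

definition l2norm :: "'a measure \<Rightarrow> ('a \<Rightarrow> complex) \<Rightarrow> ennreal" where
  "l2norm M f = epow (\<integral>\<^sup>+x. ennreal ((cmod (f x))\<^sup>2) \<partial>M) (1/2)"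

definition l2inner :: "'a measure \<Rightarrow> ('a \<Rightarrow> complex) \<Rightarrow> ('a \<Rightarrow> complex) \<Rightarrow> complex" where
  "l2inner M f g = (\<integral>x. f x * cnj (g x) \<partial>M)"

definition opnorm :: "'a measure \<Rightarrow> (('a \<Rightarrow> complex) \<Rightarrow> ('a \<Rightarrow> complex)) \<Rightarrow> ennreal" where
  "opnorm M T = (SUP f\<in>{f. L2 M f \<and> l2norm M f \<le> 1}. l2norm M (T f))"

text \<open>n-th singular value (n = 0,1,2,...) as approximation number:
  s_n(T) = inf { ||T - F|| : rank F \<le> n }, where the operators of rank \<le> n on L^2(M)
  are exactly f \<mapsto> sum_{i<n} <f, a_i> b_i with a_i, b_i in L^2(M).\<close>
definition singval :: "'a measure \<Rightarrow> (('a \<Rightarrow> complex) \<Rightarrow> ('a \<Rightarrow> complex)) \<Rightarrow> nat \<Rightarrow> ennreal" where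
  "singval M T n = (INF ab\<in>{(a, b). \<forall>i<n. L2 M (a i) \<and> L2 M (b i)}.
      opnorm M (\<lambda>f x. T f x - (\<Sum>i<n. l2inner M f (fst ab i) * snd ab i x)))"

definition schatten :: "'a measure \<Rightarrow> real \<Rightarrow> (('a \<Rightarrow> complex) \<Rightarrow> ('a \<Rightarrow> complex)) \<Rightarrow> ennreal" where
  "schatten M q T = epow (\<Sum>n. epow (singval M T n) q) (1/q)"

end

(* The functions on SU(2) given by the coefficients of (a + b z)^(n-k) (c + d z)^k are joint
   eigenfunctions of all S_theta; the eigenvalue is the unimodular number exp(-i theta (n -
   2k)) times the coefficient of z^k in 2^(-n/2) (1 + z)^(n-k) (z - 1)^k. On the circle of
   radius sqrt(k / (n - k)) the modulus of that polynomial is, after normalization, exp(-n/2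
   D) with D the relative entropy of two Bernoulli laws, so Pinsker's inequality and an
   elementary integral bound the coefficient by n^(-1/4), and by | |n - 2k| - n/sqrt 2
   |^(-1/2) away from the turning points. Hence the fourth powers sum over k to O(n^(-1/2)),
   and summing the q-th powers over k, with multiplicity n + 1, gives n^(3/2 - q/4) min(2, n
   |theta1 - theta2|)^q, which is summable over n exactly for q > 10. Completeness of the
   eigenfunctions follows from Stone-Weierstrass; they are orthogonalized only within
   eigenspaces, so Schur orthogonality is not needed. *)

theory Submission
  imports Defs "HOL-Computational_Algebra.Polynomial"
begin

subsection \<open>Decay of the diagonal matrix coefficients\<close>

text \<open>The average over \<phi> keeps only the diagonal of each representation matrix, and
  \<theta> enters a diagonal entry only through its phase. An eigenvalue difference is therefore a
  \<theta>-free modulus times a difference of two phases.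

  The obstacle is uniformity in k. The two peaks of the polynomial on the circle merge at |n - 2k| =
  n / sqrt 2, where only n^(-1/4) is obtained; using that bound for every k would give n^(2 - q/4)
  per degree and hence q > 12. The second bound recovers the missing factor n^(1/2). Its squares
  would sum with a logarithm, its fourth powers sum without one.

  The two terms of the minimum balance at n = 1 / |\<theta>1 - \<theta>2|, where both halves of the
  sum over n scale like |\<theta>1 - \<theta>2|^(q/4 - 5/2). The exponent 1/4 - 5/(2q) is the q-th
  root of this, and (q - 10)^(-1/q) is the q-th root of the constant in the tail of the sum.

  Singular values are encoded as approximation numbers, so upper bounds come from explicit
  truncations; comparing them with eigenvalues in arbitrary order costs a factor 2.\<close>

lemma cis_has_integral_period:
  fixes m :: int
  shows "((\<lambda>t. cis (of_int m * t)) has_integral (if m = 0 then complex_of_real (2 * pi) else 0)) {a..a + 2 * pi}"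
proof (cases "m = 0")
  case True
  have "((\<lambda>t::real. 1::complex) has_integral (a + 2 * pi - a) *\<^sub>R 1) {a..a + 2 * pi}"
    using has_integral_const_real[of "1::complex" a "a + 2 * pi"] by simp
  then show ?thesis using True by (simp add: scaleR_conv_of_real)
next
  case False
  let ?F = "\<lambda>t. cis (of_int m * t) / (\<i> * of_int m)"
  have "((\<lambda>t. cis (of_int m * t)) has_integral (?F (a + 2 * pi) - ?F a)) {a..a + 2 * pi}"
    using False
    by (intro fundamental_theorem_of_calculus)
      (auto intro!: derivative_eq_intros simp: has_vector_derivative_def scaleR_conv_of_real field_simps)
  moreover have "cis (of_int m * (a + 2 * pi)) = cis (of_int m * a)"
    using cis_multiple_2pi[of "of_int m"] by (simp add: distrib_left cis_mult[symmetric] mult_ac)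
  ultimately show ?thesis using False by simp
qed

text \<open>Cauchy's estimate with the mean of |p| over the circle in place of its maximum: the gain
  comes from the polynomial being large only near a few points of the circle.\<close>

lemma coeff_le_circle_integral:
  fixes p :: "complex poly"
  assumes r: "0 < r"
  shows "cmod (coeff p k) * r ^ k \<le> integral {-pi..pi} (\<lambda>t. cmod (poly p (of_real r * cis t))) / (2 * pi)"
proof -
  let ?g = "\<lambda>t. cis (of_int (- int k) * t) * poly p (of_real r * cis t)"
  have g_eq: "?g t = (\<Sum>i\<le>degree p. coeff p i * of_real r ^ i * cis (of_int (int i - int k) * t))" for t
    unfolding poly_altdef sum_distrib_left
  proof (rule sum.cong)
    fix i
    have "cis (of_int (- int k) * t) * cis (real i * t) = cis (of_int (int i - int k) * t)"
      unfolding cis_mult by (simp add: algebra_simps)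
    then show "cis (of_int (- int k) * t) * (coeff p i * (of_real r * cis t) ^ i) =
      coeff p i * of_real r ^ i * cis (of_int (int i - int k) * t)"
      unfolding power_mult_distrib Complex.DeMoivre by (simp add: mult_ac)
  qed simp
  have period: "((\<lambda>t. cis (of_int m * t)) has_integral (if m = 0 then complex_of_real (2 * pi) else 0)) {-pi..pi}" for m :: int
    using cis_has_integral_period[of m "-pi"] by simp
  have "(?g has_integral (\<Sum>i\<le>degree p. coeff p i * of_real r ^ i *
       (if int i - int k = 0 then complex_of_real (2 * pi) else 0))) {-pi..pi}"
    unfolding g_eq
    by (intro has_integral_sum has_integral_mult_right period finite_atMost)
  also have "(\<Sum>i\<le>degree p. coeff p i * of_real r ^ i * (if int i - int k = 0 then complex_of_real (2 * pi) else 0)) =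
     (\<Sum>i\<le>degree p. if i = k then coeff p k * of_real r ^ k * of_real (2 * pi) else 0)"
    by (intro sum.cong) auto
  also have "\<dots> = coeff p k * of_real r ^ k * of_real (2 * pi)"
    by (simp add: coeff_eq_0)
  finally have g: "(?g has_integral coeff p k * of_real r ^ k * of_real (2 * pi)) {-pi..pi}" .
  have "norm (integral {-pi..pi} ?g) \<le> integral {-pi..pi} (\<lambda>t. cmod (poly p (of_real r * cis t)))"
    by (rule integral_norm_bound_integral)
      (use g in \<open>auto simp: norm_mult intro!: integrable_continuous_real continuous_intros\<close>)
  then show ?thesis
    using r unfolding integral_unique[OF g] by (simp add: norm_mult norm_power field_simps)
qed

text \<open>Pinsker's inequality for Bernoulli laws, with the worse constant given by the
  Hellinger distance.\<close>
lemma bernoulli_likelihood_le: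
  fixes a p :: real and m1 m2 n :: nat
  assumes a: "0 < a" "a < 1" and p: "0 \<le> p" "p \<le> 1"
    and m: "real m1 = n * a" "real m2 = n * (1 - a)"
  shows "(p / a) ^ m1 * ((1 - p) / (1 - a)) ^ m2 \<le> exp (- (n * (a - p)\<^sup>2 / 2))"
proof -
  \<comment> \<open>The square root matters: \<open>y / b \<le> exp (y / b - 1)\<close> for both
    outcomes would multiply to the trivial bound 1, whereas this version leaves the Bhattacharyya
    coefficient \<open>sqrt (a * p) + sqrt ((1 - a) * (1 - p))\<close>, which is below 1 unless a =
    p.\<close>
  have pow: "(y / b) ^ m \<le> exp (2 * n * (sqrt (b * y) - b))"
    if "0 < b" "0 \<le> y" "real m = n * b" for b y :: real and m
  proof -
    have "y / b = (sqrt (y / b))\<^sup>2" using that by simp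
    also have "\<dots> \<le> (exp (sqrt (y / b) - 1))\<^sup>2"
      using exp_ge_add_one_self[of "sqrt (y / b) - 1"] that by (intro power_mono) auto
    finally have "(y / b) ^ m \<le> ((exp (sqrt (y / b) - 1))\<^sup>2) ^ m"
      using that by (intro power_mono) auto
    also have "\<dots> = exp (2 * real m * (sqrt (y / b) - 1))"
      by (simp add: exp_of_nat_mult[symmetric] power_mult[symmetric] mult_ac)
    also have "2 * real m * (sqrt (y / b) - 1) = 2 * n * (b * sqrt (y / b) - b)"
      using that by (simp add: algebra_simps)
    also have "b * sqrt (y / b) = sqrt (b * y)"
    proof -
      have "sqrt (b * y) = sqrt (b\<^sup>2 * (y / b))" using that by (simp add: power2_eq_square)
      also have "\<dots> = b * sqrt (y / b)" using that by (simp only: real_sqrt_mult) simp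
      finally show ?thesis by simp
    qed
    finally show ?thesis .
  qed
  have sq: "2 * sqrt (b * y) \<le> b + y - (b - y)\<^sup>2 / 4" if "0 \<le> b" "b \<le> 1" "0 \<le> y" "y \<le> 1" for b y :: real
  proof -
    have "(b - y)\<^sup>2 = (sqrt b - sqrt y)\<^sup>2 * (sqrt b + sqrt y)\<^sup>2"
      using that by (simp add: power_mult_distrib[symmetric] algebra_simps)
    also have "\<dots> \<le> (sqrt b - sqrt y)\<^sup>2 * 2\<^sup>2"
      using that real_sqrt_le_1_iff[of b] real_sqrt_le_1_iff[of y]
      by (intro mult_left_mono power_mono) (auto simp del: real_sqrt_le_1_iff)
    also have "\<dots> = 4 * (b + y - 2 * sqrt (b * y))"
      using that by (simp add: power2_diff real_sqrt_mult)
    finally show ?thesis by simp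
  qed
  have "(p / a) ^ m1 * ((1 - p) / (1 - a)) ^ m2
    \<le> exp (2 * n * (sqrt (a * p) - a)) * exp (2 * n * (sqrt ((1 - a) * (1 - p)) - (1 - a)))"
    using assms by (intro mult_mono pow) auto
  also have "\<dots> = exp (n * (2 * sqrt (a * p) + 2 * sqrt ((1 - a) * (1 - p)) - 2))"
    by (simp add: exp_add[symmetric] algebra_simps)
  also have "\<dots> \<le> exp (n * (- ((a - p)\<^sup>2 / 2)))"
  proof -
    have "2 * sqrt (a * p) + 2 * sqrt ((1 - a) * (1 - p)) - 2 \<le> - ((a - p)\<^sup>2 / 2)"
      using sq[of a p] sq[of "1 - a" "1 - p"] a p by (simp add: power2_commute[of p a] power2_diff algebra_simps)
    then show ?thesis unfolding exp_le_cancel_iff by (rule mult_left_mono) simp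
  qed
  finally show ?thesis by (simp add: mult.assoc)
qed

definition jac_poly :: "nat \<Rightarrow> nat \<Rightarrow> complex poly" where
  "jac_poly n k = [:1, 1:] ^ (n - k) * [:-1, 1:] ^ k"

text \<open>This is |d^j_mm(pi/2)|, a diagonal Wigner function with j = n/2 and m = n/2 - k: the
  modulus of the k-th diagonal entry of \<open>umat \<theta>\<close> acting on binary forms of
  degree n.\<close>

definition jac :: "nat \<Rightarrow> nat \<Rightarrow> real" where
  "jac n k = cmod (coeff (jac_poly n k) k) / sqrt 2 ^ n"

lemma cmod_one_plus_cis: "(cmod (1 + of_real r * cis t))\<^sup>2 = 1 + r\<^sup>2 + 2 * r * cos t"
proof -
  have "r\<^sup>2 * (cos t)\<^sup>2 + r\<^sup>2 * (sin t)\<^sup>2 = r\<^sup>2"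
    by (simp flip: distrib_left)
  then show ?thesis unfolding cmod_power2 by (simp add: power_mult_distrib power2_sum)
qed

text \<open>The circle through the (complex) saddle points of
  \<open>(1 + z) ^ (n - k) * (z - 1) ^ k / z ^ k\<close>.\<close>
lemma jac_poly_on_circle:
  fixes n k :: nat
  assumes k: "0 < k" "k < n"
  defines "C \<equiv> 1 - 2 * (k / n)"
  defines "s \<equiv> sqrt (1 - C\<^sup>2)" and "r \<equiv> sqrt (k / (n - k))"
  shows "cmod (poly (jac_poly n k) (of_real r * cis t)) \<le> sqrt 2 ^ n * r ^ k * exp (- (n * (s * cos t - C)\<^sup>2 / 16))"
proof -
  define \<kappa> where "\<kappa> = k / n"
  have \<kappa>: "0 < \<kappa>" "\<kappa> < 1" using k by (auto simp: \<kappa>_def)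
  have r2: "r\<^sup>2 = \<kappa> / (1 - \<kappa>)" and r0: "0 \<le> r"
    using k by (auto simp: r_def \<kappa>_def field_simps)
  have s_r: "2 * r = s / (1 - \<kappa>)"
  proof -
    have "s = sqrt (4 * (1 - \<kappa>)\<^sup>2 * r\<^sup>2)"
      unfolding s_def r2 C_def \<kappa>_def[symmetric] using \<kappa>
      by (intro arg_cong[where f = sqrt]) (simp add: power2_eq_square field_simps)
    also have "\<dots> = 2 * (1 - \<kappa>) * r"
      using \<kappa> r0 by (simp add: real_sqrt_mult)
    finally show ?thesis using \<kappa> by (simp add: field_simps)
  qed
  \<comment> \<open>\<open>p\<close> is the Bernoulli parameter carried by a point z of the circle:
    |1 + z|^2 and |z - 1|^2 are 2 p / (1 - \<kappa>) and 2 r^2 (1 - p) / \<kappa>, so the squared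
    modulus of the polynomial is a likelihood ratio against the law with parameter 1 -
    \<kappa>.\<close>
  define p where "p = (1 + s * cos t) / 2"
  have "C\<^sup>2 \<le> 1" unfolding C_def \<kappa>_def[symmetric] using \<kappa>
    by (simp add: power2_eq_square algebra_simps mult_le_cancel_left1)
  then have s01: "0 \<le> s" "s \<le> 1" unfolding s_def by auto
  then have "\<bar>s * cos t\<bar> \<le> 1" using mult_mono[of s 1 "\<bar>cos t\<bar>" 1] by (simp add: abs_mult)
  then have p: "0 \<le> p" "p \<le> 1" unfolding p_def by auto
  have one_r: "1 + r\<^sup>2 = 1 / (1 - \<kappa>)" using \<kappa> by (simp add: r2 field_simps)
  have A: "(cmod (1 + of_real r * cis t))\<^sup>2 = 2 * (p / (1 - \<kappa>))"
    unfolding cmod_one_plus_cis one_r s_r p_def using \<kappa> by (simp add: field_simps)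
  have "(cmod (- 1 + of_real r * cis t))\<^sup>2 = (cmod (1 + of_real (- r) * cis t))\<^sup>2"
    using norm_minus_cancel[of "1 + of_real (- r) * cis t"] by simp
  also have "\<dots> = 1 + r\<^sup>2 - 2 * r * cos t" unfolding cmod_one_plus_cis by simp
  also have "\<dots> = 2 * r\<^sup>2 * ((1 - p) / \<kappa>)"
    unfolding one_r s_r r2 p_def using \<kappa> by (simp add: field_simps)
  finally have B: "(cmod (- 1 + of_real r * cis t))\<^sup>2 = 2 * r\<^sup>2 * ((1 - p) / \<kappa>)" .
  have "(cmod (poly (jac_poly n k) (of_real r * cis t)))\<^sup>2 =
     ((cmod (1 + of_real r * cis t))\<^sup>2) ^ (n - k) * ((cmod (- 1 + of_real r * cis t))\<^sup>2) ^ k"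
    by (simp add: jac_poly_def norm_mult norm_power power_mult_distrib mult.commute flip: power_mult)
  also have "\<dots> = 2 ^ n * (r\<^sup>2) ^ k * ((p / (1 - \<kappa>)) ^ (n - k) * ((1 - p) / \<kappa>) ^ k)"
  proof -
    have "(2::real) ^ n = 2 ^ (n - k) * 2 ^ k" using k by (simp flip: power_add)
    then show ?thesis unfolding A B power_mult_distrib by simp
  qed
  also have "\<dots> \<le> 2 ^ n * (r\<^sup>2) ^ k * exp (- (n * ((1 - \<kappa>) - p)\<^sup>2 / 2))"
  proof -
    have "real (n - k) = n * (1 - \<kappa>)" "real k = n * (1 - (1 - \<kappa>))"
      using k by (simp_all add: \<kappa>_def of_nat_diff right_diff_distrib)
    from bernoulli_likelihood_le[OF _ _ p this] \<kappa>
    have "(p / (1 - \<kappa>)) ^ (n - k) * ((1 - p) / \<kappa>) ^ k \<le> exp (- (n * ((1 - \<kappa>) - p)\<^sup>2 / 2))"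
      by simp
    then show ?thesis by (rule mult_left_mono) simp
  qed
  \<comment> \<open>The 16 in the claim is 2 from the likelihood bound, times 4 from the halves in
    \<open>p\<close> and \<open>C\<close>, times 2 for the final square root.\<close>
  also have "n * ((1 - \<kappa>) - p)\<^sup>2 / 2 = n * (s * cos t - C)\<^sup>2 / 8"
  proof -
    have "(1 - \<kappa>) - p = - ((s * cos t - C) / 2)"
      unfolding p_def C_def \<kappa>_def[symmetric] by (simp add: field_simps)
    then show ?thesis by (simp only: power2_minus power_divide) simp
  qed
  also have "2 ^ n * (r\<^sup>2) ^ k * exp (- (n * (s * cos t - C)\<^sup>2 / 8)) =
     (sqrt 2 ^ n * r ^ k * exp (- (n * (s * cos t - C)\<^sup>2 / 16)))\<^sup>2"
  proof -
    have "(sqrt 2 ^ n)\<^sup>2 = 2 ^ n" by (metis power_mult mult.commute real_sqrt_pow2 zero_le_numeral)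
    moreover have "(r ^ k)\<^sup>2 = (r\<^sup>2) ^ k" by (simp add: mult.commute flip: power_mult)
    moreover have "(exp (- (n * (s * cos t - C)\<^sup>2 / 16)))\<^sup>2 = exp (- (n * (s * cos t - C)\<^sup>2 / 8))"
      unfolding exp_double[symmetric] by simp
    ultimately show ?thesis by (simp add: power_mult_distrib)
  qed
  finally have "(cmod (poly (jac_poly n k) (of_real r * cis t)))\<^sup>2 \<le>
     (sqrt 2 ^ n * r ^ k * exp (- (n * (s * cos t - C)\<^sup>2 / 16)))\<^sup>2" by simp
  then show ?thesis by (rule power2_le_imp_le) (use r0 in auto)
qed


section \<open>Lower bounds for the phase s cos t - C on the circle\<close>

text \<open>Jordan's inequality for the sine, from its concavity, applied at half the angle.\<close>

lemma one_minus_cos_ge: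
  assumes "\<bar>y\<bar> \<le> pi" shows "2 * (y\<^sup>2 / pi\<^sup>2) \<le> 1 - cos y"
proof -
  have sin_ge: "x \<le> sin (x * (pi / 2))" if "0 \<le> x" "x \<le> 1" for x
  proof -
    have "convex_on {0..pi} (\<lambda>x. - sin x)"
      by (rule f''_ge0_imp_convex[where f' = "\<lambda>x. - cos x" and f'' = "\<lambda>x. sin x"])
        (auto intro!: derivative_eq_intros sin_ge_zero)
    from convex_onD[OF this, of x 0 "pi / 2"] that show ?thesis by simp
  qed
  define x where "x = \<bar>y\<bar> / pi"
  have x: "0 \<le> x" "x \<le> 1" using assms by (auto simp: x_def)
  have "2 * x\<^sup>2 \<le> 2 * (sin (x * (pi / 2)))\<^sup>2"
    using sin_ge[OF x] x by (intro mult_left_mono power_mono) auto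
  also have "\<dots> = 1 - cos (2 * (x * (pi / 2)))"
    by (simp only: cos_double_sin)
  also have "2 * (x * (pi / 2)) = \<bar>y\<bar>" by (simp add: x_def)
  finally show ?thesis by (simp add: x_def power_divide)
qed

text \<open>Since \<open>c + s \<ge> 1\<close>, the quantity c - s + 2 s w = w (c + s) + (1 - w) (c
  - s) is at least w. This serves the weights whose phase has no simple zero: \<open>c\<close> is
  |C|, \<open>v\<close> is 1 minus the cosine of the distance to 0 or pi, and \<open>w\<close> is
  that distance squared over pi^2.\<close>

lemma phase_lower_bound_aux:
  fixes s c w :: real
  assumes "0 \<le> s" "s \<le> c" "c\<^sup>2 + s\<^sup>2 = 1" "0 \<le> w" "w \<le> 1" "2 * w \<le> v"
  shows "w \<le> \<bar>c - s + s * v\<bar>" "(c - s) * w \<le> (c - s + s * v)\<^sup>2"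
proof -
  have "1 \<le> (c + s)\<^sup>2" using assms by (simp add: power2_sum)
  then have cs: "1 \<le> c + s" using assms by (smt (verit) power2_le_imp_le power_one)
  have sv: "s * (2 * w) \<le> s * v" using assms by (intro mult_left_mono) auto
  have "w * 1 \<le> w * (c + s)" using cs assms by (intro mult_left_mono) auto
  moreover have "w * (c - s) \<le> 1 * (c - s)" using assms by (intro mult_right_mono) auto
  ultimately have "w \<le> (c - s) + s * (2 * w)" by (simp add: algebra_simps)
  then have *: "w \<le> c - s + s * v" using sv by linarith
  then show "w \<le> \<bar>c - s + s * v\<bar>" by linarith
  have "(c - s) * w \<le> (c - s + s * v) * (c - s + s * v)"
    using * assms sv by (intro mult_mono) auto
  then show "(c - s) * w \<le> (c - s + s * v)\<^sup>2" by (simp add: power2_eq_square)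
qed

text \<open>For |C| < s the phase has simple zeros at \<open>t0\<close> and \<open>- t0\<close>,
  with squared slope s^2 - C^2. They merge at 0 or pi as |C| grows to s; beyond that, 0 or pi
  remains the point where |s cos t - C| is least. The quadratic bound survives the merging, while
  the bound on the square is stronger away from it.\<close>

lemma phase_lower_bound:
  fixes s C :: real
  assumes s: "0 \<le> s" "C\<^sup>2 + s\<^sup>2 = 1"
  shows "\<exists>t0. \<forall>t\<in>{-pi..pi}. (\<bar>t\<bar> - t0)\<^sup>2 / pi\<^sup>2 \<le> \<bar>s * cos t - C\<bar> \<and>
    \<bar>s - \<bar>C\<bar>\<bar> * ((\<bar>t\<bar> - t0)\<^sup>2 / pi\<^sup>2) \<le> (s * cos t - C)\<^sup>2"
proof -
  have le1: "y\<^sup>2 / pi\<^sup>2 \<le> 1" if "\<bar>y\<bar> \<le> pi" for y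
    using that by (simp add: abs_le_square_iff[symmetric])
  consider "s \<le> C" | "s \<le> - C" | "\<bar>C\<bar> < s" by linarith
  then show ?thesis
  proof cases
    case 1
    have *: "t\<^sup>2 / pi\<^sup>2 \<le> \<bar>C - s + s * (1 - cos t)\<bar> \<and> (C - s) * (t\<^sup>2 / pi\<^sup>2) \<le> (C - s + s * (1 - cos t))\<^sup>2"
      if "t \<in> {-pi..pi}" for t
      using that s 1 le1[of t] one_minus_cos_ge[of t]
      by (intro conjI phase_lower_bound_aux) auto
    have "s * cos t - C = - (C - s + s * (1 - cos t))" for t by (simp add: algebra_simps)
    moreover have "\<bar>s - \<bar>C\<bar>\<bar> = C - s" "(\<bar>t\<bar> - 0)\<^sup>2 = t\<^sup>2" for t :: real
      using 1 s(1) by simp_all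
    ultimately show ?thesis using * by (intro exI[of _ 0]) (simp only: abs_minus_cancel power2_minus, blast)
  next
    case 2
    have *: "(\<bar>t\<bar> - pi)\<^sup>2 / pi\<^sup>2 \<le> \<bar>- C - s + s * (1 + cos t)\<bar> \<and>
      (- C - s) * ((\<bar>t\<bar> - pi)\<^sup>2 / pi\<^sup>2) \<le> (- C - s + s * (1 + cos t))\<^sup>2"
      if "t \<in> {-pi..pi}" for t
    proof -
      have "cos (\<bar>t\<bar> - pi) = - cos t" by (simp add: cos_diff)
      then show ?thesis
        using that s 2 le1[of "\<bar>t\<bar> - pi"] one_minus_cos_ge[of "\<bar>t\<bar> - pi"]
        by (intro conjI phase_lower_bound_aux) auto
    qed
    have "s * cos t - C = - C - s + s * (1 + cos t)" for t by (simp add: algebra_simps)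
    moreover have "\<bar>s - \<bar>C\<bar>\<bar> = - C - s"
      using 2 s(1) by simp
    ultimately show ?thesis using * by (intro exI[of _ pi]) (simp only:, blast)
  next
    case 3
    define t0 where "t0 = arccos (C / s)"
    have "- 1 \<le> C / s" "C / s \<le> 1" using 3 by (auto simp: field_simps)
    then have t0: "0 \<le> t0" "t0 \<le> pi" "cos t0 = C / s"
      unfolding t0_def by (simp_all add: arccos_lbound arccos_ubound cos_arccos)
    have "s \<noteq> 0" using 3 by auto
    then have s_cos: "C = s * cos t0" unfolding t0(3) by simp
    show ?thesis
    proof (intro exI[of _ t0] ballI)
      fix t :: real assume t: "t \<in> {-pi..pi}"
      define y where "y = \<bar>t\<bar> - t0"
      define w where "w = y\<^sup>2 / pi\<^sup>2"
      \<comment> \<open>The square of s cos t - C is 4 s^2 a b. The first bound uses w \<le> a \<le>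
        b; the second bounds b below by (sin t0)^2 / 4, which is tied to s - |C|.\<close>
      define a where "a = (sin (y / 2))\<^sup>2"
      define b where "b = (sin ((\<bar>t\<bar> + t0) / 2))\<^sup>2"
      have y: "\<bar>y\<bar> \<le> pi" using t t0 by (auto simp: y_def)
      have w0: "0 \<le> w" "w \<le> 1" using le1[OF y] by (auto simp: w_def)
      have wa: "w \<le> a"
      proof -
        have "cos y = 1 - 2 * a"
          using cos_double_sin[of "y / 2"] by (simp add: a_def)
        then show ?thesis using one_minus_cos_ge[OF y] by (simp add: w_def)
      qed
      define g where "g = s * cos t - C"
      have g2: "g\<^sup>2 = 4 * s\<^sup>2 * (a * b)"
      proof -
        have "g = - (s * (cos t0 - cos \<bar>t\<bar>))" unfolding g_def s_cos by (simp add: right_diff_distrib)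
        also have "cos t0 - cos \<bar>t\<bar> = 2 * sin ((t0 + \<bar>t\<bar>) / 2) * sin ((\<bar>t\<bar> - t0) / 2)"
          by (rule cos_diff_cos)
        finally have "g = - (s * (2 * sin ((\<bar>t\<bar> + t0) / 2) * sin (y / 2)))"
          unfolding y_def by (simp only: add.commute)
        then show ?thesis by (simp add: a_def b_def power_mult_distrib mult_ac)
      qed
      text \<open>With \<open>x = (\<bar>t\<bar> + t0) / 2\<close>, both \<open>x\<close> and \<open>pi - x\<close> are at least \<open>\<bar>y\<bar> / 2\<close>; moreover
        \<open>t0 / 2 \<le> x\<close> and \<open>(pi - t0) / 2 \<le> pi - x\<close>.\<close>
      have cos2: "cos (\<bar>t\<bar> + t0) = 1 - 2 * b"
      proof -
        have "cos (2 * ((\<bar>t\<bar> + t0) / 2)) = 1 - 2 * b" unfolding b_def by (rule cos_double_sin)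
        moreover have "2 * ((\<bar>t\<bar> + t0) / 2) = \<bar>t\<bar> + t0" by simp
        ultimately show ?thesis by (simp only:)
      qed
      have "cos (\<bar>t\<bar> + t0) \<le> cos y"
      proof (cases "\<bar>t\<bar> + t0 \<le> pi")
        case True
        have "cos (\<bar>t\<bar> + t0) \<le> cos \<bar>y\<bar>"
          using True t t0(1,2) by (intro cos_monotone_0_pi_le) (auto simp: y_def)
        then show ?thesis by simp
      next
        case False
        have "cos (2 * pi - (\<bar>t\<bar> + t0)) \<le> cos \<bar>y\<bar>"
          using False t t0(1,2) by (intro cos_monotone_0_pi_le) (auto simp: y_def)
        then show ?thesis unfolding cos_2pi_minus cos_abs_real .
      qed
      moreover have "cos y = 1 - 2 * a" using cos_double_sin[of "y / 2"] by (simp add: a_def)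
      ultimately have ab: "a \<le> b" using cos2 by simp
      have b_sin: "(sin t0)\<^sup>2 \<le> 4 * b"
      proof -
        have "cos (\<bar>t\<bar> + t0) \<le> \<bar>cos t0\<bar>"
        proof (cases "\<bar>t\<bar> + t0 \<le> pi")
          case True
          have "cos (\<bar>t\<bar> + t0) \<le> cos t0"
            using True t t0(1,2) by (intro cos_monotone_0_pi_le) auto
          then show ?thesis by linarith
        next
          case False
          have "cos (2 * pi - (\<bar>t\<bar> + t0)) \<le> cos (pi - t0)"
            using False t t0(1,2) by (intro cos_monotone_0_pi_le) auto
          then show ?thesis unfolding cos_2pi_minus cos_pi_minus by linarith
        qed
        then have le_b: "1 - \<bar>cos t0\<bar> \<le> 2 * b" using cos2 by simp
        have "(sin t0)\<^sup>2 = (1 - \<bar>cos t0\<bar>) * (1 + \<bar>cos t0\<bar>)"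
          by (simp add: sin_squared_eq power2_eq_square algebra_simps)
        also have "\<dots> \<le> (1 - \<bar>cos t0\<bar>) * 2"
          by (intro mult_left_mono) auto
        also have "\<dots> \<le> (2 * b) * 2"
          by (intro mult_right_mono) (use le_b in auto)
        finally show ?thesis by simp
      qed
      have s2: "1 \<le> 2 * s\<^sup>2"
      proof -
        have "C\<^sup>2 \<le> s\<^sup>2" using 3 by (simp add: abs_le_square_iff[symmetric])
        then show ?thesis using s by linarith
      qed
      have "w\<^sup>2 \<le> g\<^sup>2"
      proof -
        have "w * w \<le> a * b" using wa ab w0 by (intro mult_mono) auto
        also have "\<dots> \<le> 4 * s\<^sup>2 * (a * b)"
          using s2 mult_right_mono[of 1 "4 * s\<^sup>2" "a * b"] by (simp add: a_def b_def)
        finally show ?thesis unfolding g2 power2_eq_square[of w] .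
      qed
      then have "w \<le> \<bar>g\<bar>" using w0 by (simp add: abs_le_square_iff[symmetric])
      moreover have "\<bar>s - \<bar>C\<bar>\<bar> * w \<le> g\<^sup>2"
      proof -
        have "s\<^sup>2 * (sin t0)\<^sup>2 = s\<^sup>2 - C\<^sup>2" unfolding s_cos sin_squared_eq by (simp add: algebra_simps)
        also have "\<dots> = (s - \<bar>C\<bar>) * (s + \<bar>C\<bar>)" by (simp add: power2_eq_square algebra_simps)
        also have "\<dots> \<ge> (s - \<bar>C\<bar>) * 1"
        proof (rule mult_left_mono)
          have "1 \<le> (s + \<bar>C\<bar>)\<^sup>2" using s by (simp add: power2_sum add.commute)
          then show "1 \<le> s + \<bar>C\<bar>" using s by (smt (verit) power2_le_imp_le power_one)
        qed (use 3 in simp)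
        finally have "s - \<bar>C\<bar> \<le> s\<^sup>2 * (sin t0)\<^sup>2" by simp
        also have "\<dots> \<le> s\<^sup>2 * (4 * b)" by (intro mult_left_mono b_sin) simp
        finally have "(s - \<bar>C\<bar>) * w \<le> (s\<^sup>2 * (4 * b)) * a"
          using w0 wa ab 3 by (intro mult_mono) (auto simp: b_def)
        then show ?thesis using 3 by (simp add: g2 mult_ac)
      qed
      ultimately show "(\<bar>t\<bar> - t0)\<^sup>2 / pi\<^sup>2 \<le> \<bar>s * cos t - C\<bar> \<and>
        \<bar>s - \<bar>C\<bar>\<bar> * ((\<bar>t\<bar> - t0)\<^sup>2 / pi\<^sup>2) \<le> (s * cos t - C)\<^sup>2"
        by (simp add: w_def y_def g_def)
    qed
  qed
qed

text \<open>According to the sign of t, the integrand is one of two Lorentzians centred at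
  \<open>t0\<close> and \<open>- t0\<close>, each of total mass at most \<open>pi / m\<close>; the
  bound is uniform in \<open>t0\<close>.\<close>

lemma integral_inverse_quadratic_le:
  fixes m t0 :: real
  assumes m: "0 < m"
  shows "(\<lambda>t. 1 / (1 + m\<^sup>2 * (\<bar>t\<bar> - t0)\<^sup>2)) integrable_on {-pi..pi}"
    "integral {-pi..pi} (\<lambda>t. 1 / (1 + m\<^sup>2 * (\<bar>t\<bar> - t0)\<^sup>2)) \<le> 2 * pi / m"
proof -
  have pos: "0 < 1 + m\<^sup>2 * x\<^sup>2" for x :: real
    by (simp add: add_pos_nonneg)
  have ne: "1 + m\<^sup>2 * x\<^sup>2 \<noteq> 0" for x :: real using pos[of x] by simp
  have *: "((\<lambda>t. 1 / (1 + m\<^sup>2 * (t - c)\<^sup>2)) has_integral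
      (arctan (m * (pi - c)) / m - arctan (m * (- pi - c)) / m)) {-pi..pi}" for c
  proof (rule fundamental_theorem_of_calculus)
    fix t
    have "((\<lambda>t. arctan (m * (t - c)) / m) has_real_derivative inverse (1 + (m * (t - c))\<^sup>2) * m / m) (at t within {-pi..pi})"
      by (auto intro!: derivative_eq_intros)
    then show "((\<lambda>t. arctan (m * (t - c)) / m) has_vector_derivative 1 / (1 + m\<^sup>2 * (t - c)\<^sup>2)) (at t within {-pi..pi})"
      unfolding has_real_derivative_iff_has_vector_derivative[symmetric]
      using m by (simp only: power_mult_distrib inverse_eq_divide) simp
  qed simp
  have le: "arctan (m * (pi - c)) / m - arctan (m * (- pi - c)) / m \<le> pi / m" for c
    using arctan_ubound[of "m * (pi - c)"] arctan_lbound[of "m * (- pi - c)"] m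
    by (simp add: diff_divide_distrib[symmetric] divide_right_mono)
  show int: "(\<lambda>t. 1 / (1 + m\<^sup>2 * (\<bar>t\<bar> - t0)\<^sup>2)) integrable_on {-pi..pi}"
    by (intro integrable_continuous_real continuous_intros ballI ne)
  have "integral {-pi..pi} (\<lambda>t. 1 / (1 + m\<^sup>2 * (\<bar>t\<bar> - t0)\<^sup>2)) \<le>
     integral {-pi..pi} (\<lambda>t. 1 / (1 + m\<^sup>2 * (t - t0)\<^sup>2) + 1 / (1 + m\<^sup>2 * (t - (- t0))\<^sup>2))"
  proof (rule integral_le[OF int])
    show "(\<lambda>t. 1 / (1 + m\<^sup>2 * (t - t0)\<^sup>2) + 1 / (1 + m\<^sup>2 * (t - (- t0))\<^sup>2)) integrable_on {-pi..pi}"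
      using *[of t0] *[of "- t0"] by (intro integrable_add) (auto simp: integrable_on_def)
    fix t :: real
    show "1 / (1 + m\<^sup>2 * (\<bar>t\<bar> - t0)\<^sup>2) \<le> 1 / (1 + m\<^sup>2 * (t - t0)\<^sup>2) + 1 / (1 + m\<^sup>2 * (t - (- t0))\<^sup>2)"
    proof (cases "0 \<le> t")
      case False
      then have "(\<bar>t\<bar> - t0)\<^sup>2 = (t - (- t0))\<^sup>2" by (simp add: power2_eq_square algebra_simps)
      then show ?thesis using less_imp_le[OF pos] by simp
    qed (use less_imp_le[OF pos, of "t - (- t0)"] in simp)
  qed
  also have "\<dots> = (arctan (m * (pi - t0)) / m - arctan (m * (- pi - t0)) / m)
     + (arctan (m * (pi - (- t0))) / m - arctan (m * (- pi - (- t0))) / m)"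
    by (intro integral_unique has_integral_add *)
  also have "\<dots> \<le> 2 * pi / m" using le[of t0] le[of "- t0"] by simp
  finally show "integral {-pi..pi} (\<lambda>t. 1 / (1 + m\<^sup>2 * (\<bar>t\<bar> - t0)\<^sup>2)) \<le> 2 * pi / m" .
qed


text \<open>Replaces Gaussian-type integrands by rational ones, whose integrals are
  arctangents.\<close>

lemma exp_minus_le: "0 \<le> x \<Longrightarrow> exp (- x) \<le> 1 / (1 + x)" for x :: real
  using exp_ge_add_one_self[of x] by (simp add: exp_minus field_simps)

text \<open>The two bounds are, up to constants, the widths on which exp (- n G^2 / 16)
  concentrates: n^(-1/4) when |G| is bounded below by a squared distance, and (n \<Delta>)^(-1/2)
  when G^2 is bounded below by \<Delta> times one. The end weights are left to
  \<open>jac_boundary\<close>, since the radius degenerates there.\<close>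

lemma jac_le_interior:
  fixes n k :: nat
  assumes k: "0 < k" "k < n"
  shows "jac n k * sqrt (sqrt n) \<le> 4 * pi"
    "(jac n k)\<^sup>2 * \<bar>\<bar>real n - 2 * real k\<bar> - n / sqrt 2\<bar> \<le> (4 * pi)\<^sup>2"
proof -
  define C where "C = 1 - 2 * (k / n)"
  define s where "s = sqrt (1 - C\<^sup>2)"
  define r where "r = sqrt (k / (n - k))"
  have r0: "0 < r" using k by (simp add: r_def)
  have "\<bar>C\<bar> \<le> 1" unfolding C_def using k by (simp add: field_simps abs_le_iff)
  then have "C\<^sup>2 \<le> 1" by (simp add: abs_square_le_1)
  then have sC: "0 \<le> s" "C\<^sup>2 + s\<^sup>2 = 1" by (auto simp: s_def)
  define G where "G t = s * cos t - C" for t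
  have int_exp: "(\<lambda>t. exp (- (n * (G t)\<^sup>2 / 16))) integrable_on {-pi..pi}"
    unfolding G_def by (intro integrable_continuous_real continuous_intros) auto
  have jac_le: "jac n k \<le> integral {-pi..pi} (\<lambda>t. exp (- (n * (G t)\<^sup>2 / 16))) / (2 * pi)"
  proof -
    have "cmod (coeff (jac_poly n k) k) * r ^ k \<le>
      integral {-pi..pi} (\<lambda>t. cmod (poly (jac_poly n k) (of_real r * cis t))) / (2 * pi)"
      by (rule coeff_le_circle_integral[OF r0])
    also have "\<dots> \<le> integral {-pi..pi} (\<lambda>t. (sqrt 2 ^ n * r ^ k) * exp (- (n * (G t)\<^sup>2 / 16))) / (2 * pi)"
    proof (intro divide_right_mono integral_le)
      show "(\<lambda>t. (sqrt 2 ^ n * r ^ k) * exp (- (n * (G t)\<^sup>2 / 16))) integrable_on {-pi..pi}"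
        using int_exp by (rule integrable_on_mult_right)
      show "(\<lambda>t. cmod (poly (jac_poly n k) (of_real r * cis t))) integrable_on {-pi..pi}"
        by (intro integrable_continuous_real continuous_intros)
      show "cmod (poly (jac_poly n k) (of_real r * cis t)) \<le> (sqrt 2 ^ n * r ^ k) * exp (- (n * (G t)\<^sup>2 / 16))" for t
        using jac_poly_on_circle[OF k, of t] by (simp add: G_def s_def C_def r_def)
    qed simp
    also have "\<dots> = (sqrt 2 ^ n * r ^ k) * integral {-pi..pi} (\<lambda>t. exp (- (n * (G t)\<^sup>2 / 16))) / (2 * pi)"
      by simp
    finally show ?thesis using r0 by (simp add: jac_def field_simps)
  qed
  obtain t0 where t0: "\<And>t. t \<in> {-pi..pi} \<Longrightarrow> (\<bar>t\<bar> - t0)\<^sup>2 / pi\<^sup>2 \<le> \<bar>G t\<bar>"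
      "\<And>t. t \<in> {-pi..pi} \<Longrightarrow> \<bar>s - \<bar>C\<bar>\<bar> * ((\<bar>t\<bar> - t0)\<^sup>2 / pi\<^sup>2) \<le> (G t)\<^sup>2"
    using phase_lower_bound[OF sC] unfolding G_def by blast
  have gen: "jac n k \<le> c / m"
    if "0 < m" "0 \<le> c" and le: "\<And>t. t \<in> {-pi..pi} \<Longrightarrow>
      exp (- (n * (G t)\<^sup>2 / 16)) \<le> c * (1 / (1 + m\<^sup>2 * (\<bar>t\<bar> - t0)\<^sup>2))" for c m
  proof -
    have "integral {-pi..pi} (\<lambda>t. exp (- (n * (G t)\<^sup>2 / 16)))
      \<le> integral {-pi..pi} (\<lambda>t. c * (1 / (1 + m\<^sup>2 * (\<bar>t\<bar> - t0)\<^sup>2)))"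
      by (intro integral_le int_exp integrable_on_mult_right integral_inverse_quadratic_le le that)
    also have "\<dots> = c * integral {-pi..pi} (\<lambda>t. 1 / (1 + m\<^sup>2 * (\<bar>t\<bar> - t0)\<^sup>2))"
      by (rule integral_mult_right)
    also have "\<dots> \<le> c * (2 * pi / m)"
      by (intro mult_left_mono integral_inverse_quadratic_le that)
    finally have "jac n k \<le> (c * (2 * pi / m)) / (2 * pi)"
      by (intro order_trans[OF jac_le divide_right_mono]) auto
    then show ?thesis by simp
  qed
  have n0: "0 < n" using k by simp
  define R where "R = sqrt (sqrt n)"
  have R: "0 < R" "R\<^sup>2 = sqrt n" using n0 by (auto simp: R_def)
  \<comment> \<open>The scale \<open>R / (2 * pi)\<close> is chosen so that x^2 is at most n G^2 /
    16; the numerator 2 pays for passing from 1 / (1 + x^2) to 1 / (1 + x).\<close>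
  have "jac n k \<le> 2 / (R / (2 * pi))"
  proof (rule gen)
    fix t :: real assume t: "t \<in> {-pi..pi}"
    define x where "x = (R / (2 * pi))\<^sup>2 * (\<bar>t\<bar> - t0)\<^sup>2"
    have x_eq: "x = sqrt n / 4 * ((\<bar>t\<bar> - t0)\<^sup>2 / pi\<^sup>2)"
      by (simp add: x_def power_divide R power_mult_distrib)
    have x0: "0 \<le> x" by (simp add: x_def)
    have "((\<bar>t\<bar> - t0)\<^sup>2 / pi\<^sup>2)\<^sup>2 \<le> \<bar>G t\<bar>\<^sup>2" by (intro power_mono t0 t) simp
    then have "n / 16 * ((\<bar>t\<bar> - t0)\<^sup>2 / pi\<^sup>2)\<^sup>2 \<le> n / 16 * \<bar>G t\<bar>\<^sup>2" by (rule mult_left_mono) simp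
    moreover have "x\<^sup>2 = n / 16 * ((\<bar>t\<bar> - t0)\<^sup>2 / pi\<^sup>2)\<^sup>2"
      unfolding x_eq power_mult_distrib by (simp add: power_divide)
    ultimately have "x\<^sup>2 \<le> n * (G t)\<^sup>2 / 16" by simp
    then have "exp (- (n * (G t)\<^sup>2 / 16)) \<le> exp (- x\<^sup>2)" by simp
    also have "\<dots> \<le> 1 / (1 + x\<^sup>2)" by (rule exp_minus_le) simp
    also have "\<dots> \<le> 2 * (1 / (1 + x))"
    proof -
      have "1 + x \<le> 2 * (1 + x\<^sup>2)" 
      proof -
        have "2 * x \<le> x\<^sup>2 + 1" using sum_squares_bound[of x 1] by simp
        also have "\<dots> \<le> 2 * x\<^sup>2 + 1" by simp
        finally show ?thesis using x0 by simp
      qed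
      moreover have "0 < 1 + x\<^sup>2" by (simp add: add_pos_nonneg)
      ultimately show ?thesis using x0 by (simp add: divide_simps)
    qed
    finally show "exp (- (n * (G t)\<^sup>2 / 16)) \<le> 2 * (1 / (1 + (R / (2 * pi))\<^sup>2 * (\<bar>t\<bar> - t0)\<^sup>2))"
      unfolding x_def .
  qed (use R in auto)
  then show "jac n k * sqrt (sqrt n) \<le> 4 * pi"
    using R(1) unfolding R_def[symmetric] by (simp add: field_simps)
  define \<Delta> where "\<Delta> = \<bar>s - \<bar>C\<bar>\<bar>"
  have "(jac n k)\<^sup>2 * (n * \<Delta>) \<le> (4 * pi)\<^sup>2"
  proof (cases "\<Delta> = 0")
    case False
    define S where "S = sqrt (n * \<Delta>)"
    have S: "0 < S" "S\<^sup>2 = n * \<Delta>" using False n0 by (auto simp: S_def \<Delta>_def)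
    \<comment> \<open>Here x itself, not its square, lies below n G^2 / 16, so the scale absorbs the
      16 and the numerator is 1.\<close>
    have "jac n k \<le> 1 / (S / (4 * pi))"
    proof (rule gen)
      fix t :: real assume t: "t \<in> {-pi..pi}"
      define x where "x = (S / (4 * pi))\<^sup>2 * (\<bar>t\<bar> - t0)\<^sup>2"
      have x_eq: "x = n * (\<Delta> * ((\<bar>t\<bar> - t0)\<^sup>2 / pi\<^sup>2)) / 16"
        by (simp add: x_def power_divide S power_mult_distrib)
      have "x \<le> n * (G t)\<^sup>2 / 16"
        unfolding x_eq by (intro divide_right_mono mult_left_mono t0(2)[OF t, folded \<Delta>_def]) auto
      then have "exp (- (n * (G t)\<^sup>2 / 16)) \<le> exp (- x)" by simp
      also have "\<dots> \<le> 1 / (1 + x)" by (rule exp_minus_le) (simp add: x_def)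
      finally show "exp (- (n * (G t)\<^sup>2 / 16)) \<le> 1 * (1 / (1 + (S / (4 * pi))\<^sup>2 * (\<bar>t\<bar> - t0)\<^sup>2))"
        unfolding x_def by simp
    qed (use S in auto)
    then have "jac n k * S \<le> 4 * pi" using S(1) by (simp add: field_simps)
    then have "(jac n k * S)\<^sup>2 \<le> (4 * pi)\<^sup>2"
      using S(1) by (intro power_mono) (auto simp: jac_def)
    then show ?thesis by (simp add: power_mult_distrib S)
  qed simp
  moreover have "\<bar>\<bar>real n - 2 * real k\<bar> - n / sqrt 2\<bar> \<le> n * \<Delta>"
  proof -
    have half: "(1 / sqrt 2)\<^sup>2 = (1 / 2 :: real)" by (simp add: power_divide)
    \<comment> \<open>As C^2 + s^2 = 1, the numbers |C| and s lie on opposite sides of 1 / sqrt 2,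
      so their distance dominates that of |C| to 1 / sqrt 2.\<close>
    have "\<bar>\<bar>C\<bar> - 1 / sqrt 2\<bar> \<le> \<Delta>"
    proof (cases "1 / sqrt 2 \<le> \<bar>C\<bar>")
      case True
      then have "(1 / sqrt 2)\<^sup>2 \<le> \<bar>C\<bar>\<^sup>2" by (intro power_mono) auto
      then have "s\<^sup>2 \<le> (1 / sqrt 2)\<^sup>2" using sC(2) unfolding half by simp
      then have "s \<le> 1 / sqrt 2" by (rule power2_le_imp_le) simp
      with True show ?thesis by (simp add: \<Delta>_def)
    next
      case False
      then have "\<bar>C\<bar>\<^sup>2 \<le> (1 / sqrt 2)\<^sup>2" by (intro power_mono) auto
      then have "(1 / sqrt 2)\<^sup>2 \<le> s\<^sup>2" using sC(2) unfolding half by simp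
      then have "1 / sqrt 2 \<le> s" by (rule power2_le_imp_le) (rule sC(1))
      with False show ?thesis by (simp add: \<Delta>_def)
    qed
    then have "n * \<bar>\<bar>C\<bar> - 1 / sqrt 2\<bar> \<le> n * \<Delta>" by (rule mult_left_mono) simp
    also have "n * \<bar>\<bar>C\<bar> - 1 / sqrt 2\<bar> = \<bar>\<bar>n * C\<bar> - n / sqrt 2\<bar>"
    proof -
      have "\<bar>n * C\<bar> - n / sqrt 2 = n * (\<bar>C\<bar> - 1 / sqrt 2)"
        by (simp add: abs_mult right_diff_distrib)
      then show ?thesis by (simp only: abs_mult abs_of_nat)
    qed
    also have "n * C = real n - 2 * real k" using n0 by (simp add: C_def field_simps)
    finally show ?thesis .
  qed
  ultimately show "(jac n k)\<^sup>2 * \<bar>\<bar>real n - 2 * real k\<bar> - n / sqrt 2\<bar> \<le> (4 * pi)\<^sup>2"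
    by (meson mult_left_mono order_trans zero_le_power2)
qed

lemma jac_nonneg: "0 \<le> jac n k"
  by (simp add: jac_def)

lemma jac_boundary: "jac n 0 = 1 / sqrt 2 ^ n" "jac n n = 1 / sqrt 2 ^ n"
proof -
  have "coeff ([:c, 1:] ^ n) n = (1 :: complex)" for c
    using lead_coeff_power[of "[:c, 1:]" n] by (simp add: degree_power_eq)
  then show "jac n n = 1 / sqrt 2 ^ n" by (simp add: jac_def jac_poly_def)
  have "coeff ([:1, 1:] ^ n) 0 = (1 :: complex)"
    by (simp add: poly_0_coeff_0[symmetric])
  then show "jac n 0 = 1 / sqrt 2 ^ n" by (simp add: jac_def jac_poly_def)
qed

text \<open>Fourth powers turn n^(-1/4) into 1/n and the other bound into an inverse square, which
  together form a Lorentzian in k. At k = 0 and k = n the coefficient is 1, so \<open>jac\<close> is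
  2^(-n/2), far below both bounds.\<close>

lemma jac_pow4_le:
  fixes n k :: nat
  assumes "0 < n" "k \<le> n"
  shows "(jac n k) ^ 4 * n \<le> (4 * pi) ^ 4"
    "(jac n k) ^ 4 * (\<bar>real n - 2 * real k\<bar> - n / sqrt 2)\<^sup>2 \<le> (4 * pi) ^ 4"
proof -
  have pow4: "x ^ 4 = (x\<^sup>2)\<^sup>2" for x :: real by simp
  have "(jac n k) ^ 4 * n \<le> (4 * pi) ^ 4 \<and>
    (jac n k) ^ 4 * (\<bar>real n - 2 * real k\<bar> - n / sqrt 2)\<^sup>2 \<le> (4 * pi) ^ 4"
  proof (cases "0 < k \<and> k < n")
    case True
    then have "(jac n k * sqrt (sqrt n)) ^ 4 \<le> (4 * pi) ^ 4"
      by (intro power_mono jac_le_interior) (auto simp: jac_nonneg)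
    then have 1: "(jac n k) ^ 4 * n \<le> (4 * pi) ^ 4"
      by (simp add: power_mult_distrib pow4[of "sqrt (sqrt n)"])
    have "((jac n k)\<^sup>2 * \<bar>\<bar>real n - 2 * real k\<bar> - n / sqrt 2\<bar>)\<^sup>2 \<le> ((4 * pi)\<^sup>2)\<^sup>2"
      using True by (intro power_mono jac_le_interior) auto
    then show ?thesis using 1 unfolding pow4[symmetric] power_mult_distrib power2_abs by simp
  next
    case False
    then have "jac n k = 1 / sqrt 2 ^ n"
      using assms jac_boundary[of n] by (cases "k = 0") auto
    moreover have "(sqrt 2 ^ n) ^ 4 = ((2::real) ^ n) ^ 2"
    proof -
      have "(sqrt 2 ^ n)\<^sup>2 = (2::real) ^ n"
        by (metis power_mult mult.commute real_sqrt_pow2 zero_le_numeral)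
      then show ?thesis by (simp only: pow4)
    qed
    ultimately have j: "(jac n k) ^ 4 = 1 / (2 ^ n)\<^sup>2" by (simp add: power_divide)
    have n2: "real n \<le> 2 ^ n" using less_exp[of n] by (metis less_imp_le of_nat_le_iff of_nat_numeral of_nat_power)
    have nn: "(real n)\<^sup>2 \<le> (2 ^ n)\<^sup>2" using n2 by (intro power_mono) auto
    have "1 * real n \<le> real n * real n" using assms by (intro mult_right_mono) auto
    then have a: "(jac n k) ^ 4 * n \<le> 1"
      using nn unfolding j by (simp add: divide_le_eq power2_eq_square)
    have "\<bar>real n - 2 * real k\<bar> = n" using False assms by (cases "k = 0") auto
    moreover have "real n / sqrt 2 \<le> n / 1" by (intro divide_left_mono) auto
    ultimately have "(\<bar>real n - 2 * real k\<bar> - n / sqrt 2)\<^sup>2 \<le> (real n)\<^sup>2"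
      by (intro power_mono) auto
    then have b: "(jac n k) ^ 4 * (\<bar>real n - 2 * real k\<bar> - n / sqrt 2)\<^sup>2 \<le> 1"
      using order_trans[OF _ nn] unfolding j by (simp add: divide_le_eq)
    have "1 \<le> (4 * pi) ^ 4" using pi_gt3 by (intro one_le_power) auto
    with a b show ?thesis by linarith
  qed
  then show "(jac n k) ^ 4 * n \<le> (4 * pi) ^ 4"
    "(jac n k) ^ 4 * (\<bar>real n - 2 * real k\<bar> - n / sqrt 2)\<^sup>2 \<le> (4 * pi) ^ 4" by auto
qed

section \<open>Summation over weights and degrees\<close>

text \<open>Each term is bounded by an increment of the arctangent over an interval of length 2 /
  \<open>R\<close>. As 2k advances by 2 these intervals abut, so the increments telescope to at most
  pi. The 3 covers the variation of the derivative within one interval, using n \<ge> 1.\<close>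

lemma sum_inverse_quadratic_le:
  fixes n :: nat and b :: real
  assumes n: "0 < n"
  shows "(\<Sum>k\<le>n. 1 / (n + (2 * real k - b)\<^sup>2)) \<le> 3 * pi / (2 * sqrt n)"
proof -
  define R where "R = sqrt n"
  have n1: "1 \<le> real n" using n by simp
  have R: "1 \<le> R" "R\<^sup>2 = n" using n by (auto simp: R_def)
  define a where "a k = arctan ((2 * real k - b - 1) / R)" for k :: nat
  have "1 / (n + (2 * real k - b)\<^sup>2) \<le> 3 / (2 * R) * (a (Suc k) - a k)" for k :: nat
  proof -
    define x where "x = 2 * real k - b"
    have "(x - 1) / R < (x + 1) / R" using R by (intro divide_strict_right_mono) auto
    then obtain z where z: "(x - 1) / R < z" "z < (x + 1) / R"
      "arctan ((x + 1) / R) - arctan ((x - 1) / R) = ((x + 1) / R - (x - 1) / R) * inverse (1 + z\<^sup>2)"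
      using MVT2[of "(x - 1) / R" "(x + 1) / R" arctan "\<lambda>z. inverse (1 + z\<^sup>2)"] by (auto intro: DERIV_arctan)
    have zR: "x - 1 < z * R" "z * R < x + 1" using z(1,2) R by (auto simp: field_simps)
    have "(z * R)\<^sup>2 \<le> (\<bar>x\<bar> + 1)\<^sup>2" using zR by (subst abs_le_square_iff[symmetric]) auto
    also have "\<dots> \<le> 2 * x\<^sup>2 + 2" using sum_squares_bound[of "\<bar>x\<bar>" 1] by (simp add: power2_sum)
    finally have "z\<^sup>2 * R\<^sup>2 \<le> 2 * x\<^sup>2 + 2" by (simp only: power_mult_distrib)
    then have "R\<^sup>2 * (1 + z\<^sup>2) \<le> 3 * (n + x\<^sup>2)"
    proof -
      define w where "w = z\<^sup>2 * R\<^sup>2"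
      have "R\<^sup>2 * (1 + z\<^sup>2) = n + w" using R(2) by (simp add: w_def algebra_simps)
      moreover have "n + w \<le> 3 * (n + x\<^sup>2)"
      proof -
        have "w \<le> 2 * x\<^sup>2 + 2 * 1" using \<open>z\<^sup>2 * R\<^sup>2 \<le> 2 * x\<^sup>2 + 2\<close> by (simp add: w_def)
        also have "\<dots> \<le> 3 * x\<^sup>2 + 2 * real n" using n1 by (intro add_mono mult_left_mono mult_right_mono) auto
        finally show ?thesis by simp
      qed
      ultimately show ?thesis by (simp only:)
    qed
    moreover have "0 < 1 + z\<^sup>2" by (simp add: add_pos_nonneg)
    moreover have "0 < n + x\<^sup>2" using n by (simp add: add_pos_nonneg)
    ultimately have "3 / (3 * (n + x\<^sup>2)) \<le> 3 / (R\<^sup>2 * (1 + z\<^sup>2))"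
      using R n by (intro divide_left_mono mult_pos_pos) auto
    moreover have "3 / (3 * y) = 1 / y" for y :: real by simp
    ultimately have "1 / (n + x\<^sup>2) \<le> 3 / (R\<^sup>2 * (1 + z\<^sup>2))" by (simp only:)
    also have "\<dots> = 3 / (2 * R) * (arctan ((x + 1) / R) - arctan ((x - 1) / R))"
      unfolding z(3) using R by (simp add: field_simps power2_eq_square)
    finally show ?thesis by (simp add: a_def x_def algebra_simps)
  qed
  then have "(\<Sum>k\<le>n. 1 / (n + (2 * real k - b)\<^sup>2)) \<le> (\<Sum>k\<le>n. 3 / (2 * R) * (a (Suc k) - a k))"
    by (intro sum_mono)
  also have "\<dots> = 3 / (2 * R) * (a (Suc n) - a 0)"
    unfolding sum_distrib_left[symmetric] lessThan_Suc_atMost[symmetric] sum_lessThan_telescope ..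
  also have "\<dots> \<le> 3 / (2 * R) * pi"
    using R arctan_ubound[of "(2 * real (Suc n) - b - 1) / R"] arctan_lbound[of "(2 * real 0 - b - 1) / R"]
    by (intro mult_left_mono) (auto simp: a_def)
  finally show ?thesis by (simp add: R_def)
qed

text \<open>Adding the two fourth-power bounds gives one Lorentzian of width sqrt n around each
  turning point n - 2k = \<open>c\<close> and n - 2k = \<open>- c\<close>.\<close>

lemma sum_jac_pow4_le:
  assumes n: "0 < n"
  shows "(\<Sum>k\<le>n. jac n k ^ 4) \<le> 6 * pi * (4 * pi) ^ 4 / sqrt n"
proof -
  define c where "c = n / sqrt 2"
  have pos: "0 < n + x\<^sup>2" for x :: real using n by (simp add: add_pos_nonneg)
  have "jac n k ^ 4 \<le> 2 * (4 * pi) ^ 4 * (1 / (n + (2 * real k - (n - c))\<^sup>2) + 1 / (n + (2 * real k - (n + c))\<^sup>2))"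
    if "k \<le> n" for k
  proof -
    define y where "y = real n - 2 * real k"
    have "jac n k ^ 4 * (n + (\<bar>y\<bar> - c)\<^sup>2) \<le> 2 * (4 * pi) ^ 4"
      using jac_pow4_le[OF n that] by (simp add: y_def c_def distrib_left)
    then have "jac n k ^ 4 \<le> 2 * (4 * pi) ^ 4 * (1 / (n + (\<bar>y\<bar> - c)\<^sup>2))"
      using pos[of "\<bar>y\<bar> - c"] by (simp add: field_simps)
    also have "1 / (n + (\<bar>y\<bar> - c)\<^sup>2) \<le> 1 / (n + (y - c)\<^sup>2) + 1 / (n + (y + c)\<^sup>2)"
    proof (cases "0 \<le> y")
      case False
      then have "(\<bar>y\<bar> - c)\<^sup>2 = (y + c)\<^sup>2" by (simp add: power2_eq_square algebra_simps)
      then show ?thesis using less_imp_le[OF pos] by simp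
    qed (use less_imp_le[OF pos] in simp)
    also have "(y - c)\<^sup>2 = (2 * real k - (n - c))\<^sup>2"
      by (simp add: y_def power2_eq_square algebra_simps)
    also have "(y + c)\<^sup>2 = (2 * real k - (n + c))\<^sup>2"
      by (simp add: y_def power2_eq_square algebra_simps)
    finally show ?thesis by (simp add: mult_left_mono)
  qed
  then have "(\<Sum>k\<le>n. jac n k ^ 4) \<le>
    (\<Sum>k\<le>n. 2 * (4 * pi) ^ 4 * (1 / (n + (2 * real k - (n - c))\<^sup>2) + 1 / (n + (2 * real k - (n + c))\<^sup>2)))"
    by (intro sum_mono) auto
  also have "\<dots> = 2 * (4 * pi) ^ 4 * ((\<Sum>k\<le>n. 1 / (n + (2 * real k - (n - c))\<^sup>2)) + (\<Sum>k\<le>n. 1 / (n + (2 * real k - (n + c))\<^sup>2)))"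
    by (simp only: sum_distrib_left[symmetric] sum.distrib)
  also have "\<dots> \<le> 2 * (4 * pi) ^ 4 * (3 * pi / (2 * sqrt n) + 3 * pi / (2 * sqrt n))"
    by (intro mult_left_mono add_mono sum_inverse_quadratic_le n) simp
  also have "\<dots> = 6 * pi * (4 * pi) ^ 4 / sqrt n" by (simp add: field_simps)
  finally show ?thesis .
qed

text \<open>Of the q factors, q - 4 are estimated by the uniform bound \<open>b\<close> of order
  n^(-1/4), and the remaining four are summed over k.\<close>

lemma sum_jac_powr_le:
  fixes q :: real
  assumes n: "0 < n" and q: "4 \<le> q"
  shows "(\<Sum>k\<le>n. jac n k powr q) \<le> 6 * pi * (4 * pi) powr q * n powr (1 / 2 - q / 4)"
proof -
  define b where "b = 4 * pi * n powr (- (1 / 4))"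
  have b: "0 < b" using n by (simp add: b_def)
  have le: "jac n k powr q \<le> b powr (q - 4) * jac n k ^ 4" if "k \<le> n" for k
  proof (cases "jac n k = 0")
    case False
    then have pos: "0 < jac n k" using jac_nonneg[of n k] by simp
    have "jac n k ^ 4 * n \<le> (4 * pi) ^ 4" by (rule jac_pow4_le[OF n that])
    then have "jac n k ^ 4 \<le> (4 * pi) ^ 4 * n powr (- 1)"
      using n by (simp add: powr_minus_divide field_simps)
    also have "\<dots> = b ^ 4"
      using n by (simp add: b_def power_mult_distrib powr_power)
    finally have "jac n k \<le> b" using b by (simp add: power_mono_iff jac_nonneg)
    then have "jac n k powr (q - 4) \<le> b powr (q - 4)" using q pos by (intro powr_mono2) auto
    then have "jac n k powr (q - 4) * jac n k ^ 4 \<le> b powr (q - 4) * jac n k ^ 4"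
      by (rule mult_right_mono) (simp add: jac_nonneg)
    moreover have "jac n k powr q = jac n k powr (q - 4) * jac n k powr 4"
      by (simp only: powr_add[symmetric]) simp
    moreover have "jac n k powr 4 = jac n k ^ 4" using pos by simp
    ultimately show ?thesis by (simp only:)
  qed simp
  have "(\<Sum>k\<le>n. jac n k powr q) \<le> b powr (q - 4) * (\<Sum>k\<le>n. jac n k ^ 4)"
    unfolding sum_distrib_left by (intro sum_mono le) simp
  also have "\<dots> \<le> b powr (q - 4) * (6 * pi * (4 * pi) ^ 4 / sqrt n)"
    by (intro mult_left_mono sum_jac_pow4_le n) simp
  also have "\<dots> = 6 * pi * ((4 * pi) powr (q - 4) * (4 * pi) powr 4) * (n powr (- (1 / 4) * (q - 4)) * n powr (- (1 / 2)))"
  proof -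
    have "(n::real) powr (- (1 / 2)) = 1 / sqrt n"
      using n by (simp add: powr_minus_divide powr_half_sqrt)
    moreover have "b powr (q - 4) = (4 * pi) powr (q - 4) * n powr (- (1 / 4) * (q - 4))"
      by (simp only: b_def powr_mult powr_powr)
    moreover have "(4 * pi) powr 4 = (4 * pi) ^ 4" by simp
    ultimately show ?thesis by (simp only:) (simp only: mult_ac times_divide_eq_right times_divide_eq_left mult_1_left mult_1_right)
  qed
  also have "\<dots> = 6 * pi * (4 * pi) powr q * n powr (1 / 2 - q / 4)"
  proof -
    have "- (1 / 4) * (q - 4) + - (1 / 2) = 1 / 2 - q / 4" by (simp add: field_simps)
    then show ?thesis by (simp only: powr_add[symmetric]) simp
  qed
  finally show ?thesis .
qed

text \<open>Comparison with the integral of x^(-s): the term N^(1 - s) carried through the induction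
  absorbs each new summand by the mean value theorem.\<close>

lemma sum_powr_tail_le:
  fixes s :: real
  assumes s: "1 < s" and m: "0 < m"
  shows "(\<Sum>n=m..N. real n powr (- s)) \<le> s / (s - 1) * m powr (1 - s)"
proof (cases "m \<le> N")
  case True
  have "(\<Sum>n=m..N. real n powr (- s)) \<le> m powr (- s) + (m powr (1 - s) - N powr (1 - s)) / (s - 1)"
    using True
  proof (induction N rule: dec_induct)
    case (step N)
    have "\<exists>z::real. N < z \<and> z < real N + 1 \<and> (real N + 1) powr (1 - s) - N powr (1 - s) = (real N + 1 - N) * ((1 - s) * z powr (1 - s - 1))"
      using m step(1) by (intro MVT2) (auto intro!: derivative_eq_intros)
    then obtain z :: real where z: "N < z" "z < real N + 1" "(real N + 1) powr (1 - s) - N powr (1 - s) = (1 - s) * z powr (- s)"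
      by auto
    have "(s - 1) * (real N + 1) powr (- s) \<le> (s - 1) * z powr (- s)"
      using z(1,2) s by (intro mult_left_mono powr_mono2') auto
    also have "\<dots> = N powr (1 - s) - (real N + 1) powr (1 - s)" using z(3) by (simp add: algebra_simps)
    finally have "(real N + 1) powr (- s) \<le> (N powr (1 - s) - (real N + 1) powr (1 - s)) / (s - 1)"
      using s by (simp add: field_simps)
    then show ?case using step by (simp add: add.commute diff_divide_distrib)
  qed simp
  also have "\<dots> \<le> m powr (1 - s) + m powr (1 - s) / (s - 1)"
    using s m by (intro add_mono powr_mono divide_right_mono) auto
  also have "\<dots> = s / (s - 1) * m powr (1 - s)" using s by (simp add: field_simps)
  finally show ?thesis .
qed (use s in auto)

text \<open>Up to n = 1/\<delta> there are at most 1/\<delta> terms, each at most \<delta>^s with s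
  = q/4 - 3/2; beyond it the minimum is replaced by 2 and the tail sum applies. Both parts are of
  order \<delta>^(s - 1), and s - 1 = (q - 10) / 4 produces the pole at q = 10.\<close>

lemma sum_min_powr_le:
  fixes q \<delta> :: real
  assumes q: "10 < q" and \<delta>: "0 \<le> \<delta>"
  shows "(\<Sum>n=1..N. real n powr (3 / 2 - q / 4) * min 2 (n * \<delta>) powr q)
    \<le> 2 powr q * (2 * q / (q - 10)) * \<delta> powr (q / 4 - 5 / 2)"
proof (cases "\<delta> = 0")
  case False
  with \<delta> have \<delta>: "0 < \<delta>" by simp
  define s where "s = q / 4 - 3 / 2"
  have s: "1 < s" using q by (simp add: s_def)
  define A where "A = {n \<in> {1..N}. n * \<delta> \<le> 1}"
  let ?t = "\<lambda>n::nat. n powr (- s) * min 2 (n * \<delta>) powr q"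
  have "sum ?t A \<le> (\<Sum>n\<in>A. \<delta> powr s)"
  proof (rule sum_mono)
    fix n assume n: "n \<in> A"
    then have n': "0 < real n" "n \<le> 1 / \<delta>" using \<delta> by (auto simp: A_def field_simps)
    have "?t n \<le> n powr (- s) * (n * \<delta>) powr q"
      using n' \<delta> q by (intro mult_left_mono powr_mono2) auto
    also have "\<dots> = n powr (q - s) * \<delta> powr q"
      using n' \<delta> by (simp add: powr_mult powr_diff powr_minus field_simps)
    also have "\<dots> \<le> (1 / \<delta>) powr (q - s) * \<delta> powr q"
      using n' q by (intro mult_right_mono powr_mono2) (auto simp: s_def)
    also have "\<dots> = \<delta> powr s"
      using \<delta> by (simp add: powr_divide powr_diff)
    finally show "?t n \<le> \<delta> powr s" .
  qed
  also have "\<dots> = card A * \<delta> powr s" by simp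
  also have "\<dots> \<le> (1 / \<delta>) * \<delta> powr s"
  proof (rule mult_right_mono)
    have "A \<subseteq> {1..nat \<lfloor>1 / \<delta>\<rfloor>}"
      using \<delta> by (auto simp: A_def field_simps le_nat_floor)
    then have "card A \<le> nat \<lfloor>1 / \<delta>\<rfloor>" using card_mono[of "{1..nat \<lfloor>1 / \<delta>\<rfloor>}" A] by simp
    then have "real (card A) \<le> real (nat \<lfloor>1 / \<delta>\<rfloor>)" by simp
    also have "\<dots> \<le> 1 / \<delta>" using \<delta> by simp
    finally show "real (card A) \<le> 1 / \<delta>" .
  qed simp
  also have "\<dots> = \<delta> powr (s - 1)" using \<delta> by (simp add: powr_diff)
  finally have sumA: "sum ?t A \<le> \<delta> powr (s - 1)" .
  define m where "m = (LEAST n::nat. 1 < n * \<delta>)"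
  obtain n0 :: nat where "1 < n0 * \<delta>" using reals_Archimedean3[OF \<delta>] by blast
  then have m1: "1 < m * \<delta>" unfolding m_def by (rule LeastI)
  then have m: "0 < m" by (intro gr0I) auto
  have m_le: "m \<le> n" if "1 < n * \<delta>" for n :: nat unfolding m_def using that by (rule Least_le)
  have "sum ?t ({1..N} - A) \<le> (\<Sum>n=m..N. 2 powr q * real n powr (- s))"
  proof (rule sum_mono2[THEN order_trans[rotated]])
    show "sum ?t ({1..N} - A) \<le> (\<Sum>n\<in>{1..N} - A. 2 powr q * real n powr (- s))"
    proof (rule sum_mono)
      fix n assume "n \<in> {1..N} - A"
      have "min 2 (n * \<delta>) powr q \<le> 2 powr q" using q \<delta> by (intro powr_mono2) auto
      then show "?t n \<le> 2 powr q * real n powr (- s)"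
        by (subst mult.commute) (rule mult_right_mono, auto)
    qed
    show "{1..N} - A \<subseteq> {m..N}" by (auto simp: A_def intro!: m_le)
  qed auto
  also have "\<dots> \<le> 2 powr q * (s / (s - 1) * m powr (1 - s))"
    unfolding sum_distrib_left[symmetric] by (intro mult_left_mono sum_powr_tail_le s m) auto
  also have "\<dots> \<le> 2 powr q * (s / (s - 1) * (1 / \<delta>) powr (1 - s))"
    using m1 m \<delta> s by (intro mult_left_mono powr_mono2') (auto simp: field_simps)
  also have "(1 / \<delta>) powr (1 - s) = \<delta> powr (s - 1)"
    using \<delta> by (simp add: powr_divide powr_minus_divide[symmetric])
  finally have sumB: "sum ?t ({1..N} - A) \<le> 2 powr q * (s / (s - 1) * \<delta> powr (s - 1))" .
  have "sum ?t {1..N} = sum ?t ({1..N} - A) + sum ?t A"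
    by (rule sum.subset_diff) (auto simp: A_def)
  also have "\<dots> \<le> 2 powr q * (s / (s - 1) * \<delta> powr (s - 1)) + 2 powr q * \<delta> powr (s - 1)"
  proof (rule add_mono[OF sumB order_trans[OF sumA]])
    have "1 \<le> (2::real) powr q" using q by (intro ge_one_powr_ge_zero) auto
    then show "\<delta> powr (s - 1) \<le> 2 powr q * \<delta> powr (s - 1)"
      using mult_right_mono[of 1 "2 powr q" "\<delta> powr (s - 1)"] by simp
  qed
  also have "\<dots> = 2 powr q * (s / (s - 1) + 1) * \<delta> powr (s - 1)" by (simp add: algebra_simps)
  also have "\<dots> \<le> 2 powr q * (2 * q / (q - 10)) * \<delta> powr (s - 1)"
  proof (intro mult_right_mono mult_left_mono)
    have "s / (s - 1) + 1 = (2 * q - 16) / (q - 10)" using q by (simp add: s_def field_simps)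
    also have "\<dots> \<le> 2 * q / (q - 10)" using q by (intro divide_right_mono) auto
    finally show "s / (s - 1) + 1 \<le> 2 * q / (q - 10)" .
  qed auto
  finally show ?thesis by (simp add: s_def)
qed (use q in simp)

lemma sum_eigenvalue_bound:
  fixes q \<delta> :: real
  assumes q: "10 < q" and \<delta>: "0 \<le> \<delta>"
  shows "(\<Sum>n\<le>N. \<Sum>k\<le>n. \<Sum>l\<le>n. (jac n k * min 2 (n * \<delta>)) powr q)
    \<le> 12 * pi * (4 * pi) powr q * (2 powr q * (2 * q / (q - 10)) * \<delta> powr (q / 4 - 5 / 2))"
proof -
  have "(\<Sum>n\<le>N. \<Sum>k\<le>n. \<Sum>l\<le>n. (jac n k * min 2 (n * \<delta>)) powr q) =
    (\<Sum>n\<le>N. (real n + 1) * min 2 (n * \<delta>) powr q * (\<Sum>k\<le>n. jac n k powr q))"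
    by (simp add: sum_distrib_left sum_distrib_right powr_mult jac_nonneg \<delta> mult_ac add_ac)
  \<comment> \<open>Degree 0 contributes nothing, since the eigenvalue on constants is independent
    of \<theta>; for the other degrees the multiplicity n + 1 is at most 2n.\<close>
  also have "\<dots> = (\<Sum>n=1..N. (real n + 1) * min 2 (n * \<delta>) powr q * (\<Sum>k\<le>n. jac n k powr q))"
    using q by (intro sum.mono_neutral_right) (auto simp: not_less_eq_eq)
  also have "\<dots> \<le> (\<Sum>n=1..N. 12 * pi * (4 * pi) powr q * (real n powr (3 / 2 - q / 4) * min 2 (n * \<delta>) powr q))"
  proof (rule sum_mono)
    fix n assume "n \<in> {1..N}"
    then have n: "0 < n" by simp
    have "(real n + 1) * min 2 (n * \<delta>) powr q * (\<Sum>k\<le>n. jac n k powr q)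
      \<le> (2 * real n) * min 2 (n * \<delta>) powr q * (6 * pi * (4 * pi) powr q * n powr (1 / 2 - q / 4))"
      using n q by (intro mult_mono sum_jac_powr_le) (auto intro!: sum_nonneg)
    also have "\<dots> = 12 * pi * (4 * pi) powr q * ((n powr 1 * n powr (1 / 2 - q / 4)) * min 2 (n * \<delta>) powr q)"
      by simp
    also have "n powr 1 * n powr (1 / 2 - q / 4) = n powr (3 / 2 - q / 4)"
      by (simp only: powr_add[symmetric]) simp
    finally show "(real n + 1) * min 2 (n * \<delta>) powr q * (\<Sum>k\<le>n. jac n k powr q)
      \<le> 12 * pi * (4 * pi) powr q * (real n powr (3 / 2 - q / 4) * min 2 (n * \<delta>) powr q)" .
  qed
  also have "\<dots> = 12 * pi * (4 * pi) powr q * (\<Sum>n=1..N. real n powr (3 / 2 - q / 4) * min 2 (n * \<delta>) powr q)"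
    by (simp only: sum_distrib_left)
  also have "\<dots> \<le> 12 * pi * (4 * pi) powr q * (2 powr q * (2 * q / (q - 10)) * \<delta> powr (q / 4 - 5 / 2))"
    by (intro mult_left_mono sum_min_powr_le assms) auto
  finally show ?thesis .
qed

lemma powr_self_inverse_le:
  fixes q :: real
  assumes "1 < q" shows "q powr (1 / q) \<le> 2"
proof -
  have "q \<le> 2 powr q"
  proof -
    have "ln q / ln 2 \<le> q"
    proof -
      have "ln q = 2 * ln (sqrt q)" using assms by (simp add: ln_sqrt)
      also have "\<dots> \<le> 2 * (sqrt q - 1)" using ln_le_minus_one[of "sqrt q"] assms by simp
      also have "\<dots> \<le> q / 2"
        using zero_le_power2[of "sqrt q - 2"] assms by (simp add: power2_diff)
      also have "\<dots> \<le> q * ln 2"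
        using assms mult_left_mono[of "1 / 2" "ln 2" q] ln2_ge_two_thirds by simp
      finally show ?thesis by (simp add: field_simps)
    qed
    then have "log 2 q \<le> q" by (simp add: log_def)
    then show ?thesis using assms by (simp add: log_le_iff)
  qed
  then have "q powr (1 / q) \<le> (2 powr q) powr (1 / q)" using assms by (intro powr_mono2) auto
  then show ?thesis using assms by (simp add: powr_powr)
qed

text \<open>Under the q-th root every factor except (q - 10)^(-1) and the power of \<delta> stays
  bounded: (24 pi)^(1/q) by 24 pi, q^(1/q) by 2, and (8 pi)^q becomes 8 pi. With the leading 2 these
  multiply to 768 pi^2.\<close>

lemma schatten_constant_bound:
  fixes q \<delta> :: real
  assumes q: "10 < q" and \<delta>: "0 \<le> \<delta>"
  shows "2 * (12 * pi * (4 * pi) powr q * (2 powr q * (2 * q / (q - 10)) * \<delta> powr (q / 4 - 5 / 2))) powr (1 / q)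
    \<le> 768 * pi\<^sup>2 * (q - 10) powr (- 1 / q) * \<delta> powr (1 / 4 - 5 / (2 * q))"
proof -
  have "12 * pi * (4 * pi) powr q * (2 powr q * (2 * q / (q - 10)) * \<delta> powr (q / 4 - 5 / 2)) =
     (24 * pi) * q * (8 * pi) powr q * (q - 10) powr (- 1) * \<delta> powr (q / 4 - 5 / 2)"
    using q powr_mult[of "4 * pi" 2 q] by (simp add: powr_minus_divide)
  then have "(12 * pi * (4 * pi) powr q * (2 powr q * (2 * q / (q - 10)) * \<delta> powr (q / 4 - 5 / 2))) powr (1 / q) =
    (24 * pi) powr (1 / q) * q powr (1 / q) * (8 * pi) powr (q * (1 / q)) * (q - 10) powr (- 1 * (1 / q)) * \<delta> powr ((q / 4 - 5 / 2) * (1 / q))"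
    by (simp only: powr_mult powr_powr)
  also have "(q / 4 - 5 / 2) * (1 / q) = 1 / 4 - 5 / (2 * q)" using q by (simp add: field_simps)
  also have "q * (1 / q) = 1" using q by simp
  also have "- 1 * (1 / q) = - 1 / q" by simp
  also have "(24 * pi) powr (1 / q) * q powr (1 / q) * (8 * pi) powr 1 * (q - 10) powr (- 1 / q) * \<delta> powr (1 / 4 - 5 / (2 * q))
    \<le> (24 * pi) * 2 * (8 * pi) * (q - 10) powr (- 1 / q) * \<delta> powr (1 / 4 - 5 / (2 * q))"
  proof (intro mult_right_mono mult_mono)
    have "(24 * pi) powr (1 / q) \<le> (24 * pi) powr 1"
      using q pi_gt3 by (intro powr_mono) auto
    then show "(24 * pi) powr (1 / q) \<le> 24 * pi" using pi_gt_zero by simp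
    show "q powr (1 / q) \<le> 2" using q by (intro powr_self_inverse_le) auto
  qed auto
  finally show ?thesis by (simp add: power2_eq_square mult_ac)
qed

subsection \<open>Schatten norms of diagonalizable operators\<close>

lemma L2_borel: "L2 M f \<Longrightarrow> f \<in> borel_measurable M"
  by (simp add: L2_def)

lemma L2_square_integrable: "L2 M f \<Longrightarrow> integrable M (\<lambda>x. (cmod (f x))\<^sup>2)"
  unfolding L2_def by (intro integrableI_nonneg) auto

lemma L2_iff: "L2 M f \<longleftrightarrow> f \<in> borel_measurable M \<and> integrable M (\<lambda>x. (cmod (f x))\<^sup>2)"
proof
  assume "f \<in> borel_measurable M \<and> integrable M (\<lambda>x. (cmod (f x))\<^sup>2)"
  then show "L2 M f"
    unfolding L2_def using nn_integral_eq_integral[of M "\<lambda>x. (cmod (f x))\<^sup>2"] by simp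
qed (simp add: L2_square_integrable L2_borel)

lemma L2_cmult: "L2 M f \<Longrightarrow> L2 M (\<lambda>x. c * f x)"
  by (auto simp: L2_iff norm_mult power_mult_distrib)

lemma cmod_add_square_le: "(cmod (a + b))\<^sup>2 \<le> 2 * (cmod a)\<^sup>2 + 2 * (cmod b)\<^sup>2"
proof -
  have "(cmod (a + b))\<^sup>2 \<le> (cmod a + cmod b)\<^sup>2"
    by (simp add: norm_triangle_ineq power_mono)
  also have "\<dots> \<le> 2 * (cmod a)\<^sup>2 + 2 * (cmod b)\<^sup>2"
    using sum_squares_bound[of "cmod a" "cmod b"] by (simp add: power2_sum)
  finally show ?thesis .
qed

lemma L2_add:
  assumes "L2 M f" "L2 M g" shows "L2 M (\<lambda>x. f x + g x)"
proof -
  have [measurable]: "f \<in> borel_measurable M" "g \<in> borel_measurable M"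
    using assms by (auto simp: L2_iff)
  have "integrable M (\<lambda>x. (cmod (f x + g x))\<^sup>2)"
  proof (rule Bochner_Integration.integrable_bound)
    show "integrable M (\<lambda>x. 2 * (cmod (f x))\<^sup>2 + 2 * (cmod (g x))\<^sup>2)"
      using assms by (auto simp: L2_iff)
    show "AE x in M. norm ((cmod (f x + g x))\<^sup>2) \<le> norm (2 * (cmod (f x))\<^sup>2 + 2 * (cmod (g x))\<^sup>2)"
      by (rule AE_I2) (simp add: cmod_add_square_le)
  qed measurable
  then show ?thesis by (simp add: L2_iff)
qed

lemma L2_zero: "L2 M (\<lambda>x. 0)"
  by (simp add: L2_iff)

lemma L2_diff:
  assumes "L2 M f" "L2 M g" shows "L2 M (\<lambda>x. f x - g x)"
  using L2_add[OF assms(1) L2_cmult[OF assms(2), of "-1"]] by simp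

lemma L2_sum: "(\<And>i. i \<in> A \<Longrightarrow> L2 M (f i)) \<Longrightarrow> L2 M (\<lambda>x. \<Sum>i\<in>A. f i x)"
  by (induction A rule: infinite_finite_induct) (auto intro: L2_zero L2_add)

lemma borel_measurable_cnj [measurable (raw)]:
  "f \<in> borel_measurable M \<Longrightarrow> (\<lambda>x. cnj (f x)) \<in> borel_measurable M"
  by (erule measurable_compose[OF _ borel_measurable_continuous_onI]) (intro continuous_intros)

lemma L2_inner_integrable:
  assumes "L2 M f" "L2 M g" shows "integrable M (\<lambda>x. f x * cnj (g x))"
proof (rule Bochner_Integration.integrable_bound)
  show "integrable M (\<lambda>x. (cmod (f x))\<^sup>2 + (cmod (g x))\<^sup>2)"
    using assms by (auto simp: L2_iff)
  have [measurable]: "f \<in> borel_measurable M" "g \<in> borel_measurable M"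
    using assms by (auto simp: L2_iff)
  show "(\<lambda>x. f x * cnj (g x)) \<in> borel_measurable M"
    by measurable
  have "cmod a * cmod b \<le> (cmod a)\<^sup>2 + (cmod b)\<^sup>2" for a b
    using sum_squares_bound[of "cmod a" "cmod b"] mult_nonneg_nonneg[OF norm_ge_zero[of a] norm_ge_zero[of b]]
    unfolding mult.assoc by linarith
  then show "AE x in M. norm (f x * cnj (g x)) \<le> norm ((cmod (f x))\<^sup>2 + (cmod (g x))\<^sup>2)"
    by (intro AE_I2) (simp add: norm_mult)
qed

lemma l2inner_cnj: "l2inner M g f = cnj (l2inner M f g)"
  using Bochner_Integration.integral_cnj[of M "\<lambda>x. f x * cnj (g x)"] unfolding l2inner_def
  by (simp add: mult.commute del: Bochner_Integration.integral_cnj)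

lemma l2inner_diff_left:
  "L2 M f \<Longrightarrow> L2 M g \<Longrightarrow> L2 M h \<Longrightarrow> l2inner M (\<lambda>x. f x - g x) h = l2inner M f h - l2inner M g h"
  unfolding l2inner_def by (simp add: left_diff_distrib L2_inner_integrable)

lemma l2inner_add_left:
  "L2 M f \<Longrightarrow> L2 M g \<Longrightarrow> L2 M h \<Longrightarrow> l2inner M (\<lambda>x. f x + g x) h = l2inner M f h + l2inner M g h"
  unfolding l2inner_def by (simp add: distrib_right L2_inner_integrable)

lemma l2inner_cmult_left: "l2inner M (\<lambda>x. c * f x) h = c * l2inner M f h"
  unfolding l2inner_def by (simp add: mult.assoc)

lemma l2inner_zero_left: "l2inner M (\<lambda>x. 0) h = 0"
  unfolding l2inner_def by simp

lemma l2inner_sum_left: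
  "(\<And>i. i \<in> A \<Longrightarrow> L2 M (f i)) \<Longrightarrow> L2 M h \<Longrightarrow>
   l2inner M (\<lambda>x. \<Sum>i\<in>A. f i x) h = (\<Sum>i\<in>A. l2inner M (f i) h)"
  by (induction A rule: infinite_finite_induct)
    (auto simp: l2inner_zero_left l2inner_add_left L2_sum)

lemma l2inner_diff_right:
  "L2 M f \<Longrightarrow> L2 M g \<Longrightarrow> L2 M h \<Longrightarrow> l2inner M h (\<lambda>x. f x - g x) = l2inner M h f - l2inner M h g"
  using l2inner_diff_left[of M f g h] by (simp add: l2inner_cnj[of M h])

lemma l2inner_cmult_right: "l2inner M h (\<lambda>x. c * f x) = cnj c * l2inner M h f"
  using l2inner_cmult_left[of M c f h] by (simp add: l2inner_cnj[of M h])

lemma l2inner_sum_right: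
  "(\<And>i. i \<in> A \<Longrightarrow> L2 M (f i)) \<Longrightarrow> L2 M h \<Longrightarrow>
   l2inner M h (\<lambda>x. \<Sum>i\<in>A. f i x) = (\<Sum>i\<in>A. l2inner M h (f i))"
  using l2inner_sum_left[of A M f h] by (simp add: l2inner_cnj[of M h])

lemma l2inner_self: "l2inner M f f = of_real (\<integral>x. (cmod (f x))\<^sup>2 \<partial>M)"
  unfolding l2inner_def integral_complex_of_real[symmetric] complex_norm_square ..

text \<open>Lets null vectors stay in an orthogonal family: their coefficients vanish, which agrees
  with quotients by a zero norm being 0.\<close>

lemma l2inner_self_zero:
  assumes "L2 M e" "L2 M f" "l2inner M e e = 0" shows "l2inner M f e = 0"
proof -
  have "(\<integral>x. (cmod (e x))\<^sup>2 \<partial>M) = 0"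
    using assms(3) unfolding l2inner_self by simp
  then have "AE x in M. (cmod (e x))\<^sup>2 = 0"
    by (subst (asm) integral_nonneg_eq_0_iff_AE) (use assms in \<open>auto simp: L2_iff\<close>)
  then have "AE x in M. f x * cnj (e x) = 0"
    by eventually_elim simp
  then show ?thesis unfolding l2inner_def by (simp add: integral_eq_zero_AE)
qed

section \<open>Gram-Schmidt orthogonalization and Bessel's inequality\<close>

text \<open>Dependent vectors are kept and become null vectors, whose later projections vanish
  because division by zero gives 0. The output thus stays indexed like the input, so the eigenvalue
  sequence can be carried along unchanged.\<close>

function gram_schmidt :: "'a measure \<Rightarrow> (nat \<Rightarrow> 'a \<Rightarrow> complex) \<Rightarrow> nat \<Rightarrow> 'a \<Rightarrow> complex" where
  "gram_schmidt M f n = (\<lambda>x. f n x - (\<Sum>j<n.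
     (l2inner M (f n) (gram_schmidt M f j) / l2inner M (gram_schmidt M f j) (gram_schmidt M f j))
        * gram_schmidt M f j x))"
  by auto
termination by (relation "Wellfounded.measure (\<lambda>(M, f, n). n)") auto

declare gram_schmidt.simps [simp del]

lemma L2_gram_schmidt:
  assumes "\<And>i. L2 M (f i)" shows "L2 M (gram_schmidt M f n)"
proof (induction n rule: less_induct)
  case (less n)
  show ?case
    by (subst gram_schmidt.simps) (intro L2_diff assms L2_sum L2_cmult less, simp)
qed

lemma gram_schmidt_orthogonal_less:
  assumes f: "\<And>i. L2 M (f i)" and "k < n"
  shows "l2inner M (gram_schmidt M f n) (gram_schmidt M f k) = 0"
  using \<open>k < n\<close>
proof (induction n arbitrary: k rule: less_induct)
  case (less n)
  let ?e = "gram_schmidt M f"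
  have L: "L2 M (?e j)" for j using L2_gram_schmidt[of M f, OF f] .
  have orth: "l2inner M (?e j) (?e k) = 0" if "j < n" "j \<noteq> k" for j
  proof (cases "j < k")
    case True
    then show ?thesis using less.IH[of k j] less.prems l2inner_cnj[of M "?e j" "?e k"] by simp
  next
    case False
    then show ?thesis using that less.IH[of j k] by simp
  qed
  have "l2inner M (?e n) (?e k) = l2inner M (f n) (?e k) -
     (\<Sum>j<n. l2inner M (f n) (?e j) / l2inner M (?e j) (?e j) * l2inner M (?e j) (?e k))"
    by (subst gram_schmidt.simps)
      (simp add: l2inner_diff_left l2inner_sum_left l2inner_cmult_left f L L2_sum L2_cmult
        del: times_divide_eq_left)
  also have "(\<Sum>j<n. l2inner M (f n) (?e j) / l2inner M (?e j) (?e j) * l2inner M (?e j) (?e k)) =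
     (\<Sum>j\<in>{k}. l2inner M (f n) (?e j) / l2inner M (?e j) (?e j) * l2inner M (?e j) (?e k))"
    using less.prems orth by (intro sum.mono_neutral_right) auto
  also have "\<dots> = l2inner M (f n) (?e k)"
    using l2inner_self_zero[OF L f, of k n] by auto
  finally show ?case by simp
qed

lemma gram_schmidt_orthogonal:
  assumes f: "\<And>i. L2 M (f i)" and "k \<noteq> n"
  shows "l2inner M (gram_schmidt M f n) (gram_schmidt M f k) = 0"
  using gram_schmidt_orthogonal_less[of M f, OF f, of k n] gram_schmidt_orthogonal_less[of M f, OF f, of n k]
    l2inner_cnj[of M "gram_schmidt M f n" "gram_schmidt M f k"] \<open>k \<noteq> n\<close>
  by (cases "k < n") auto

text \<open>Vectors are only subtracted within one eigenspace, because eigenvectors of a normal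
  operator for distinct eigenvalues are already orthogonal.\<close>
lemma gram_schmidt_eigen:
  assumes f: "\<And>i. L2 M (f i)" and T: "\<And>g. L2 M g \<Longrightarrow> L2 M (T g)"
    and eig: "\<And>i. l2inner M (T (f i)) = l2inner M (\<lambda>x. \<Lambda> i * f i x)"
    and adj: "\<And>g i. L2 M g \<Longrightarrow> l2inner M (T g) (f i) = \<Lambda> i * l2inner M g (f i)"
    and g: "L2 M g"
  shows "l2inner M (T g) (gram_schmidt M f n) = \<Lambda> n * l2inner M g (gram_schmidt M f n)"
  using g
proof (induction n arbitrary: g rule: less_induct)
  case (less n)
  let ?e = "gram_schmidt M f"
  let ?c = "\<lambda>j. l2inner M (f n) (?e j) / l2inner M (?e j) (?e j)"
  have L: "L2 M (?e j)" for j using L2_gram_schmidt[of M f, OF f] .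
  have expand: "l2inner M h (?e n) = l2inner M h (f n) - (\<Sum>j<n. cnj (?c j) * l2inner M h (?e j))"
    if "L2 M h" for h
    using that by (subst gram_schmidt.simps)
      (simp add: l2inner_diff_right l2inner_sum_right l2inner_cmult_right f L L2_sum L2_cmult
        del: times_divide_eq_left complex_cnj_divide)
  \<comment> \<open>The induction hypothesis for the vector \<open>f n\<close>, itself an
    eigenvector, shows that either its overlap with \<open>?e j\<close> is 0 or the two eigenvalues
    agree.\<close>
  have c_eq: "cnj (?c j) * (\<Lambda> j * l2inner M g (?e j)) = \<Lambda> n * (cnj (?c j) * l2inner M g (?e j))" if "j < n" for j
  proof -
    have "\<Lambda> j * l2inner M (f n) (?e j) = \<Lambda> n * l2inner M (f n) (?e j)"
      using less.IH[OF that f, of n] unfolding eig l2inner_cmult_left by (rule sym)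
    then have "l2inner M (f n) (?e j) = 0 \<or> \<Lambda> j = \<Lambda> n"
      unfolding mult_cancel_right by blast
    then show ?thesis by auto
  qed
  have "(\<Sum>j<n. cnj (?c j) * l2inner M (T g) (?e j)) = \<Lambda> n * (\<Sum>j<n. cnj (?c j) * l2inner M g (?e j))"
    unfolding sum_distrib_left
  proof (rule sum.cong)
    fix j assume "j \<in> {..<n}"
    then have j: "j < n" by simp
    show "cnj (?c j) * l2inner M (T g) (?e j) = \<Lambda> n * (cnj (?c j) * l2inner M g (?e j))"
      unfolding less.IH[OF j less.prems] by (rule c_eq[OF j])
  qed simp
  then show ?case
    unfolding expand[OF T[OF less.prems]] expand[OF less.prems] adj[OF less.prems]
    by (simp only: right_diff_distrib)
qed

definition onb_or_zero :: "'a measure \<Rightarrow> (nat \<Rightarrow> 'a \<Rightarrow> complex) \<Rightarrow> bool" where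
  "onb_or_zero M e \<longleftrightarrow> (\<forall>i. L2 M (e i)) \<and> (\<forall>i j. i \<noteq> j \<longrightarrow> l2inner M (e i) (e j) = 0) \<and>
     (\<forall>i. l2inner M (e i) (e i) = 0 \<or> l2inner M (e i) (e i) = 1)"

lemma onb_or_zeroD:
  assumes "onb_or_zero M e"
  shows "L2 M (e i)" "i \<noteq> j \<Longrightarrow> l2inner M (e i) (e j) = 0"
    "l2inner M (e i) (e i) = 0 \<or> l2inner M (e i) (e i) = 1"
  using assms unfolding onb_or_zero_def by auto

text \<open>Completing the square in the coefficients \<open>c\<close>. The optimal choice of
  \<open>c\<close> gives Bessel's inequality; for an arbitrary \<open>c\<close> the last sum is
  nonnegative, which bounds the norm of \<open>g\<close> by its Bessel sum plus the approximation
  error.\<close>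

lemma l2_expand_square:
  assumes e: "onb_or_zero M e" and g: "L2 M g" and A: "finite A"
  shows "(\<integral>x. (cmod (g x - (\<Sum>i\<in>A. c i * e i x)))\<^sup>2 \<partial>M) =
    (\<integral>x. (cmod (g x))\<^sup>2 \<partial>M) - (\<Sum>i\<in>A. (cmod (l2inner M g (e i)))\<^sup>2)
      + (\<Sum>i\<in>A. (cmod (l2inner M g (e i) - c i * l2inner M (e i) (e i)))\<^sup>2)"
proof -
  note L = onb_or_zeroD(1)[OF e]
  let ?s = "\<lambda>x. \<Sum>i\<in>A. c i * e i x"
  have Ls: "L2 M ?s" by (intro L2_sum L2_cmult L)
  have ss: "l2inner M ?s (e j) = c j * l2inner M (e j) (e j)" if "j \<in> A" for j
  proof -
    have "l2inner M ?s (e j) = (\<Sum>i\<in>A. c i * l2inner M (e i) (e j))"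
      by (simp add: l2inner_sum_left l2inner_cmult_left L L2_cmult)
    also have "\<dots> = (\<Sum>i\<in>{j}. c i * l2inner M (e i) (e j))"
      using A that onb_or_zeroD(2)[OF e] by (intro sum.mono_neutral_right) auto
    finally show ?thesis by simp
  qed
  have right: "l2inner M h ?s = (\<Sum>i\<in>A. cnj (c i) * l2inner M h (e i))" if "L2 M h" for h
    using that by (simp add: l2inner_sum_right l2inner_cmult_right L L2_cmult)
  have "l2inner M (\<lambda>x. g x - ?s x) (\<lambda>x. g x - ?s x) =
     l2inner M g g - l2inner M g ?s - l2inner M ?s g + l2inner M ?s ?s"
    using g Ls by (simp add: l2inner_diff_left l2inner_diff_right L2_diff)
  also have "l2inner M ?s g = cnj (l2inner M g ?s)" by (rule l2inner_cnj)
  also have "l2inner M g g - l2inner M g ?s - cnj (l2inner M g ?s) + l2inner M ?s ?s =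
    l2inner M g g + (\<Sum>i\<in>A. - (cnj (c i) * l2inner M g (e i)) - c i * cnj (l2inner M g (e i))
       + cnj (c i) * (c i * l2inner M (e i) (e i)))"
    by (simp add: right g Ls ss sum.distrib sum_subtractf sum_negf)
  also have "(\<Sum>i\<in>A. - (cnj (c i) * l2inner M g (e i)) - c i * cnj (l2inner M g (e i))
       + cnj (c i) * (c i * l2inner M (e i) (e i))) =
    (\<Sum>i\<in>A. complex_of_real ((cmod (l2inner M g (e i) - c i * l2inner M (e i) (e i)))\<^sup>2 - (cmod (l2inner M g (e i)))\<^sup>2))"
  proof (rule sum.cong)
    fix i assume "i \<in> A"
    show "- (cnj (c i) * l2inner M g (e i)) - c i * cnj (l2inner M g (e i))
       + cnj (c i) * (c i * l2inner M (e i) (e i)) =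
       complex_of_real ((cmod (l2inner M g (e i) - c i * l2inner M (e i) (e i)))\<^sup>2 - (cmod (l2inner M g (e i)))\<^sup>2)"
      using onb_or_zeroD(3)[OF e, of i]
    proof
      assume "l2inner M (e i) (e i) = 0"
      then show ?thesis using l2inner_self_zero[OF L g, of i] by simp
    next
      assume "l2inner M (e i) (e i) = 1"
      then show ?thesis
        by (simp only: of_real_diff complex_norm_square) (simp add: algebra_simps)
    qed
  qed simp
  finally have "complex_of_real (\<integral>x. (cmod (g x - ?s x))\<^sup>2 \<partial>M) =
    complex_of_real ((\<integral>x. (cmod (g x))\<^sup>2 \<partial>M) + (\<Sum>i\<in>A. ((cmod (l2inner M g (e i) - c i * l2inner M (e i) (e i)))\<^sup>2 - (cmod (l2inner M g (e i)))\<^sup>2)))"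
    unfolding l2inner_self by simp
  then show ?thesis
    unfolding of_real_eq_iff by (simp add: sum_subtractf)
qed

lemma bessel:
  assumes e: "onb_or_zero M e" and g: "L2 M g" and A: "finite A"
  shows "(\<Sum>i\<in>A. (cmod (l2inner M g (e i)))\<^sup>2) \<le> (\<integral>x. (cmod (g x))\<^sup>2 \<partial>M)"
proof -
  have "0 \<le> (\<integral>x. (cmod (g x - (\<Sum>i\<in>A. l2inner M g (e i) * e i x)))\<^sup>2 \<partial>M)"
    by simp
  also have "\<dots> = (\<integral>x. (cmod (g x))\<^sup>2 \<partial>M) - (\<Sum>i\<in>A. (cmod (l2inner M g (e i)))\<^sup>2)
      + (\<Sum>i\<in>A. (cmod (l2inner M g (e i) - l2inner M g (e i) * l2inner M (e i) (e i)))\<^sup>2)"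
    by (rule l2_expand_square[OF e g A])
  also have "(\<Sum>i\<in>A. (cmod (l2inner M g (e i) - l2inner M g (e i) * l2inner M (e i) (e i)))\<^sup>2) = 0"
  proof (intro sum.neutral ballI)
    fix i
    show "(cmod (l2inner M g (e i) - l2inner M g (e i) * l2inner M (e i) (e i)))\<^sup>2 = 0"
      using onb_or_zeroD(3)[OF e, of i] l2inner_self_zero[OF onb_or_zeroD(1)[OF e] g, of i] by auto
  qed
  finally show ?thesis by simp
qed

section \<open>Approximation numbers and eigenvalues\<close>

lemma l2norm_le:
  assumes "L2 M f" "0 \<le> t" "(\<integral>x. (cmod (f x))\<^sup>2 \<partial>M) \<le> t\<^sup>2"
  shows "l2norm M f \<le> ennreal t"
proof -
  have *: "(\<integral>\<^sup>+x. ennreal ((cmod (f x))\<^sup>2) \<partial>M) = ennreal (\<integral>x. (cmod (f x))\<^sup>2 \<partial>M)"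
    by (intro nn_integral_eq_integral L2_square_integrable assms) simp
  have "(\<integral>x. (cmod (f x))\<^sup>2 \<partial>M) powr (1/2) \<le> (t\<^sup>2) powr (1/2)"
    using assms by (intro powr_mono2) auto
  also have "\<dots> = t" using assms(2) by (simp add: powr_half_sqrt)
  finally show ?thesis
    unfolding l2norm_def * epow_def by (simp add: ennreal_leI)
qed

lemma l2norm_le_1D:
  assumes "L2 M f" "l2norm M f \<le> 1" shows "(\<integral>x. (cmod (f x))\<^sup>2 \<partial>M) \<le> 1"
proof -
  have *: "(\<integral>\<^sup>+x. ennreal ((cmod (f x))\<^sup>2) \<partial>M) = ennreal (\<integral>x. (cmod (f x))\<^sup>2 \<partial>M)"
    by (intro nn_integral_eq_integral L2_square_integrable assms) simp
  have "ennreal (sqrt (\<integral>x. (cmod (f x))\<^sup>2 \<partial>M)) \<le> ennreal 1"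
    using assms(2) unfolding l2norm_def * epow_def by (simp add: powr_half_sqrt)
  then show ?thesis by (subst (asm) ennreal_le_iff) auto
qed

text \<open>Greedy choice: fewer than \<open>card (A m)\<close> values are taken when
  \<open>m\<close> is served. This stands in for the decreasing rearrangement of the
  eigenvalues.\<close>

lemma injective_selection:
  fixes A :: "nat \<Rightarrow> 'b set"
  assumes "\<And>m. finite (A m) \<Longrightarrow> m < card (A m)"
  shows "\<exists>\<sigma>. inj_on \<sigma> {..<N} \<and> (\<forall>m<N. \<sigma> m \<in> A m)"
proof (induction N)
  case (Suc N)
  then obtain \<sigma> where \<sigma>: "inj_on \<sigma> {..<N}" "\<forall>m<N. \<sigma> m \<in> A m" by blast
  have "\<not> A N \<subseteq> \<sigma> ` {..<N}"
  proof
    assume "A N \<subseteq> \<sigma> ` {..<N}"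
    then have "finite (A N)" "card (A N) \<le> N"
      using card_mono[of "\<sigma> ` {..<N}" "A N"] card_image_le[of "{..<N}" \<sigma>] finite_subset[of "A N" "\<sigma> ` {..<N}"] by auto
    then show False using assms[of N] by simp
  qed
  then obtain y where y: "y \<in> A N" "y \<notin> \<sigma> ` {..<N}" by blast
  have "inj_on (\<sigma>(N := y)) {..<Suc N}"
    using \<sigma>(1) y(2) unfolding lessThan_Suc by (auto simp: inj_on_def)
  moreover have "\<forall>m<Suc N. (\<sigma>(N := y)) m \<in> A m"
    using \<sigma>(2) y(1) by (auto simp: less_Suc_eq)
  ultimately show ?case by blast
qed simp

text \<open>Cutting \<open>T\<close> off on the indices with large eigenvalue is a competitor of
  rank at most \<open>m\<close>; each coefficient of the remainder is at most \<open>t\<close> times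
  that of \<open>g\<close>, and density turns this into a bound on the norm.\<close>

lemma singval_le:
  assumes e: "onb_or_zero M e" and T: "\<And>g. L2 M g \<Longrightarrow> L2 M (T g)"
    and adj: "\<And>g i. L2 M g \<Longrightarrow> l2inner M (T g) (e i) = \<Lambda> i * l2inner M g (e i)"
    and dense: "\<And>g \<epsilon>. L2 M g \<Longrightarrow> 0 < \<epsilon> \<Longrightarrow>
      \<exists>N c. (\<integral>x. (cmod (g x - (\<Sum>i<N. c i * e i x)))\<^sup>2 \<partial>M) < \<epsilon>"
    and A: "finite A" "card A \<le> m" and t: "0 \<le> t" "\<And>i. i \<notin> A \<Longrightarrow> cmod (\<Lambda> i) \<le> t"
  shows "singval M T m \<le> ennreal t"
proof -
  note L = onb_or_zeroD(1)[OF e]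
  \<comment> \<open>The competitor in \<open>singval\<close> is a sum of exactly \<open>m\<close>
    rank-one terms, so \<open>A\<close> is padded with arbitrary further indices.\<close>
  obtain B where B: "A \<subseteq> B" "finite B" "card B = m"
  proof -
    obtain C where C: "C \<subseteq> - A" "finite C" "card C = m - card A"
      using infinite_arbitrarily_large[of "- A" "m - card A"] A(1) by (metis Compl_eq_Diff_UNIV Diff_infinite_finite infinite_UNIV_nat)
    have "card (A \<union> C) = m" using A C by (subst card_Un_disjoint) auto
    then show thesis using that[of "A \<union> C"] A(1) C(2) by auto
  qed
  obtain h where h: "bij_betw h {..<m} B"
    using ex_bij_betw_nat_finite[OF B(2)] B(3) by (auto simp: lessThan_atLeast0)
  define a where "a = (\<lambda>i. (\<lambda>x. e (h i) x))"
  define b where "b = (\<lambda>i. (\<lambda>x. \<Lambda> (h i) * e (h i) x))"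
  have "singval M T m \<le> opnorm M (\<lambda>f x. T f x - (\<Sum>i<m. l2inner M f (fst (a, b) i) * snd (a, b) i x))"
    unfolding singval_def by (intro INF_lower) (auto simp: a_def b_def L L2_cmult)
  also have "\<dots> \<le> ennreal t"
    unfolding opnorm_def
  proof (rule SUP_least, safe)
    fix g assume g: "L2 M g" "l2norm M g \<le> 1"
    have sum_eq: "(\<Sum>i<m. l2inner M g (fst (a, b) i) * snd (a, b) i x) = (\<Sum>i\<in>B. \<Lambda> i * l2inner M g (e i) * e i x)" for x
      unfolding sum.reindex_bij_betw[OF h, symmetric] by (simp add: a_def b_def algebra_simps)
    let ?r = "\<lambda>x. T g x - (\<Sum>i\<in>B. \<Lambda> i * l2inner M g (e i) * e i x)"
    have r: "L2 M ?r" by (intro L2_diff T g L2_sum L2_cmult L)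
    have ri: "(cmod (l2inner M ?r (e j)))\<^sup>2 \<le> t\<^sup>2 * (cmod (l2inner M g (e j)))\<^sup>2" for j
    proof -
      have "l2inner M ?r (e j) = \<Lambda> j * l2inner M g (e j) - (\<Sum>i\<in>B. \<Lambda> i * l2inner M g (e i) * l2inner M (e i) (e j))"
        by (simp add: l2inner_diff_left l2inner_sum_left l2inner_cmult_left L L2_sum L2_cmult g T adj)
      also have "(\<Sum>i\<in>B. \<Lambda> i * l2inner M g (e i) * l2inner M (e i) (e j)) =
        (\<Sum>i\<in>B \<inter> {j}. \<Lambda> i * l2inner M g (e i) * l2inner M (e i) (e j))"
        using B(2) onb_or_zeroD(2)[OF e] by (intro sum.mono_neutral_right) auto
      finally have eq: "l2inner M ?r (e j) = \<Lambda> j * l2inner M g (e j) - (\<Sum>i\<in>B \<inter> {j}. \<Lambda> i * l2inner M g (e i) * l2inner M (e i) (e j))" .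
      show ?thesis
      proof (cases "j \<in> B")
        case True
        then have "l2inner M ?r (e j) = \<Lambda> j * l2inner M g (e j) * (1 - l2inner M (e j) (e j))"
          unfolding eq by (simp add: Int_absorb1 algebra_simps)
        then have "l2inner M ?r (e j) = 0"
          using onb_or_zeroD(3)[OF e, of j] l2inner_self_zero[OF L g(1), of j] by auto
        then show ?thesis by simp
      next
        case False
        then have "l2inner M ?r (e j) = \<Lambda> j * l2inner M g (e j)" unfolding eq by simp
        moreover have "cmod (\<Lambda> j) \<le> t" using False B(1) t(2) by blast
        ultimately show ?thesis
          by (simp add: norm_mult power_mult_distrib mult_right_mono power_mono)
      qed
    qed
    \<comment> \<open>Parseval's identity up to \<epsilon>: any combination approximating the
      remainder bounds its squared norm by a finite Bessel sum plus \<epsilon>.\<close>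
    have "(\<integral>x. (cmod (?r x))\<^sup>2 \<partial>M) \<le> t\<^sup>2"
    proof (rule field_le_epsilon)
      fix \<epsilon> :: real assume "0 < \<epsilon>"
      obtain N c where Nc: "(\<integral>x. (cmod (?r x - (\<Sum>i<N. c i * e i x)))\<^sup>2 \<partial>M) < \<epsilon>"
        using dense[OF r \<open>0 < \<epsilon>\<close>] by blast
      have "0 \<le> (\<Sum>i<N. (cmod (l2inner M ?r (e i) - c i * l2inner M (e i) (e i)))\<^sup>2)"
        by (intro sum_nonneg) simp
      with Nc have "(\<integral>x. (cmod (?r x))\<^sup>2 \<partial>M) \<le> (\<Sum>i<N. (cmod (l2inner M ?r (e i)))\<^sup>2) + \<epsilon>"
        unfolding l2_expand_square[OF e r finite_lessThan] by linarith
      also have "(\<Sum>i<N. (cmod (l2inner M ?r (e i)))\<^sup>2) \<le> t\<^sup>2 * (\<Sum>i<N. (cmod (l2inner M g (e i)))\<^sup>2)"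
        unfolding sum_distrib_left by (intro sum_mono ri)
      also have "\<dots> \<le> t\<^sup>2 * 1"
        by (intro mult_left_mono order_trans[OF bessel[OF e g(1)] l2norm_le_1D[OF g]]) auto
      finally show "(\<integral>x. (cmod (?r x))\<^sup>2 \<partial>M) \<le> t\<^sup>2 + \<epsilon>" by simp
    qed
    then show "l2norm M (\<lambda>x. T g x - (\<Sum>i<m. l2inner M g (fst (a, b) i) * snd (a, b) i x)) \<le> ennreal t"
      unfolding sum_eq by (intro l2norm_le r t(1))
  qed
  finally show ?thesis .
qed

text \<open>If at most m indices had |\<Lambda>| \<ge> s_m / 2, truncating there would give s_m
  \<le> s_m / 2. Hence more than m such indices exist, and distinct ones can be assigned to distinct
  m. The half makes the contradiction work for eigenvalues in any order and is the source of the
  factor 2.\<close>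

lemma schatten_le_onb:
  assumes e: "onb_or_zero M e" and T: "\<And>g. L2 M g \<Longrightarrow> L2 M (T g)"
    and adj: "\<And>g i. L2 M g \<Longrightarrow> l2inner M (T g) (e i) = \<Lambda> i * l2inner M g (e i)"
    and dense: "\<And>g \<epsilon>. L2 M g \<Longrightarrow> 0 < \<epsilon> \<Longrightarrow>
      \<exists>N c. (\<integral>x. (cmod (g x - (\<Sum>i<N. c i * e i x)))\<^sup>2 \<partial>M) < \<epsilon>"
    and q: "0 < q" and B: "\<And>A. finite A \<Longrightarrow> (\<Sum>i\<in>A. cmod (\<Lambda> i) powr q) \<le> B"
  shows "schatten M q T \<le> ennreal (2 * B powr (1 / q))"
proof -
  note sv = singval_le[OF e T adj dense]
  have B0: "0 \<le> B" using B[of "{}"] by simp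
  have fin: "singval M T m \<noteq> \<infinity>" for m
  proof -
    have "cmod (\<Lambda> i) \<le> B powr (1 / q)" for i
    proof -
      have "(cmod (\<Lambda> i) powr q) powr (1 / q) \<le> B powr (1 / q)"
        using B[of "{i}"] q by (intro powr_mono2) auto
      then show ?thesis using q by (simp add: powr_powr)
    qed
    then have "singval M T m \<le> ennreal (B powr (1 / q))" by (intro sv[of "{}"]) auto
    then show ?thesis by (auto simp: top_unique)
  qed
  define s where "s m = enn2real (singval M T m)" for m
  have s: "singval M T m = ennreal (s m)" for m
    using fin[of m] by (simp add: s_def less_top[symmetric])
  have s0: "0 \<le> s m" for m by (simp add: s_def)
  have big: "m < card {i. s m / 2 \<le> cmod (\<Lambda> i)}" if "finite {i. s m / 2 \<le> cmod (\<Lambda> i)}" for m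
  proof (rule ccontr)
    assume "\<not> m < card {i. s m / 2 \<le> cmod (\<Lambda> i)}"
    then have "singval M T m \<le> ennreal (s m / 2)"
      using s0[of m] by (intro sv[OF _ _ _ _ that]) auto
    then have "s m \<le> s m / 2" using s0[of m] unfolding s by (subst (asm) ennreal_le_iff) auto
    then have "s m = 0" using s0[of m] by simp
    \<comment> \<open>For \<open>s m = 0\<close> the index set is all of the naturals, contrary to
      its assumed finiteness.\<close>
    then show False using that by simp
  qed
  have part: "(\<Sum>m<N. s m powr q) \<le> 2 powr q * B" for N
  proof -
    obtain \<sigma> where \<sigma>: "inj_on \<sigma> {..<N}" "\<forall>m<N. \<sigma> m \<in> {i. s m / 2 \<le> cmod (\<Lambda> i)}"
      using injective_selection[of "\<lambda>m. {i. s m / 2 \<le> cmod (\<Lambda> i)}" N] big by blast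
    have "(\<Sum>m<N. s m powr q) \<le> (\<Sum>m<N. 2 powr q * cmod (\<Lambda> (\<sigma> m)) powr q)"
    proof (rule sum_mono)
      fix m assume "m \<in> {..<N}"
      then have "s m \<le> 2 * cmod (\<Lambda> (\<sigma> m))" using \<sigma>(2) by auto
      then have "s m powr q \<le> (2 * cmod (\<Lambda> (\<sigma> m))) powr q" using q s0 by (intro powr_mono2) auto
      then show "s m powr q \<le> 2 powr q * cmod (\<Lambda> (\<sigma> m)) powr q" by (simp add: powr_mult)
    qed
    also have "\<dots> = 2 powr q * (\<Sum>i\<in>\<sigma> ` {..<N}. cmod (\<Lambda> i) powr q)"
      unfolding sum_distrib_left using \<sigma>(1) by (simp add: sum.reindex)
    also have "\<dots> \<le> 2 powr q * B" by (intro mult_left_mono B) auto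
    finally show ?thesis .
  qed
  have "(\<Sum>m. epow (singval M T m) q) \<le> ennreal (2 powr q * B)"
  proof (rule suminf_le_const)
    fix N
    have "(\<Sum>m<N. epow (singval M T m) q) = ennreal (\<Sum>m<N. s m powr q)"
      by (simp add: s epow_def s0)
    then show "(\<Sum>m<N. epow (singval M T m) q) \<le> ennreal (2 powr q * B)"
      using part[of N] by (simp add: ennreal_leI)
  qed (rule summableI)
  moreover have "epow x p \<le> ennreal (r powr p)" if "x \<le> ennreal r" "0 \<le> r" "0 \<le> p" for x r p
  proof -
    have "enn2real x \<le> r" using that(1,2) enn2real_leI by blast
    moreover have "x \<noteq> \<infinity>" using that(1) by (auto simp: top_unique)
    ultimately show ?thesis unfolding epow_def using that by (auto intro!: ennreal_leI powr_mono2)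
  qed
  ultimately have "schatten M q T \<le> ennreal ((2 powr q * B) powr (1 / q))"
    unfolding schatten_def using q B0 by simp
  also have "(2 powr q * B) powr (1 / q) = 2 * B powr (1 / q)"
    using q B0 by (simp add: powr_mult powr_powr)
  finally show ?thesis .
qed

text \<open>The hypothesis \<open>adj\<close> makes \<open>f i\<close> an eigenvector of the adjoint
  for the conjugate eigenvalue; with \<open>eig\<close> this is the part of normality that makes
  distinct eigenspaces orthogonal. Gram-Schmidt preserves \<open>adj\<close> and the span, which
  reduces the claim to the orthonormal case.\<close>

theorem schatten_le_eigenvalues:
  fixes f :: "nat \<Rightarrow> 'a \<Rightarrow> complex"
  assumes f: "\<And>i. L2 M (f i)" and T: "\<And>g. L2 M g \<Longrightarrow> L2 M (T g)"
    and eig: "\<And>i x. x \<in> space M \<Longrightarrow> T (f i) x = \<Lambda> i * f i x"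
    and adj: "\<And>g i. L2 M g \<Longrightarrow> l2inner M (T g) (f i) = \<Lambda> i * l2inner M g (f i)"
    and dense: "\<And>g \<epsilon>. L2 M g \<Longrightarrow> 0 < \<epsilon> \<Longrightarrow>
      \<exists>N c. (\<integral>x. (cmod (g x - (\<Sum>i<N. c i * f i x)))\<^sup>2 \<partial>M) < \<epsilon>"
    and q: "0 < q" and B: "\<And>A. finite A \<Longrightarrow> (\<Sum>i\<in>A. cmod (\<Lambda> i) powr q) \<le> B"
  shows "schatten M q T \<le> ennreal (2 * B powr (1 / q))"
proof -
  let ?g = "gram_schmidt M f"
  define \<rho> where "\<rho> n = sqrt (\<integral>x. (cmod (?g n x))\<^sup>2 \<partial>M)" for n
  define e where "e n = (\<lambda>x. complex_of_real (1 / \<rho> n) * ?g n x)" for n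
  have L: "L2 M (?g j)" for j using L2_gram_schmidt[of M f, OF f] .
  \<comment> \<open>The eigenvalue equation holds only on \<open>space M\<close>, so it is passed on
    as an equality of inner product functionals.\<close>
  have eig': "l2inner M (T (f i)) = l2inner M (\<lambda>x. \<Lambda> i * f i x)" for i
    unfolding l2inner_def using eig by (intro ext Bochner_Integration.integral_cong) auto
  have gg: "l2inner M (?g n) (?g n) = (complex_of_real (\<rho> n))\<^sup>2" for n
    unfolding l2inner_self \<rho>_def of_real_power[symmetric] by simp
  have e: "onb_or_zero M e"
    unfolding onb_or_zero_def
  proof (intro conjI allI impI)
    show "L2 M (e i)" for i unfolding e_def by (intro L2_cmult L)
    show "l2inner M (e i) (e j) = 0" if "i \<noteq> j" for i j
      unfolding e_def l2inner_cmult_left l2inner_cmult_right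
      using gram_schmidt_orthogonal[of M f j i] f that by simp
    show "l2inner M (e i) (e i) = 0 \<or> l2inner M (e i) (e i) = 1" for i
      unfolding e_def l2inner_cmult_left l2inner_cmult_right gg
      by (cases "\<rho> i = 0") (simp_all add: power2_eq_square)
  qed
  have adj': "l2inner M (T g) (e i) = \<Lambda> i * l2inner M g (e i)" if "L2 M g" for g i
    unfolding e_def l2inner_cmult_right
    using gram_schmidt_eigen[of M f T \<Lambda>, OF f T eig' adj that] by simp
  have g_e: "AE x in M. ?g n x = complex_of_real (\<rho> n) * e n x" for n
  proof (cases "\<rho> n = 0")
    case True
    then have "(\<integral>x. (cmod (?g n x))\<^sup>2 \<partial>M) = 0" by (simp add: \<rho>_def)
    then have "AE x in M. (cmod (?g n x))\<^sup>2 = 0"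
      by (subst (asm) integral_nonneg_eq_0_iff_AE) (use L in \<open>auto simp: L2_iff\<close>)
    then show ?thesis by eventually_elim (simp add: True)
  qed (simp add: e_def)
  \<comment> \<open>The triangular matrix expressing \<open>f\<close> through \<open>e\<close>. The
    expansion holds only almost everywhere, because a Gram-Schmidt vector of norm zero may differ
    from 0 on a null set while its normalization is exactly 0.\<close>
  define b where "b n j = complex_of_real (\<rho> j) *
    (if j = n then 1 else if j < n then l2inner M (f n) (?g j) / l2inner M (?g j) (?g j) else 0)" for n j
  have f_e: "AE x in M. \<forall>n. f n x = (\<Sum>j\<le>n. b n j * e j x)"
  proof -
    have "AE x in M. \<forall>n. ?g n x = complex_of_real (\<rho> n) * e n x"
      unfolding AE_all_countable using g_e by blast
    then show ?thesis
    proof eventually_elim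
      case (elim x)
      show ?case
      proof
        fix n
        have "f n x = ?g n x + (\<Sum>j<n. l2inner M (f n) (?g j) / l2inner M (?g j) (?g j) * ?g j x)"
          by (subst (1) gram_schmidt.simps) simp
        also have "\<dots> = b n n * e n x + (\<Sum>j<n. b n j * e j x)"
        proof -
          have "(\<Sum>j<n. l2inner M (f n) (?g j) / l2inner M (?g j) (?g j) * ?g j x) = (\<Sum>j<n. b n j * e j x)"
          proof (rule sum.cong)
            fix j assume "j \<in> {..<n}"
            then show "l2inner M (f n) (?g j) / l2inner M (?g j) (?g j) * ?g j x = b n j * e j x"
              unfolding elim[rule_format, of j] by (simp add: b_def)
          qed simp
          moreover have "?g n x = b n n * e n x" unfolding elim[rule_format, of n] by (simp add: b_def)
          ultimately show ?thesis by (simp only:)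
        qed
        finally show "f n x = (\<Sum>j\<le>n. b n j * e j x)"
          by (simp add: lessThan_Suc_atMost[symmetric])
      qed
    qed
  qed
  have conv: "(\<integral>x. (cmod (h x - (\<Sum>i<N. c i * f i x)))\<^sup>2 \<partial>M) =
      (\<integral>x. (cmod (h x - (\<Sum>j<N. (\<Sum>i<N. c i * b i j) * e j x)))\<^sup>2 \<partial>M)" if h: "L2 M h" for N c h
  proof (rule integral_cong_AE)
    note [measurable] = L2_borel[OF h] L2_borel[OF f] L2_borel[OF onb_or_zeroD(1)[OF e]]
    show "(\<lambda>x. (cmod (h x - (\<Sum>i<N. c i * f i x)))\<^sup>2) \<in> borel_measurable M"
      "(\<lambda>x. (cmod (h x - (\<Sum>j<N. (\<Sum>i<N. c i * b i j) * e j x)))\<^sup>2) \<in> borel_measurable M"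
      by measurable
    show "AE x in M. (cmod (h x - (\<Sum>i<N. c i * f i x)))\<^sup>2 =
      (cmod (h x - (\<Sum>j<N. (\<Sum>i<N. c i * b i j) * e j x)))\<^sup>2"
      using f_e
    proof eventually_elim
      case (elim x)
      have "(\<Sum>i<N. c i * f i x) = (\<Sum>i<N. \<Sum>j<N. c i * b i j * e j x)"
      proof (rule sum.cong)
        fix i assume "i \<in> {..<N}"
        then have "(\<Sum>j\<le>i. b i j * e j x) = (\<Sum>j<N. b i j * e j x)"
          by (intro sum.mono_neutral_left) (auto simp: b_def)
        then show "c i * f i x = (\<Sum>j<N. c i * b i j * e j x)"
          using elim by (simp add: sum_distrib_left mult.assoc)
      qed simp
      also have "\<dots> = (\<Sum>j<N. (\<Sum>i<N. c i * b i j) * e j x)"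
        by (subst sum.swap) (simp add: sum_distrib_right)
      finally show ?case by simp
    qed
  qed
  have dense': "\<exists>N c. (\<integral>x. (cmod (g x - (\<Sum>i<N. c i * e i x)))\<^sup>2 \<partial>M) < \<epsilon>"
    if g\<epsilon>: "L2 M g" "0 < \<epsilon>" for g \<epsilon>
  proof -
    obtain N c where "(\<integral>x. (cmod (g x - (\<Sum>i<N. c i * f i x)))\<^sup>2 \<partial>M) < \<epsilon>"
      using dense[OF g\<epsilon>] by blast
    then show ?thesis unfolding conv[OF g\<epsilon>(1)] by (intro exI)
  qed
  show ?thesis by (rule schatten_le_onb[OF e T adj' dense' q B])
qed

subsection \<open>SU(2) and the orbit of the torus\<close>

lemma mat2_eq_iff: "A = B \<longleftrightarrow> A$1$1 = B$1$1 \<and> A$1$2 = B$1$2 \<and> A$2$1 = B$2$1 \<and> A$2$2 = B$2$2" for A B :: mat2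
  by (auto simp: vec_eq_iff forall_2)

lemma mat2_mult_entry: "(A ** B) $ i $ j = A $ i $ 1 * B $ 1 $ j + A $ i $ 2 * B $ 2 $ j" for A B :: mat2
  by (simp add: matrix_matrix_mult_def sum_2)

lemma cadj_entry [simp]: "cadj A $ i $ j = cnj (A $ j $ i)"
  by (simp add: cadj_def)

lemma cadj_mult: "cadj (A ** B) = cadj B ** cadj A"
  by (simp add: mat2_eq_iff mat2_mult_entry mult.commute)

lemma SU2_iff:
  "U \<in> SU2 \<longleftrightarrow> U$2$2 = cnj (U$1$1) \<and> U$2$1 = - cnj (U$1$2) \<and> U$1$1 * U$2$2 - U$1$2 * U$2$1 = 1"
proof
  assume U: "U \<in> SU2"
  have "U ** cadj U = mat 1" and det: "U$1$1 * U$2$2 - U$1$2 * U$2$1 = 1"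
    using U by (auto simp: SU2_def det_2)
  then have e: "U$1$1 * cnj (U$1$1) + U$1$2 * cnj (U$1$2) = 1" "U$2$1 * cnj (U$1$1) + U$2$2 * cnj (U$1$2) = 0"
    unfolding mat2_eq_iff mat2_mult_entry by (auto simp: mat_def)
  have "U$2$2 = cnj (U$1$1)" "U$2$1 = - cnj (U$1$2)"
  proof -
    \<comment> \<open>Multiplying by the unit norm of the first row, then inserting the
      orthogonality of the rows and the determinant, solves for the second row.\<close>
    have "U$2$2 = U$2$2 * (U$1$1 * cnj (U$1$1) + U$1$2 * cnj (U$1$2))" unfolding e by simp
    also have "\<dots> = cnj (U$1$1) * (U$1$1 * U$2$2 - U$1$2 * U$2$1) + U$1$2 * (U$2$1 * cnj (U$1$1) + U$2$2 * cnj (U$1$2))"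
      by (simp add: algebra_simps)
    finally show "U$2$2 = cnj (U$1$1)" unfolding e det by simp
    have "U$2$1 = U$2$1 * (U$1$1 * cnj (U$1$1) + U$1$2 * cnj (U$1$2))" unfolding e by simp
    also have "\<dots> = U$1$1 * (U$2$1 * cnj (U$1$1) + U$2$2 * cnj (U$1$2)) - cnj (U$1$2) * (U$1$1 * U$2$2 - U$1$2 * U$2$1)"
      by (simp add: algebra_simps)
    finally show "U$2$1 = - cnj (U$1$2)" unfolding e det by simp
  qed
  then show "U$2$2 = cnj (U$1$1) \<and> U$2$1 = - cnj (U$1$2) \<and> U$1$1 * U$2$2 - U$1$2 * U$2$1 = 1"
    using det by simp
next
  assume "U$2$2 = cnj (U$1$1) \<and> U$2$1 = - cnj (U$1$2) \<and> U$1$1 * U$2$2 - U$1$2 * U$2$1 = 1"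
  then have e: "U$2$2 = cnj (U$1$1)" "U$2$1 = - cnj (U$1$2)" "U$1$1 * cnj (U$1$1) + U$1$2 * cnj (U$1$2) = 1"
    by auto
  then show "U \<in> SU2"
    unfolding SU2_def mat2_eq_iff mat2_mult_entry by (auto simp: mat_def det_2 algebra_simps)
qed

lemma SU2_mult:
  assumes "A \<in> SU2" "B \<in> SU2" shows "A ** B \<in> SU2"
proof -
  have AB: "cadj A ** A = mat 1" "A ** cadj A = mat 1" "cadj B ** B = mat 1" "B ** cadj B = mat 1"
    "det A = 1" "det B = 1" using assms by (auto simp: SU2_def)
  have "cadj (A ** B) ** (A ** B) = cadj B ** (cadj A ** A) ** B"
    "A ** B ** cadj (A ** B) = A ** (B ** cadj B) ** cadj A"
    by (simp_all only: cadj_mult matrix_mul_assoc)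
  then show ?thesis by (simp add: SU2_def AB det_mul matrix_mul_rid)
qed

lemma SU2_cadj: "A \<in> SU2 \<Longrightarrow> cadj A \<in> SU2"
  by (auto simp: SU2_iff mult.commute)

text \<open>For \<open>\<sigma> = -1\<close> this is left translation by \<open>d\<^sub>\<phi> u\<^sub>\<eta> d\<^sub>-\<^sub>\<phi>\<close>, for \<open>\<sigma> = 1\<close> by the inverse of
  \<open>d\<^sub>\<phi> u\<^sub>-\<^sub>\<eta> d\<^sub>-\<^sub>\<phi>\<close>.\<close>
definition rot :: "real \<Rightarrow> real \<Rightarrow> real \<Rightarrow> mat2 \<Rightarrow> mat2" where
  "rot \<eta> \<sigma> \<phi> x = (\<chi> i j. of_real (1 / sqrt 2) *
     (if i = 1 then cis \<eta> * x$1$j + of_real \<sigma> * cis (2 * \<phi>) * x$2$j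
      else - of_real \<sigma> * cis (- (2 * \<phi>)) * x$1$j + cis (- \<eta>) * x$2$j))"

definition conj_umat :: "real \<Rightarrow> real \<Rightarrow> mat2" where
  "conj_umat \<theta> \<phi> = dmat \<phi> ** umat \<theta> ** dmat (- \<phi>)"

lemma conj_umat_entries:
  "conj_umat \<theta> \<phi> $ 1 $ 1 = of_real (1 / sqrt 2) * cis \<theta>"
  "conj_umat \<theta> \<phi> $ 1 $ 2 = - of_real (1 / sqrt 2) * cis (2 * \<phi>)"
  "conj_umat \<theta> \<phi> $ 2 $ 1 = of_real (1 / sqrt 2) * cis (- (2 * \<phi>))"
  "conj_umat \<theta> \<phi> $ 2 $ 2 = of_real (1 / sqrt 2) * cis (- \<theta>)"
proof -
  have c: "cis \<phi> * (z * cis (- \<phi>)) = z" "cis (- \<phi>) * (z * cis \<phi>) = z" for z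
    by (simp_all add: mult.left_commute[of _ z] cis_mult)
  have d: "cis (2 * \<phi>) = cis \<phi> * cis \<phi>" "cis (- (2 * \<phi>)) = cis (- \<phi>) * cis (- \<phi>)"
    by (simp_all add: cis_mult)
  show "conj_umat \<theta> \<phi> $ 1 $ 1 = of_real (1 / sqrt 2) * cis \<theta>"
    "conj_umat \<theta> \<phi> $ 1 $ 2 = - of_real (1 / sqrt 2) * cis (2 * \<phi>)"
    "conj_umat \<theta> \<phi> $ 2 $ 1 = of_real (1 / sqrt 2) * cis (- (2 * \<phi>))"
    "conj_umat \<theta> \<phi> $ 2 $ 2 = of_real (1 / sqrt 2) * cis (- \<theta>)"
    unfolding conj_umat_def mat2_mult_entry dmat_def umat_def Let_def d
    by (simp_all add: mult.assoc c del: cis_divide)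
qed

lemma conj_umat_SU2: "conj_umat \<theta> \<phi> \<in> SU2"
proof -
  define c where "c = complex_of_real (1 / sqrt 2)"
  have "c * c = 1 / 2" unfolding c_def of_real_mult[symmetric] by simp
  moreover have "c * cis \<theta> * (c * cis (- \<theta>)) - - c * cis (2 * \<phi>) * (c * cis (- (2 * \<phi>))) =
      (c * c) * (cis \<theta> * cis (- \<theta>)) + (c * c) * (cis (2 * \<phi>) * cis (- (2 * \<phi>)))"
    by (simp only: mult_ac mult_minus_left mult_minus_right diff_minus_eq_add)
  ultimately have "c * cis \<theta> * (c * cis (- \<theta>)) - - c * cis (2 * \<phi>) * (c * cis (- (2 * \<phi>))) = 1"
    unfolding cis_mult by (simp add: mult.commute)
  moreover have "cnj c = c" by (simp add: c_def)
  ultimately show ?thesis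
    unfolding SU2_iff conj_umat_entries c_def[symmetric] by (simp add: cis_cnj)
qed

lemma rot_eq_mult: "conj_umat \<theta> \<phi> ** x = rot \<theta> (-1) \<phi> x" "cadj (conj_umat \<theta> \<phi>) ** x = rot (- \<theta>) 1 \<phi> x"
  unfolding mat2_eq_iff mat2_mult_entry cadj_entry conj_umat_entries rot_def
  by (simp_all add: algebra_simps cis_cnj add_divide_distrib diff_divide_distrib)

lemma rot_SU2: "x \<in> SU2 \<Longrightarrow> rot \<theta> (-1) \<phi> x \<in> SU2" "x \<in> SU2 \<Longrightarrow> rot (- \<theta>) 1 \<phi> x \<in> SU2"
  unfolding rot_eq_mult[symmetric] by (intro SU2_mult SU2_cadj conj_umat_SU2; assumption)+

lemma rot_inverse: "rot \<theta> (-1) \<phi> (rot (- \<theta>) 1 \<phi> x) = x"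
proof -
  have "conj_umat \<theta> \<phi> ** cadj (conj_umat \<theta> \<phi>) = mat 1"
    using conj_umat_SU2[of \<theta> \<phi>] unfolding SU2_def by blast
  then show ?thesis
    unfolding rot_eq_mult[symmetric] matrix_mul_assoc by (simp only: matrix_mul_lid)
qed

text \<open>Continuity is joint in matrix and angle, as Fubini's theorem asks for measurability on
  the product.\<close>

lemma continuous_on_rot: "continuous_on UNIV (\<lambda>p. rot \<eta> \<sigma> (snd p) (fst p))"
proof -
  have "continuous_on UNIV (\<lambda>p::mat2 \<times> real. of_real (1 / sqrt 2) *
     (if i = 1 then cis \<eta> * fst p$1$j + of_real \<sigma> * cis (2 * snd p) * fst p$2$j
      else - of_real \<sigma> * cis (- (2 * snd p)) * fst p$1$j + cis (- \<eta>) * fst p$2$j))" for i j :: 2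
    by (cases "i = 1") (auto intro!: continuous_intros)
  then show ?thesis unfolding rot_def by (intro continuous_on_vec_lambda)
qed

subsection \<open>Eigenfunctions\<close>

text \<open>The binary form P^m p(Q / P) of degree \<open>m\<close>, where \<open>m\<close> may
  exceed the degree of \<open>p\<close>.\<close>

definition homogenize :: "complex poly \<Rightarrow> nat \<Rightarrow> complex poly \<Rightarrow> complex poly \<Rightarrow> complex poly" where
  "homogenize p m P Q = (\<Sum>i\<le>m. smult (coeff p i) (P ^ (m - i) * Q ^ i))"

lemma homogenize_linear_mult:
  assumes "degree p \<le> m"
  shows "homogenize ([:a, b:] * p) (Suc m) P Q = (smult a P + smult b Q) * homogenize p m P Q"
proof -
  have "homogenize ([:a, b:] * p) (Suc m) P Q =
    (\<Sum>i\<le>Suc m. smult (a * coeff p i) (P ^ (Suc m - i) * Q ^ i)) +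
    (\<Sum>i\<le>Suc m. smult (b * (if i = 0 then 0 else coeff p (i - 1))) (P ^ (Suc m - i) * Q ^ i))"
    unfolding homogenize_def sum.distrib[symmetric]
    by (intro sum.cong refl) (auto simp: smult_add_left coeff_pCons split: nat.splits)
  also have "(\<Sum>i\<le>Suc m. smult (a * coeff p i) (P ^ (Suc m - i) * Q ^ i)) = smult a P * homogenize p m P Q"
    using assms by (simp add: coeff_eq_0 homogenize_def sum_distrib_left Suc_diff_le mult_ac)
  also have "(\<Sum>i\<le>Suc m. smult (b * (if i = 0 then 0 else coeff p (i - 1))) (P ^ (Suc m - i) * Q ^ i)) =
     smult b Q * homogenize p m P Q"
    by (subst sum.atMost_Suc_shift) (simp add: homogenize_def sum_distrib_left mult_ac)
  finally show ?thesis by (simp add: distrib_right)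
qed

lemma degree_linear_power_mult_le:
  "degree ([:a, b:] ^ i * [:c, d:] ^ j :: complex poly) \<le> i + j"
  by (intro order_trans[OF degree_mult_le] add_mono order_trans[OF degree_power_le]) auto

lemma homogenize_linear_powers:
  "homogenize ([:a, b:] ^ i * [:c, d:] ^ j) (i + j) P Q =
    (smult a P + smult b Q) ^ i * (smult c P + smult d Q) ^ j"
proof (induction i)
  case 0
  show ?case
  proof (induction j)
    case (Suc j)
    then show ?case
      using homogenize_linear_mult[OF degree_linear_power_mult_le[of 0 0 0 c d j], of c d P Q]
      unfolding power_0 power_Suc mult_1_left add_0 by (simp only:)
  qed (simp add: homogenize_def)
next
  case (Suc i)
  then show ?case
    using homogenize_linear_mult[OF degree_linear_power_mult_le[of a b i c d j], of a b P Q]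
    unfolding power_Suc mult.assoc add_Suc by (simp only:)
qed

text \<open>Up to scaling, the matrix coefficients of the representation on binary forms of degree
  n. Left translation mixes the two rows of \<open>x\<close> and leaves the power of the variable
  alone, so \<open>l\<close> only counts multiplicity.\<close>

definition eigfun :: "nat \<Rightarrow> nat \<Rightarrow> nat \<Rightarrow> mat2 \<Rightarrow> complex" where
  "eigfun n k l x = coeff ([:x$1$1, x$1$2:] ^ (n - k) * [:x$2$1, x$2$2:] ^ k) l"

text \<open>Both rows of the rotated matrix are multiples of the linear factors of
  \<open>jac_poly\<close>, evaluated at the rows of \<open>x\<close> with a twist. The term i then
  depends on \<phi> through a single character of order 2 (i - k), which the average kills unless i
  = k.\<close>

lemma eigfun_rot:
  assumes k: "k \<le> n" and \<sigma>: "\<sigma>\<^sup>2 = 1"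
  shows "eigfun n k l (rot \<eta> \<sigma> \<phi> x) = (\<Sum>i\<le>n. of_real (1 / sqrt 2) ^ n *
     coeff (jac_poly n k) i * of_real \<sigma> ^ (k + i) * cis (\<eta> * (real n - real k - real i)) *
     eigfun n i l x * cis (of_int (2 * (int i - int k)) * \<phi>))"
proof -
  define P where "P = [:x$1$1, x$1$2:]"
  define Q where "Q = [:x$2$1, x$2$2:]"
  define c where "c = complex_of_real (1 / sqrt 2)"
  \<comment> \<open>The twist \<open>w\<close> is forced: \<open>e1\<close> fits it to the first
    row, and \<open>e2\<close>, by \<sigma>^2 = 1, shows that the same \<open>w\<close> fits the
    second.\<close>
  define w where "w = complex_of_real \<sigma> * cis (2 * \<phi> - \<eta>)"
  define y where "y = rot \<eta> \<sigma> \<phi> x"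
  have \<sigma>': "complex_of_real \<sigma> * complex_of_real \<sigma> = 1"
    using \<sigma> unfolding of_real_mult[symmetric] by (simp add: power2_eq_square)
  have e1: "cis \<eta> * w = of_real \<sigma> * cis (2 * \<phi>)"
    unfolding w_def by (simp add: mult.left_commute cis_mult)
  have e2: "of_real \<sigma> * cis (- (2 * \<phi>)) * w = cis (- \<eta>)"
  proof -
    have "of_real \<sigma> * cis (- (2 * \<phi>)) * w = (of_real \<sigma> * of_real \<sigma>) * (cis (- (2 * \<phi>)) * cis (2 * \<phi> - \<eta>))"
      unfolding w_def by (simp only: mult_ac)
    also have "\<dots> = cis (- \<eta>)" unfolding \<sigma>' cis_mult by simp
    finally show ?thesis .
  qed
  have r1: "y$1$j = c * (cis \<eta> * x$1$j + (cis \<eta> * w) * x$2$j)" for j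
    unfolding y_def rot_def c_def e1 by simp
  have row1: "[:y$1$1, y$1$2:] = smult (c * cis \<eta>) (smult 1 P + smult 1 (smult w Q))"
    by (simp add: r1 P_def Q_def algebra_simps)
  have r2: "y$2$j = c * (- of_real \<sigma> * cis (- (2 * \<phi>)) * x$1$j + (of_real \<sigma> * cis (- (2 * \<phi>)) * w) * x$2$j)" for j
    unfolding y_def rot_def c_def e2 by simp
  have row2: "[:y$2$1, y$2$2:] = smult (c * (of_real \<sigma> * cis (- (2 * \<phi>)))) (smult (-1) P + smult 1 (smult w Q))"
    by (simp add: r2 P_def Q_def algebra_simps)
  let ?K = "(c * cis \<eta>) ^ (n - k) * (c * (of_real \<sigma> * cis (- (2 * \<phi>)))) ^ k"
  have "[:y$1$1, y$1$2:] ^ (n - k) * [:y$2$1, y$2$2:] ^ k =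
     smult ?K ((smult 1 P + smult 1 (smult w Q)) ^ (n - k) * (smult (-1) P + smult 1 (smult w Q)) ^ k)"
    unfolding row1 row2 by (simp add: smult_power mult_ac)
  also have "\<dots> = smult ?K (homogenize (jac_poly n k) n P (smult w Q))"
    using homogenize_linear_powers[of 1 1 "n - k" "-1" 1 k P "smult w Q"] k by (simp add: jac_poly_def)
  finally have "eigfun n k l y = (\<Sum>i\<le>n. ?K * (coeff (jac_poly n k) i * (w ^ i * eigfun n i l x)))"
    unfolding eigfun_def[of n k l y] eigfun_def[of n _ l x] P_def[symmetric] Q_def[symmetric]
    by (simp add: homogenize_def coeff_sum sum_distrib_left smult_power mult.assoc)
  also have "\<dots> = (\<Sum>i\<le>n. c ^ n *
     coeff (jac_poly n k) i * of_real \<sigma> ^ (k + i) * cis (\<eta> * (real n - real k - real i)) *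
     eigfun n i l x * cis (of_int (2 * (int i - int k)) * \<phi>))"
  proof (rule sum.cong)
    fix i
    have cn: "c ^ (n - k) * c ^ k = c ^ n" using k by (simp flip: power_add)
    have "cis \<eta> ^ (n - k) * (cis (- (2 * \<phi>)) ^ k * cis (2 * \<phi> - \<eta>) ^ i)
      = cis (\<eta> * (real n - real k - real i)) * cis (of_int (2 * (int i - int k)) * \<phi>)"
      unfolding Complex.DeMoivre cis_mult using k by (simp add: of_nat_diff algebra_simps)
    moreover have "?K * (coeff (jac_poly n k) i * (w ^ i * eigfun n i l x)) =
      (c ^ (n - k) * c ^ k) * coeff (jac_poly n k) i * (of_real \<sigma> ^ k * of_real \<sigma> ^ i) *
      (cis \<eta> ^ (n - k) * (cis (- (2 * \<phi>)) ^ k * cis (2 * \<phi> - \<eta>) ^ i)) * eigfun n i l x"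
      unfolding w_def power_mult_distrib by (simp only: mult_ac)
    ultimately show "?K * (coeff (jac_poly n k) i * (w ^ i * eigfun n i l x)) = c ^ n *
     coeff (jac_poly n k) i * of_real \<sigma> ^ (k + i) * cis (\<eta> * (real n - real k - real i)) *
     eigfun n i l x * cis (of_int (2 * (int i - int k)) * \<phi>)"
      unfolding cn power_add by (simp only: mult_ac)
  qed simp
  finally show ?thesis unfolding y_def c_def .
qed

definition eigval :: "nat \<Rightarrow> nat \<Rightarrow> real \<Rightarrow> complex" where
  "eigval n k \<theta> = of_real (1 / sqrt 2) ^ n * coeff (jac_poly n k) k * cis (\<theta> * (2 * real k - real n))"

text \<open>Reality confines \<theta> to the phase even under conjugation, so that replacing
  \<theta> by - \<theta> conjugates the eigenvalue; this matches the adjoint operator.\<close>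

lemma coeff_jac_poly_real: "coeff (jac_poly n k) i \<in> \<real>"
proof -
  have mult: "\<forall>i. coeff (p * q) i \<in> \<real>" if "\<forall>i. coeff p i \<in> \<real>" "\<forall>i. coeff q i \<in> \<real>" for p q :: "complex poly"
    using that by (auto simp: coeff_mult intro!: sum_in_Reals)
  have pow: "\<forall>i. coeff (p ^ m) i \<in> \<real>" if "\<forall>i. coeff p i \<in> \<real>" for p :: "complex poly" and m
  proof (induction m)
    case (Suc m)
    then show ?case unfolding power_Suc by (rule mult[OF that])
  qed (simp add: of_bool_def)
  have lin: "\<forall>i. coeff [:a, b:] i \<in> \<real>" if "a \<in> \<real>" "b \<in> \<real>" for a b :: complex
    using that by (auto simp: coeff_pCons split: nat.splits)
  show ?thesis unfolding jac_poly_def using mult[OF pow[OF lin] pow[OF lin]] by simp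
qed

lemma cnj_eigval: "cnj (eigval n k (- \<theta>)) = eigval n k \<theta>"
proof -
  have "cnj (coeff (jac_poly n k) k) = coeff (jac_poly n k) k"
    using coeff_jac_poly_real by (simp add: Reals_cnj_iff)
  then show ?thesis by (simp add: eigval_def cis_cnj)
qed

text \<open>Both eigenvalues have modulus \<open>jac n k\<close>; their phases rotate with frequency
  2k - n, which is at most n in modulus.\<close>

lemma cmod_eigval_diff_le:
  assumes "k \<le> n"
  shows "cmod (eigval n k \<theta>1 - eigval n k \<theta>2) \<le> jac n k * min 2 (n * \<bar>\<theta>1 - \<theta>2\<bar>)"
proof -
  let ?m = "2 * real k - real n"
  have "eigval n k \<theta>1 - eigval n k \<theta>2 = of_real (1 / sqrt 2) ^ n * coeff (jac_poly n k) k * (cis (\<theta>1 * ?m) - cis (\<theta>2 * ?m))"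
    by (simp add: eigval_def right_diff_distrib)
  then have "cmod (eigval n k \<theta>1 - eigval n k \<theta>2) = jac n k * cmod (cis (\<theta>1 * ?m) - cis (\<theta>2 * ?m))"
    by (simp add: norm_mult norm_power jac_def power_divide norm_divide)
  also have "\<dots> \<le> jac n k * min 2 (n * \<bar>\<theta>1 - \<theta>2\<bar>)"
  proof (intro mult_left_mono min.boundedI jac_nonneg)
    show "cmod (cis (\<theta>1 * ?m) - cis (\<theta>2 * ?m)) \<le> 2"
      using norm_triangle_ineq4[of "cis (\<theta>1 * ?m)" "cis (\<theta>2 * ?m)"] by simp
    have "cmod (cis (\<theta>1 * ?m) - cis (\<theta>2 * ?m)) = cmod (cis (\<theta>2 * ?m) * (cis (\<theta>1 * ?m - \<theta>2 * ?m) - 1))"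
      by (simp add: right_diff_distrib cis_mult)
    also have "\<dots> = cmod (cis (\<theta>1 * ?m - \<theta>2 * ?m) - 1)" by (simp add: norm_mult)
    also have "\<dots> \<le> \<bar>\<theta>1 * ?m - \<theta>2 * ?m\<bar>"
      using dist_exp_i_1[of "\<theta>1 * ?m - \<theta>2 * ?m"] abs_sin_x_le_abs_x[of "(\<theta>1 * ?m - \<theta>2 * ?m) / 2"]
      unfolding cis_conv_exp by simp
    also have "\<dots> = \<bar>\<theta>1 - \<theta>2\<bar> * \<bar>?m\<bar>" by (simp add: abs_mult left_diff_distrib flip: abs_mult)
    also have "\<dots> \<le> \<bar>\<theta>1 - \<theta>2\<bar> * n" using assms by (intro mult_left_mono) auto
    finally show "cmod (cis (\<theta>1 * ?m) - cis (\<theta>2 * ?m)) \<le> n * \<bar>\<theta>1 - \<theta>2\<bar>" by (simp add: mult.commute)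
  qed
  finally show ?thesis .
qed

subsection \<open>The operators on \<open>L\<^sup>2\<close>\<close>

lemma haar_facts:
  assumes "is_haar_SU2 \<mu>"
  shows "space \<mu> = SU2" "sets \<mu> = sets (restrict_space borel SU2)" "emeasure \<mu> (space \<mu>) = 1"
    "finite_measure \<mu>" "g \<in> SU2 \<Longrightarrow> distr \<mu> \<mu> (\<lambda>x. g ** x) = \<mu>"
proof -
  show s: "sets \<mu> = sets (restrict_space borel SU2)" and e: "emeasure \<mu> (space \<mu>) = 1"
    using assms by (auto simp: is_haar_SU2_def)
  show "space \<mu> = SU2" using sets_eq_imp_space_eq[OF s] by (simp add: space_restrict_space)
  show "finite_measure \<mu>" by (rule finite_measureI) (simp add: e)
  show "g \<in> SU2 \<Longrightarrow> distr \<mu> \<mu> (\<lambda>x. g ** x) = \<mu>" using assms by (auto simp: is_haar_SU2_def)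
qed

text \<open>The set integral in \<open>Sop\<close> becomes an integral for a finite measure, so that
  the product measure and Fubini apply.\<close>

definition circle_measure :: "real measure" where
  "circle_measure = restrict_space lborel {0..2 * pi}"

lemma emeasure_circle_measure: "emeasure circle_measure (space circle_measure) = ennreal (2 * pi)"
  by (simp add: circle_measure_def emeasure_restrict_space space_restrict_space)

lemma finite_measure_circle_measure: "finite_measure circle_measure"
  by (rule finite_measureI) (simp add: emeasure_circle_measure)

lemma integral_circle_measure: "integral\<^sup>L circle_measure f = (LBINT \<phi>:{0..2*pi}. f \<phi>)"
  for f :: "real \<Rightarrow> complex"
  unfolding circle_measure_def set_lebesgue_integral_def by (rule integral_restrict_space) simp

lemma integrable_circle_measure_cis: "integrable circle_measure (\<lambda>\<phi>. cis (of_int m * \<phi>))"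
proof -
  interpret finite_measure circle_measure by (rule finite_measure_circle_measure)
  have "(\<lambda>\<phi>::real. cis (of_int m * \<phi>)) \<in> borel_measurable borel"
    by (intro borel_measurable_continuous_onI continuous_intros)
  then have "(\<lambda>\<phi>. cis (of_int m * \<phi>)) \<in> borel_measurable circle_measure"
    unfolding circle_measure_def by (intro measurable_restrict_space1) simp
  then show ?thesis by (intro integrable_const_bound[where B = 1]) auto
qed

lemma integral_circle_measure_cis:
  "integral\<^sup>L circle_measure (\<lambda>\<phi>. cis (of_int m * \<phi>)) = (if m = 0 then of_real (2 * pi) else 0)"
proof -
  have "set_integrable lborel {0..2 * pi} (\<lambda>\<phi>. cis (of_int m * \<phi>))"
    by (intro borel_integrable_atLeastAtMost' continuous_intros)
  from set_borel_integral_eq_integral(2)[OF this] show ?thesis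
    unfolding integral_circle_measure
    using integral_unique[OF cis_has_integral_period[of m 0]] by simp
qed

text \<open>Orthogonality of characters leaves the term i = k, where the sign is \<sigma>^(2k) =
  1.\<close>

lemma eigfun_rot_integral:
  assumes "k \<le> n" "\<sigma>\<^sup>2 = 1"
  shows "integrable circle_measure (\<lambda>\<phi>. eigfun n k l (rot \<eta> \<sigma> \<phi> x))"
    "integral\<^sup>L circle_measure (\<lambda>\<phi>. eigfun n k l (rot \<eta> \<sigma> \<phi> x)) = of_real (2 * pi) * eigval n k (- \<eta>) * eigfun n k l x"
proof -
  show "integrable circle_measure (\<lambda>\<phi>. eigfun n k l (rot \<eta> \<sigma> \<phi> x))"
    unfolding eigfun_rot[OF assms]
    by (intro Bochner_Integration.integrable_sum integrable_mult_right integrable_circle_measure_cis)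
  have \<sigma>: "complex_of_real \<sigma> ^ (k + k) = 1"
    using assms(2) by (metis mult_2 of_real_1 of_real_power power_mult power_one)
  have "integral\<^sup>L circle_measure (\<lambda>\<phi>. eigfun n k l (rot \<eta> \<sigma> \<phi> x)) =
    (\<Sum>i\<le>n. of_real (1 / sqrt 2) ^ n *
     coeff (jac_poly n k) i * of_real \<sigma> ^ (k + i) * cis (\<eta> * (real n - real k - real i)) *
     eigfun n i l x * (if 2 * (int i - int k) = 0 then of_real (2 * pi) else 0))"
    unfolding eigfun_rot[OF assms]
    by (subst Bochner_Integration.integral_sum)
      (intro integrable_mult_right integrable_circle_measure_cis, simp only: integral_mult_right_zero integral_circle_measure_cis)
  also have "\<dots> = (\<Sum>i\<le>n. if i = k then of_real (1 / sqrt 2) ^ n *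
     coeff (jac_poly n k) k * of_real \<sigma> ^ (k + k) * cis (\<eta> * (real n - real k - real k)) *
     eigfun n k l x * of_real (2 * pi) else 0)"
    by (intro sum.cong) auto
  also have "\<dots> = of_real (1 / sqrt 2) ^ n *
     coeff (jac_poly n k) k * cis (\<eta> * (real n - real k - real k)) * eigfun n k l x * of_real (2 * pi)"
    using assms(1) by (simp add: \<sigma>)
  also have "\<eta> * (real n - real k - real k) = - \<eta> * (2 * real k - real n)" by (simp add: algebra_simps)
  finally show "integral\<^sup>L circle_measure (\<lambda>\<phi>. eigfun n k l (rot \<eta> \<sigma> \<phi> x)) = of_real (2 * pi) * eigval n k (- \<eta>) * eigfun n k l x"
    by (simp add: eigval_def)
qed

lemma Sop_eq: "Sop \<theta> \<xi> x = of_real (1 / (2 * pi)) * integral\<^sup>L circle_measure (\<lambda>\<phi>. \<xi> (rot (- \<theta>) 1 \<phi> x))"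
  unfolding Sop_def lreg_def conj_umat_def[symmetric] rot_eq_mult integral_circle_measure ..

lemma Sop_eigfun:
  assumes "k \<le> n" shows "Sop \<theta> (eigfun n k l) x = eigval n k \<theta> * eigfun n k l x"
  unfolding Sop_eq using eigfun_rot_integral(2)[of k n 1 l "- \<theta>" x] assms by simp

lemma continuous_eigfun: "continuous_on UNIV (eigfun n k l)"
proof -
  have mult: "\<forall>i. continuous_on UNIV (\<lambda>x. coeff (p x * q x) i)"
    if "\<forall>i. continuous_on UNIV (\<lambda>x. coeff (p x) i)" "\<forall>i. continuous_on UNIV (\<lambda>x. coeff (q x) i)"
    for p q :: "mat2 \<Rightarrow> complex poly"
    unfolding coeff_mult using that by (auto intro!: continuous_intros)
  have pow: "\<forall>i. continuous_on UNIV (\<lambda>x. coeff (p x ^ m) i)"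
    if "\<forall>i. continuous_on UNIV (\<lambda>x. coeff (p x) i)" for p :: "mat2 \<Rightarrow> complex poly" and m
  proof (induction m)
    case (Suc m)
    then show ?case unfolding power_Suc by (rule mult[OF that])
  qed simp
  have lin: "\<forall>l. continuous_on UNIV (\<lambda>x::mat2. coeff [:x$i$1, x$i$2:] l)" for i
  proof
    fix l :: nat
    consider "l = 0" | "l = 1" | m where "l = Suc (Suc m)" by (metis One_nat_def not0_implies_Suc)
    then show "continuous_on UNIV (\<lambda>x::mat2. coeff [:x$i$1, x$i$2:] l)"
      by cases (auto intro!: continuous_intros)
  qed
  have "continuous_on UNIV (\<lambda>x. eigfun n k l x)"
    unfolding eigfun_def using mult[OF pow[OF lin] pow[OF lin]] by blast
  then show ?thesis by simp
qed

lemma compact_SU2: "compact SU2"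
proof -
  have "SU2 = {x. x$2$2 = cnj (x$1$1)} \<inter> ({x. x$2$1 = - cnj (x$1$2)} \<inter> {x. x$1$1 * x$2$2 - x$1$2 * x$2$1 = 1})"
    by (auto simp: SU2_iff)
  moreover have "closed \<dots>"
    by (intro closed_Int closed_Collect_eq continuous_intros)
  ultimately have "closed SU2" by simp
  moreover have "bounded SU2"
  proof (rule boundedI)
    fix x assume x: "x \<in> SU2"
    then have e: "x$2$2 = cnj (x$1$1)" "x$2$1 = - cnj (x$1$2)" "x$1$1 * cnj (x$1$1) + x$1$2 * cnj (x$1$2) = 1"
      unfolding SU2_iff by auto
    have "complex_of_real ((cmod (x$1$1))\<^sup>2 + (cmod (x$1$2))\<^sup>2) = 1"
      unfolding of_real_add complex_norm_square using e(3) .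
    then have sum1: "(cmod (x$1$1))\<^sup>2 + (cmod (x$1$2))\<^sup>2 = 1"
      by (metis of_real_eq_1_iff)
    have "(cmod (x$1$1))\<^sup>2 \<le> (cmod (x$1$1))\<^sup>2 + (cmod (x$1$2))\<^sup>2"
      "(cmod (x$1$2))\<^sup>2 \<le> (cmod (x$1$1))\<^sup>2 + (cmod (x$1$2))\<^sup>2" by simp_all
    then have "(cmod (x$1$1))\<^sup>2 \<le> 1\<^sup>2" "(cmod (x$1$2))\<^sup>2 \<le> 1\<^sup>2"
      unfolding sum1 by simp_all
    then have le: "cmod (x$1$1) \<le> 1" "cmod (x$1$2) \<le> 1"
      by (auto intro: power2_le_imp_le)
    have row: "norm v \<le> (\<Sum>j\<in>UNIV. norm (v $ j))" for v :: "complex ^ 2"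
      unfolding norm_vec_def[of v] by (intro L2_set_le_sum) auto
    have "norm x \<le> (\<Sum>i\<in>UNIV. norm (x $ i))"
      unfolding norm_vec_def[of x] by (intro L2_set_le_sum) auto
    also have "\<dots> \<le> (\<Sum>i\<in>(UNIV::2 set). \<Sum>j\<in>UNIV. norm (x $ i $ j))"
      by (intro sum_mono row)
    also have "\<dots> \<le> 4" using le e by (simp add: sum_2)
    finally show "norm x \<le> 4" .
  qed
  ultimately show ?thesis by (simp add: compact_eq_bounded_closed)
qed

section \<open>Invariance, boundedness and the adjoint relation for Haar measure\<close>

locale haar_SU2 =
  fixes \<mu> :: "mat2 measure"
  assumes haar: "is_haar_SU2 \<mu>"
begin

sublocale finite_measure \<mu> by (rule haar_facts(4)[OF haar])

lemma space_haar [simp]: "space \<mu> = SU2"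
  by (rule haar_facts(1)[OF haar])

lemma measurable_haar_borel: "f \<in> measurable borel N \<Longrightarrow> f \<in> measurable \<mu> N"
  unfolding measurable_cong_sets[OF haar_facts(2)[OF haar] refl] by (rule measurable_restrict_space1)

lemma measurable_haar_continuous:
  "continuous_on UNIV f \<Longrightarrow> f \<in> borel_measurable \<mu>" for f :: "mat2 \<Rightarrow> 'b::topological_space"
  by (intro measurable_haar_borel borel_measurable_continuous_onI)

lemma measurable_into_haar: "f \<in> borel_measurable N \<Longrightarrow> (\<And>x. x \<in> space N \<Longrightarrow> f x \<in> SU2) \<Longrightarrow> f \<in> measurable N \<mu>"
  using measurable_restrict_space2[of f N SU2 borel] measurable_cong_sets[OF refl haar_facts(2)[OF haar]] by auto

lemma bounded_on_SU2:
  assumes "continuous_on UNIV f" shows "\<exists>B. \<forall>x\<in>SU2. cmod (f x) \<le> B"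
proof -
  have "compact (f ` SU2)"
    using compact_SU2 assms by (intro compact_continuous_image) (auto intro: continuous_on_subset)
  then show ?thesis using compact_imp_bounded[of "f ` SU2"] by (auto simp: bounded_iff)
qed

lemma L2_bounded:
  assumes "f \<in> borel_measurable \<mu>" "\<And>x. x \<in> SU2 \<Longrightarrow> cmod (f x) \<le> B" shows "L2 \<mu> f"
proof -
  have "integrable \<mu> (\<lambda>x. (cmod (f x))\<^sup>2)"
    using assms by (intro integrable_const_bound[where B = "B\<^sup>2"]) (auto intro!: AE_I2 power_mono)
  then show ?thesis using assms by (simp add: L2_iff)
qed

lemma L2_continuous: "continuous_on UNIV f \<Longrightarrow> L2 \<mu> f"
  using bounded_on_SU2[of f] L2_bounded[OF measurable_haar_continuous, of f] by blast

lemma measurable_translate [measurable]: "g \<in> SU2 \<Longrightarrow> (\<lambda>x. g ** x) \<in> measurable \<mu> \<mu>"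
proof (intro measurable_into_haar measurable_haar_continuous)
  have "continuous_on UNIV (\<lambda>x::mat2. (\<chi> i j. g$i$1 * x$1$j + g$i$2 * x$2$j) :: mat2)"
    by (intro continuous_on_vec_lambda continuous_intros)
  moreover have "(\<lambda>x::mat2. (\<chi> i j. g$i$1 * x$1$j + g$i$2 * x$2$j) :: mat2) = (\<lambda>x. g ** x)"
    by (auto simp: mat2_eq_iff mat2_mult_entry)
  ultimately show "continuous_on UNIV (\<lambda>x::mat2. g ** x)" by (simp only:)
qed (auto intro: SU2_mult)

lemma nn_integral_translate:
  assumes g: "g \<in> SU2" and [measurable]: "f \<in> borel_measurable \<mu>"
  shows "(\<integral>\<^sup>+x. f (g ** x) \<partial>\<mu>) = (\<integral>\<^sup>+x. f x \<partial>\<mu>)"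
proof -
  have "(\<integral>\<^sup>+x. f x \<partial>\<mu>) = (\<integral>\<^sup>+x. f x \<partial>distr \<mu> \<mu> (\<lambda>x. g ** x))"
    by (simp only: haar_facts(5)[OF haar g])
  also have "\<dots> = (\<integral>\<^sup>+x. f (g ** x) \<partial>\<mu>)"
    using g by (subst nn_integral_distr) auto
  finally show ?thesis by simp
qed

lemma integral_translate:
  fixes f :: "mat2 \<Rightarrow> complex"
  assumes g: "g \<in> SU2" and [measurable]: "f \<in> borel_measurable \<mu>"
  shows "(\<integral>x. f (g ** x) \<partial>\<mu>) = (\<integral>x. f x \<partial>\<mu>)"
proof -
  have "(\<integral>x. f x \<partial>\<mu>) = (\<integral>x. f x \<partial>distr \<mu> \<mu> (\<lambda>x. g ** x))"
    by (simp only: haar_facts(5)[OF haar g])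
  also have "\<dots> = (\<integral>x. f (g ** x) \<partial>\<mu>)"
    using g by (subst integral_distr) auto
  finally show ?thesis by simp
qed

lemma measurable_rot [measurable]:
  "(\<lambda>p. rot (- \<theta>) 1 (snd p) (fst p)) \<in> measurable (\<mu> \<Otimes>\<^sub>M circle_measure) \<mu>"
proof (rule measurable_into_haar)
  have 1: "(\<lambda>p::mat2 \<times> real. rot (- \<theta>) 1 (snd p) (fst p)) \<in> borel_measurable (borel \<Otimes>\<^sub>M borel)"
    unfolding borel_prod by (intro borel_measurable_continuous_onI continuous_on_rot)
  have [measurable]: "(\<lambda>x. x) \<in> borel_measurable \<mu>" "(\<lambda>x. x) \<in> borel_measurable circle_measure"
    by (auto simp: circle_measure_def intro: measurable_haar_borel measurable_restrict_space1)
  have 2: "(\<lambda>p. (fst p, snd p)) \<in> measurable (\<mu> \<Otimes>\<^sub>M circle_measure) (borel \<Otimes>\<^sub>M borel)"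
    by (intro measurable_Pair measurable_compose[OF measurable_fst] measurable_compose[OF measurable_snd]) measurable
  show "(\<lambda>p. rot (- \<theta>) 1 (snd p) (fst p)) \<in> borel_measurable (\<mu> \<Otimes>\<^sub>M circle_measure)"
    using measurable_compose[OF 2 1] by simp
qed (auto simp: space_pair_measure intro: rot_SU2)

text \<open>After Tonelli, left invariance removes the translation at each fixed angle.\<close>

lemma nn_integral_rot:
  assumes [measurable]: "f \<in> borel_measurable \<mu>"
  shows "(\<integral>\<^sup>+x. \<integral>\<^sup>+\<phi>. f (rot (- \<theta>) 1 \<phi> x) \<partial>circle_measure \<partial>\<mu>) = ennreal (2 * pi) * (\<integral>\<^sup>+x. f x \<partial>\<mu>)"
proof -
  interpret C: finite_measure circle_measure by (rule finite_measure_circle_measure)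
  interpret P: pair_sigma_finite \<mu> circle_measure ..
  have "(\<lambda>(x, \<phi>). f (rot (- \<theta>) 1 \<phi> x)) \<in> borel_measurable (\<mu> \<Otimes>\<^sub>M circle_measure)"
    using measurable_compose[OF measurable_rot assms] by (simp add: case_prod_beta')
  then have "(\<integral>\<^sup>+x. \<integral>\<^sup>+\<phi>. f (rot (- \<theta>) 1 \<phi> x) \<partial>circle_measure \<partial>\<mu>) =
    (\<integral>\<^sup>+\<phi>. \<integral>\<^sup>+x. f (rot (- \<theta>) 1 \<phi> x) \<partial>\<mu> \<partial>circle_measure)"
    by (rule P.Fubini'[symmetric])
  also have "\<dots> = (\<integral>\<^sup>+\<phi>. (\<integral>\<^sup>+x. f x \<partial>\<mu>) \<partial>circle_measure)"
    unfolding rot_eq_mult[symmetric] by (intro nn_integral_cong nn_integral_translate SU2_cadj conj_umat_SU2 assms)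
  also have "\<dots> = ennreal (2 * pi) * (\<integral>\<^sup>+x. f x \<partial>\<mu>)"
    by (simp add: emeasure_circle_measure mult.commute)
  finally show ?thesis .
qed

lemma measurable_rot_complex:
  fixes f :: "mat2 \<Rightarrow> 'b::topological_space"
  assumes "f \<in> borel_measurable \<mu>"
  shows "(\<lambda>(x, \<phi>). f (rot (- \<theta>) 1 \<phi> x)) \<in> borel_measurable (\<mu> \<Otimes>\<^sub>M circle_measure)"
  using measurable_compose[OF measurable_rot assms] by (simp add: case_prod_beta')

text \<open>Cauchy-Schwarz on the circle bounds the square of the average by the average of squares,
  which \<open>nn_integral_rot\<close> integrates.\<close>

lemma L2_Sop:
  assumes \<xi>: "L2 \<mu> \<xi>" shows "L2 \<mu> (Sop \<theta> \<xi>)"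
proof -
  interpret C: finite_measure circle_measure by (rule finite_measure_circle_measure)
  have [measurable]: "\<xi> \<in> borel_measurable \<mu>" using \<xi> by (rule L2_borel)
  note meas = measurable_rot_complex[OF L2_borel[OF \<xi>]]
  define F where "F x = integral\<^sup>L circle_measure (\<lambda>\<phi>. \<xi> (rot (- \<theta>) 1 \<phi> x))" for x
  have F_meas: "F \<in> borel_measurable \<mu>"
    unfolding F_def by (rule C.borel_measurable_lebesgue_integral[OF meas])
  have F_le: "ennreal ((cmod (F x))\<^sup>2) \<le>
      (\<integral>\<^sup>+\<phi>. ennreal ((cmod (\<xi> (rot (- \<theta>) 1 \<phi> x)))\<^sup>2) \<partial>circle_measure) * ennreal (2 * pi)"
    if x: "x \<in> space \<mu>" for x
  proof -
    have [measurable]: "(\<lambda>\<phi>. \<xi> (rot (- \<theta>) 1 \<phi> x)) \<in> borel_measurable circle_measure"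
      using measurable_Pair2[OF meas x] by simp
    have "ennreal (cmod (F x)) \<le> (\<integral>\<^sup>+\<phi>. ennreal (cmod (\<xi> (rot (- \<theta>) 1 \<phi> x))) \<partial>circle_measure)"
    \<comment> \<open>Where the integrand is not integrable in \<phi>, the Bochner integral is 0 by
      convention and the bound is trivial.\<close>
    proof (cases "integrable circle_measure (\<lambda>\<phi>. \<xi> (rot (- \<theta>) 1 \<phi> x))")
      case True
      then show ?thesis unfolding F_def by (rule integral_norm_bound_ennreal)
    qed (simp add: F_def not_integrable_integral_eq)
    then have "(ennreal (cmod (F x)))\<^sup>2 \<le> (\<integral>\<^sup>+\<phi>. ennreal (cmod (\<xi> (rot (- \<theta>) 1 \<phi> x))) * 1 \<partial>circle_measure)\<^sup>2"
      by (simp add: power_mono)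
    also have "\<dots> \<le> (\<integral>\<^sup>+\<phi>. (ennreal (cmod (\<xi> (rot (- \<theta>) 1 \<phi> x))))\<^sup>2 \<partial>circle_measure) * (\<integral>\<^sup>+\<phi>. 1\<^sup>2 \<partial>circle_measure)"
      by (rule Cauchy_Schwarz_nn_integral) measurable
    finally show ?thesis by (simp add: ennreal_power emeasure_circle_measure)
  qed
  have "(\<integral>\<^sup>+x. ennreal ((cmod (F x))\<^sup>2) \<partial>\<mu>) \<le>
    (\<integral>\<^sup>+x. (\<integral>\<^sup>+\<phi>. ennreal ((cmod (\<xi> (rot (- \<theta>) 1 \<phi> x)))\<^sup>2) \<partial>circle_measure) * ennreal (2 * pi) \<partial>\<mu>)"
    by (rule nn_integral_mono) (rule F_le)
  also have "\<dots> = (\<integral>\<^sup>+x. (\<integral>\<^sup>+\<phi>. ennreal ((cmod (\<xi> (rot (- \<theta>) 1 \<phi> x)))\<^sup>2) \<partial>circle_measure) \<partial>\<mu>) * ennreal (2 * pi)"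
  proof (rule nn_integral_multc)
    have "(\<lambda>(x, \<phi>). ennreal ((cmod (\<xi> (rot (- \<theta>) 1 \<phi> x)))\<^sup>2)) \<in> borel_measurable (\<mu> \<Otimes>\<^sub>M circle_measure)"
      using measurable_rot_complex[of "\<lambda>x. ennreal ((cmod (\<xi> x))\<^sup>2)"] by simp
    then show "(\<lambda>x. \<integral>\<^sup>+\<phi>. ennreal ((cmod (\<xi> (rot (- \<theta>) 1 \<phi> x)))\<^sup>2) \<partial>circle_measure) \<in> borel_measurable \<mu>"
      by (rule C.borel_measurable_nn_integral)
  qed
  also have "\<dots> = ennreal (2 * pi) * (\<integral>\<^sup>+x. ennreal ((cmod (\<xi> x))\<^sup>2) \<partial>\<mu>) * ennreal (2 * pi)"
    by (subst nn_integral_rot) auto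
  also have "\<dots> < \<infinity>" using \<xi> by (auto simp: L2_def ennreal_mult_less_top)
  finally have "L2 \<mu> F" using F_meas by (simp add: L2_def)
  then show ?thesis
    using L2_cmult[of \<mu> F "of_real (1 / (2 * pi))"] unfolding F_def Sop_eq[symmetric] by simp
qed

text \<open>Fubini and invariance move each translation onto the eigenfunction as its inverse.
  Averaging there yields \<open>eigval n k (- \<theta>)\<close>, and the conjugation in the second
  argument turns it into \<open>eigval n k \<theta>\<close>.\<close>

lemma Sop_adjoint_eigfun:
  assumes \<xi>: "L2 \<mu> \<xi>" and k: "k \<le> n"
  shows "l2inner \<mu> (Sop \<theta> \<xi>) (eigfun n k l) = eigval n k \<theta> * l2inner \<mu> \<xi> (eigfun n k l)"
proof -
  interpret C: finite_measure circle_measure by (rule finite_measure_circle_measure)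
  interpret P: pair_sigma_finite \<mu> circle_measure ..
  have [measurable]: "\<xi> \<in> borel_measurable \<mu>" using \<xi> by (rule L2_borel)
  have L2e: "L2 \<mu> (eigfun n i l)" for i by (intro L2_continuous continuous_eigfun)
  have [measurable]: "eigfun n i l \<in> borel_measurable \<mu>" for i using L2e by (rule L2_borel)
  let ?e = "eigfun n k l"
  obtain B where B: "\<And>x. x \<in> SU2 \<Longrightarrow> cmod (?e x) \<le> B"
    using bounded_on_SU2[OF continuous_eigfun] by blast
  have meas: "(\<lambda>(x, \<phi>). \<xi> (rot (- \<theta>) 1 \<phi> x) * cnj (?e x)) \<in> borel_measurable (\<mu> \<Otimes>\<^sub>M circle_measure)"
    using measurable_rot_complex[OF L2_borel[OF \<xi>], of \<theta>] measurable_compose[OF measurable_fst, of "\<lambda>x. cnj (?e x)" \<mu> borel circle_measure]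
    by (simp add: case_prod_beta')
  have int\<xi>: "integrable \<mu> \<xi>"
    using L2_inner_integrable[OF \<xi> L2_continuous[of "\<lambda>_. 1"]] by simp
  have int: "integrable (\<mu> \<Otimes>\<^sub>M circle_measure) (\<lambda>(x, \<phi>). \<xi> (rot (- \<theta>) 1 \<phi> x) * cnj (?e x))"
  proof (rule integrableI_bounded[OF meas])
    have "(\<integral>\<^sup>+p. ennreal (norm (case p of (x, \<phi>) \<Rightarrow> \<xi> (rot (- \<theta>) 1 \<phi> x) * cnj (?e x))) \<partial>(\<mu> \<Otimes>\<^sub>M circle_measure))
      = (\<integral>\<^sup>+x. \<integral>\<^sup>+\<phi>. ennreal (norm (\<xi> (rot (- \<theta>) 1 \<phi> x) * cnj (?e x))) \<partial>circle_measure \<partial>\<mu>)"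
      using meas by (subst C.nn_integral_fst[symmetric]) (auto simp: case_prod_beta')
    also have "\<dots> \<le> (\<integral>\<^sup>+x. \<integral>\<^sup>+\<phi>. ennreal (B * cmod (\<xi> (rot (- \<theta>) 1 \<phi> x))) \<partial>circle_measure \<partial>\<mu>)"
      using B by (intro nn_integral_mono ennreal_leI) (auto simp: norm_mult mult.commute intro!: mult_right_mono)
    also have "\<dots> = ennreal (2 * pi) * (\<integral>\<^sup>+x. ennreal (B * cmod (\<xi> x)) \<partial>\<mu>)"
      by (rule nn_integral_rot) measurable
    also have "\<dots> < \<infinity>"
    proof -
      have "integrable \<mu> (\<lambda>x. B * cmod (\<xi> x))" using int\<xi> by (intro integrable_mult_right integrable_norm)
      then have "(\<integral>\<^sup>+x. ennreal (norm (B * cmod (\<xi> x))) \<partial>\<mu>) < \<infinity>"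
        by (simp only: integrable_iff_bounded)
      moreover have "(\<integral>\<^sup>+x. ennreal (B * cmod (\<xi> x)) \<partial>\<mu>) \<le> (\<integral>\<^sup>+x. ennreal (norm (B * cmod (\<xi> x))) \<partial>\<mu>)"
        by (intro nn_integral_mono ennreal_leI) simp
      ultimately have "(\<integral>\<^sup>+x. ennreal (B * cmod (\<xi> x)) \<partial>\<mu>) < \<infinity>" by (rule le_less_trans[rotated])
      then show ?thesis by (simp add: ennreal_mult_less_top)
    qed
    finally show "(\<integral>\<^sup>+p. ennreal (norm (case p of (x, \<phi>) \<Rightarrow> \<xi> (rot (- \<theta>) 1 \<phi> x) * cnj (?e x))) \<partial>(\<mu> \<Otimes>\<^sub>M circle_measure)) < \<infinity>" .
  qed
  have "of_real (2 * pi) * l2inner \<mu> (Sop \<theta> \<xi>) ?e = (\<integral>x. (\<integral>\<phi>. \<xi> (rot (- \<theta>) 1 \<phi> x) * cnj (?e x) \<partial>circle_measure) \<partial>\<mu>)"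
    unfolding l2inner_def integral_mult_right_zero[symmetric] Sop_eq
    by (intro Bochner_Integration.integral_cong) auto
  also have "\<dots> = (\<integral>\<phi>. (\<integral>x. \<xi> (rot (- \<theta>) 1 \<phi> x) * cnj (?e x) \<partial>\<mu>) \<partial>circle_measure)"
    by (rule P.Fubini_integral[symmetric, OF int])
  also have "\<dots> = (\<integral>\<phi>. l2inner \<mu> \<xi> (\<lambda>x. ?e (rot \<theta> (-1) \<phi> x)) \<partial>circle_measure)"
  proof (rule Bochner_Integration.integral_cong[OF refl])
    fix \<phi>
    have m: "(\<lambda>x. ?e (rot \<theta> (-1) \<phi> x)) \<in> borel_measurable \<mu>"
      unfolding rot_eq_mult(1)[symmetric] using conj_umat_SU2 by measurable
    \<comment> \<open>Writing x as the conjugated \<open>umat\<close> applied to its inverse applied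
      to x makes the whole integrand a function of the translated point.\<close>
    have "(\<integral>x. \<xi> (rot (- \<theta>) 1 \<phi> x) * cnj (?e x) \<partial>\<mu>) =
      (\<integral>x. \<xi> (cadj (conj_umat \<theta> \<phi>) ** x) * cnj (?e (rot \<theta> (-1) \<phi> (cadj (conj_umat \<theta> \<phi>) ** x))) \<partial>\<mu>)"
      unfolding rot_eq_mult(2) rot_inverse ..
    also have "\<dots> = (\<integral>x. \<xi> x * cnj (?e (rot \<theta> (-1) \<phi> x)) \<partial>\<mu>)"
      by (intro integral_translate[of _ "\<lambda>x. \<xi> x * cnj (?e (rot \<theta> (-1) \<phi> x))"] SU2_cadj conj_umat_SU2
          borel_measurable_times borel_measurable_cnj m L2_borel[OF \<xi>])
    finally show "(\<integral>x. \<xi> (rot (- \<theta>) 1 \<phi> x) * cnj (?e x) \<partial>\<mu>) = l2inner \<mu> \<xi> (\<lambda>x. ?e (rot \<theta> (-1) \<phi> x))"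
      unfolding l2inner_def .
  qed
  also have "\<dots> = of_real (2 * pi) * (eigval n k \<theta> * l2inner \<mu> \<xi> ?e)"
  proof -
    define a where "a i = complex_of_real (1 / sqrt 2) ^ n *
     coeff (jac_poly n k) i * of_real (-1) ^ (k + i) * cis (\<theta> * (real n - real k - real i))" for i
    have ek: "?e (rot \<theta> (-1) \<phi> x) = (\<Sum>i\<le>n. (a i * cis (of_int (2 * (int i - int k)) * \<phi>)) * eigfun n i l x)" for \<phi> x
      using eigfun_rot[OF k, of "-1" l \<theta> \<phi> x] unfolding a_def by (simp add: mult_ac)
    have inner_sum: "l2inner \<mu> \<xi> (\<lambda>x. \<Sum>i\<le>n. b i * eigfun n i l x) = (\<Sum>i\<le>n. cnj (b i) * l2inner \<mu> \<xi> (eigfun n i l))" for b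
      by (subst l2inner_sum_right) (auto simp: l2inner_cmult_right L2e L2_cmult \<xi>)
    have "l2inner \<mu> \<xi> (\<lambda>x. ?e (rot \<theta> (-1) \<phi> x)) =
      (\<Sum>i\<le>n. cnj (a i) * l2inner \<mu> \<xi> (eigfun n i l) * cnj (cis (of_int (2 * (int i - int k)) * \<phi>)))" for \<phi>
      unfolding ek inner_sum by (simp only: complex_cnj_mult mult_ac)
    then have "(\<integral>\<phi>. l2inner \<mu> \<xi> (\<lambda>x. ?e (rot \<theta> (-1) \<phi> x)) \<partial>circle_measure) =
      (\<integral>\<phi>. (\<Sum>i\<le>n. cnj (a i) * l2inner \<mu> \<xi> (eigfun n i l) * cnj (cis (of_int (2 * (int i - int k)) * \<phi>))) \<partial>circle_measure)"
      by simp
    also have "\<dots> = (\<Sum>i\<le>n. cnj (a i) * l2inner \<mu> \<xi> (eigfun n i l) * cnj (if 2 * (int i - int k) = 0 then of_real (2 * pi) else 0))"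
      by (subst Bochner_Integration.integral_sum)
        (intro integrable_mult_right integrable_cnj integrable_circle_measure_cis,
         simp only: integral_mult_right_zero Bochner_Integration.integral_cnj integral_circle_measure_cis)
    also have "\<dots> = (\<Sum>i\<le>n. if i = k then cnj (a k) * l2inner \<mu> \<xi> ?e * of_real (2 * pi) else 0)"
      by (intro sum.cong) auto
    also have "\<dots> = cnj (a k) * l2inner \<mu> \<xi> ?e * of_real (2 * pi)"
      using k by simp
    also have "a k = eigval n k (- \<theta>)"
    proof -
      have "complex_of_real (-1) ^ (k + k) = 1" by (simp flip: mult_2)
      moreover have "\<theta> * (real n - real k - real k) = - \<theta> * (2 * real k - real n)" by (simp add: algebra_simps)
      ultimately show ?thesis unfolding a_def eigval_def by simp
    qed
    finally show ?thesis by (simp add: cnj_eigval)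
  qed
  finally show ?thesis by simp
qed

end

subsection \<open>Density of the eigenfunctions\<close>

definition monomial :: "nat \<Rightarrow> nat \<Rightarrow> nat \<Rightarrow> nat \<Rightarrow> mat2 \<Rightarrow> complex" where
  "monomial p q r s x = x$1$1 ^ p * x$1$2 ^ q * x$2$1 ^ r * x$2$2 ^ s"

text \<open>Functions live on all 2 by 2 matrices, while relations such as determinant one hold only
  on SU(2); the rule \<open>cong\<close> builds equality on SU(2) into the span.\<close>

inductive eig_span :: "(mat2 \<Rightarrow> complex) \<Rightarrow> bool" where
  gen: "k \<le> n \<Longrightarrow> l \<le> n \<Longrightarrow> eig_span (eigfun n k l)"
| zero: "eig_span (\<lambda>x. 0)"
| add: "eig_span f \<Longrightarrow> eig_span g \<Longrightarrow> eig_span (\<lambda>x. f x + g x)"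
| cmult: "eig_span f \<Longrightarrow> eig_span (\<lambda>x. c * f x)"
| cong: "eig_span f \<Longrightarrow> (\<And>x. x \<in> SU2 \<Longrightarrow> f x = g x) \<Longrightarrow> eig_span g"

inductive mono_span :: "(mat2 \<Rightarrow> complex) \<Rightarrow> bool" where
  gen: "mono_span (monomial p q r s)"
| zero: "mono_span (\<lambda>x. 0)"
| add: "mono_span f \<Longrightarrow> mono_span g \<Longrightarrow> mono_span (\<lambda>x. f x + g x)"
| cmult: "mono_span f \<Longrightarrow> mono_span (\<lambda>x. c * f x)"
| cong: "mono_span f \<Longrightarrow> (\<And>x. x \<in> SU2 \<Longrightarrow> f x = g x) \<Longrightarrow> mono_span g"

lemma eig_span_sum: "(\<And>i. i \<in> A \<Longrightarrow> eig_span (f i)) \<Longrightarrow> eig_span (\<lambda>x. \<Sum>i\<in>A. f i x)"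
  by (induction A rule: infinite_finite_induct) (auto intro: eig_span.intros)

lemma coeff_linear_power:
  "coeff ([:a, b:] ^ m) j = of_nat (m choose j) * (a ^ (m - j) * b ^ j)" for a b :: complex
proof (induction m arbitrary: j)
  case 0
  then show ?case by (cases j) auto
next
  case (Suc m)
  have "coeff ([:a, b:] ^ Suc m) j = a * coeff ([:a, b:] ^ m) j + (if j = 0 then 0 else b * coeff ([:a, b:] ^ m) (j - 1))"
    by (simp add: coeff_pCons split: nat.splits)
  also have "\<dots> = of_nat (Suc m choose j) * (a ^ (Suc m - j) * b ^ j)"
  proof (cases j)
    case 0
    then show ?thesis unfolding Suc by simp
  next
    case (Suc i)
    consider "i < m" | "i = m" | "m < i" by linarith
    then show ?thesis
    proof cases
      case 1
      then have "m - i = Suc (m - Suc i)" by simp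
      then show ?thesis unfolding Suc.IH Suc by (simp add: algebra_simps)
    qed (auto simp: Suc.IH Suc binomial_eq_0)
  qed
  finally show ?case .
qed

lemma eigfun_eq_sum_monomial:
  "eigfun n k l x = (\<Sum>j\<le>l. of_nat ((n - k choose j) * (k choose (l - j))) *
     monomial (n - k - j) j (k - (l - j)) (l - j) x)"
  unfolding eigfun_def coeff_mult coeff_linear_power monomial_def
  by (intro sum.cong refl) (simp add: mult_ac)

lemma monomial_exchange:
  assumes "x \<in> SU2"
  shows "monomial (Suc p) q r (Suc s) x = monomial p q r s x + monomial p (Suc q) (Suc r) s x"
proof -
  have "x$1$1 * x$2$2 - x$1$2 * x$2$1 = 1" using assms unfolding SU2_iff by blast
  then have "x$1$1 * x$2$2 = 1 + x$1$2 * x$2$1" by (simp only: diff_eq_eq)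
  then have "monomial p q r s x * (x$1$1 * x$2$2) = monomial p q r s x * (1 + x$1$2 * x$2$1)" by simp
  then show ?thesis by (simp add: monomial_def algebra_simps)
qed

text \<open>By \<open>ad = 1 + bc\<close>, the monomials with the same torus weights and degree agree modulo
  monomials of lower degree, so each of them is a multiple of an eigenfunction modulo lower
  degree; the multiple is non-zero by Vandermonde's identity.\<close>
lemma eig_span_monomial: "eig_span (monomial p q r s)"
proof (induction "p + q + r + s" arbitrary: p q r s rule: less_induct)
  case less
  define n k l where "n = p + q + r + s" and "k = r + s" and "l = q + s"
  \<comment> \<open>These are the monomials occurring in \<open>eigfun n k l\<close>, and
    \<open>m q\<close> is the given one. Subtraction is truncated, so only j between
    \<open>j0\<close> and the smaller of n - k and l is genuine; every other j carries a zero
    binomial weight.\<close>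
  define m where "m j = monomial (n - k - j) j (k - (l - j)) (l - j)" for j
  define j0 where "j0 = l - k"
  have diff: "eig_span (\<lambda>x. m j x - m j0 x)" if "j0 \<le> j" "j \<le> n - k" "j \<le> l" for j
    using that
  proof (induction j rule: dec_induct)
    case base
    show ?case by (simp add: eig_span.zero)
  next
    case (step j)
    define p' r' s' where "p' = n - k - Suc j" and "r' = k - (l - j)" and "s' = l - Suc j"
    have eqs: "n - k - j = Suc p'" "k - (l - Suc j) = Suc r'" "l - j = Suc s'"
      using step by (auto simp: p'_def r'_def s'_def j0_def)
    have mj: "m j = monomial (Suc p') j r' (Suc s')"
      unfolding m_def r'_def eqs(1) eqs(3) ..
    have mSj: "m (Suc j) = monomial p' (Suc j) (Suc r') s'"
      by (simp only: m_def eqs(2) p'_def s'_def)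
    have "p' + j + r' + s' < p + q + r + s"
      using step by (auto simp: p'_def r'_def s'_def j0_def n_def k_def l_def)
    then have "eig_span (monomial p' j r' s')" by (rule less)
    then have "eig_span (\<lambda>x. (m j x - m j0 x) + (-1) * monomial p' j r' s' x)"
      using step by (intro eig_span.add eig_span.cmult) auto
    then show ?case
    proof (rule eig_span.cong)
      fix x assume "x \<in> SU2"
      then show "m j x - m j0 x + (-1) * monomial p' j r' s' x = m (Suc j) x - m j0 x"
        unfolding mj mSj using monomial_exchange[of x p' j r' s'] by simp
    qed
  qed
  have coeff_pos: "(\<Sum>j\<le>l. (n - k choose j) * (k choose (l - j))) = n choose l"
    using vandermonde[of "n - k" k l] by (simp add: n_def k_def add.assoc)
  have nz: "complex_of_nat (n choose l) \<noteq> 0" by (simp add: n_def l_def)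
  have "eig_span (\<lambda>x. \<Sum>j\<le>l. of_nat ((n - k choose j) * (k choose (l - j))) * (m j x - m j0 x))"
  proof (rule eig_span_sum)
    fix j assume "j \<in> {..l}"
    then have j: "j \<le> l" by simp
    show "eig_span (\<lambda>x. of_nat ((n - k choose j) * (k choose (l - j))) * (m j x - m j0 x))"
    proof (cases "j \<le> n - k \<and> l - j \<le> k")
      case True
      then show ?thesis using j by (intro eig_span.cmult diff) (auto simp: j0_def)
    next
      case False
      then show ?thesis by (auto simp: binomial_eq_0 intro: eig_span.zero)
    qed
  qed
  \<comment> \<open>\<open>eigfun n k l\<close> equals (n choose l) times \<open>m j0\<close> plus
    weighted differences already in the span; solving for \<open>m j0\<close> explains this
    expression.\<close>
  then have "eig_span (\<lambda>x. (1 / of_nat (n choose l)) * (eigfun n k l x +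
     (-1) * (\<Sum>j\<le>l. of_nat ((n - k choose j) * (k choose (l - j))) * (m j x - m j0 x))))"
    by (intro eig_span.add eig_span.cmult eig_span.gen) (auto simp: n_def k_def l_def)
  then have m_j0: "eig_span (m j0)"
  proof (rule eig_span.cong)
    fix x
    have "(\<Sum>j\<le>l. of_nat ((n - k choose j) * (k choose (l - j))) * (m j x - m j0 x)) =
      eigfun n k l x - of_nat (\<Sum>j\<le>l. (n - k choose j) * (k choose (l - j))) * m j0 x"
      unfolding eigfun_eq_sum_monomial m_def[symmetric] of_nat_sum
      by (simp add: right_diff_distrib sum_subtractf sum_distrib_right)
    then show "(1 / of_nat (n choose l)) * (eigfun n k l x +
     (-1) * (\<Sum>j\<le>l. of_nat ((n - k choose j) * (k choose (l - j))) * (m j x - m j0 x))) = m j0 x"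
      unfolding coeff_pos using nz by simp
  qed
  have "eig_span (\<lambda>x. (m q x - m j0 x) + m j0 x)"
    by (intro eig_span.add m_j0 diff) (auto simp: j0_def n_def k_def l_def)
  then have "eig_span (m q)" by simp
  then show ?case by (simp add: m_def n_def k_def l_def)
qed

lemma mono_span_imp_eig_span: "mono_span f \<Longrightarrow> eig_span f"
proof (induction rule: mono_span.induct)
  case (cong f g)
  then show ?case using eig_span.cong by blast
qed (auto intro: eig_span.intros eig_span_monomial)

lemma mono_span_mult:
  assumes "mono_span f" "mono_span g" shows "mono_span (\<lambda>x. f x * g x)"
  using assms(1)
proof (induction rule: mono_span.induct)
  case (gen p q r s)
  show ?case using assms(2)
  proof (induction rule: mono_span.induct)
    case (gen p' q' r' s')
    have "(\<lambda>x. monomial p q r s x * monomial p' q' r' s' x) = monomial (p + p') (q + q') (r + r') (s + s')"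
      by (auto simp: monomial_def power_add mult_ac)
    then show ?case by (simp add: mono_span.gen)
  next
    case (add f g)
    then show ?case using mono_span.add by (fastforce simp: distrib_left)
  next
    case (cmult f c)
    then show ?case using mono_span.cmult[of "\<lambda>x. monomial p q r s x * f x" c] by (simp add: mult_ac)
  next
    case (cong f h)
    then show ?case by (auto intro: mono_span.cong[OF cong.IH])
  qed (simp add: mono_span.zero)
next
  case (add f g)
  then show ?case using mono_span.add by (fastforce simp: distrib_right)
next
  case (cmult f c)
  then show ?case using mono_span.cmult[of _ c] by (fastforce simp: mult.assoc)
next
  case (cong f h)
  then show ?case by (auto intro: mono_span.cong[OF cong.IH])
qed (simp add: mono_span.zero)

lemma mono_span_const: "mono_span (\<lambda>x. c)"
  using mono_span.cmult[OF mono_span.gen[of 0 0 0 0], of c] by (simp add: monomial_def)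

lemma mono_span_entry: "mono_span (\<lambda>x. x $ i $ j)"
proof -
  have "mono_span (\<lambda>x. x$1$1)" "mono_span (\<lambda>x. x$1$2)" "mono_span (\<lambda>x. x$2$1)" "mono_span (\<lambda>x. x$2$2)"
    using mono_span.gen[of 1 0 0 0] mono_span.gen[of 0 1 0 0] mono_span.gen[of 0 0 1 0] mono_span.gen[of 0 0 0 1]
    by (simp_all add: monomial_def[abs_def])
  then show ?thesis using exhaust_2[of i] exhaust_2[of j] by auto
qed

text \<open>On SU(2) the conjugate of an entry is, up to sign, another entry. Thus polynomials in
  the entries already contain all real polynomial functions, as Stone-Weierstrass requires.\<close>

lemma mono_span_cnj_entry: "mono_span (\<lambda>x. cnj (x $ i $ j))"
proof -
  have e: "x $ 2 $ 2 = cnj (x $ 1 $ 1)" "x $ 1 $ 1 = cnj (x $ 2 $ 2)" "- 1 * x $ 2 $ 1 = cnj (x $ 1 $ 2)" "- 1 * x $ 1 $ 2 = cnj (x $ 2 $ 1)"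
    if "x \<in> SU2" for x
    using that by (auto simp: SU2_iff)
  have "mono_span (\<lambda>x. cnj (x$1$1))" "mono_span (\<lambda>x. cnj (x$1$2))" "mono_span (\<lambda>x. cnj (x$2$1))" "mono_span (\<lambda>x. cnj (x$2$2))"
    using mono_span.cong[OF mono_span_entry e(1)] mono_span.cong[OF mono_span_entry e(2)]
      mono_span.cong[OF mono_span.cmult[OF mono_span_entry] e(3)] mono_span.cong[OF mono_span.cmult[OF mono_span_entry] e(4)]
    by blast+
  then show ?thesis using exhaust_2[of i] exhaust_2[of j] by auto
qed

lemma mono_span_sum: "(\<And>i. i \<in> A \<Longrightarrow> mono_span (f i)) \<Longrightarrow> mono_span (\<lambda>x. \<Sum>i\<in>A. f i x)"
  by (induction A rule: infinite_finite_induct) (auto intro: mono_span.zero mono_span.add)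

lemma mono_span_inner_Basis:
  assumes "b \<in> Basis" shows "mono_span (\<lambda>x. of_real (x \<bullet> b))"
proof -
  from assms obtain i j u where b: "b = axis i (axis j u)" "u \<in> {1, \<i>}"
    unfolding Basis_vec_def by (auto simp: Basis_complex_def)
  have inner: "x \<bullet> b = x $ i $ j \<bullet> u" for x unfolding b inner_axis ..
  from b(2) consider "u = 1" | "u = \<i>" by blast
  then show ?thesis
  proof cases
    case 1
    have "mono_span (\<lambda>x. (1 / 2) * (x $ i $ j + cnj (x $ i $ j)))"
      by (intro mono_span.cmult mono_span.add mono_span_entry mono_span_cnj_entry)
    moreover have "(1 / 2) * (z + cnj z) = of_real (z \<bullet> 1)" for z
      by (simp add: complex_eq_iff)
    ultimately show ?thesis unfolding inner 1 by simp
  next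
    case 2
    have "mono_span (\<lambda>x. (- \<i> / 2) * (x $ i $ j + (-1) * cnj (x $ i $ j)))"
      by (intro mono_span.cmult mono_span.add mono_span_entry mono_span_cnj_entry)
    moreover have "(- \<i> / 2) * (z + (-1) * cnj z) = of_real (z \<bullet> \<i>)" for z
      by (simp add: complex_eq_iff)
    ultimately show ?thesis unfolding inner 2 by simp
  qed
qed

lemma mono_span_real_polynomial:
  assumes "real_polynomial_function p" shows "mono_span (\<lambda>x. of_real (p x))"
  using assms
proof (induction rule: real_polynomial_function.induct)
  case (linear f)
  interpret bounded_linear f by fact
  have "f x = (\<Sum>b\<in>Basis. (x \<bullet> b) * f b)" for x
    by (subst (1) euclidean_representation[of x, symmetric]) (simp only: sum scaleR real_scaleR_def)
  then have eq: "complex_of_real (f x) = (\<Sum>b\<in>Basis. of_real (x \<bullet> b) * of_real (f b))" for x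
    by (metis (no_types, lifting) of_real_mult of_real_sum sum.cong)
  have "mono_span (\<lambda>x. \<Sum>b\<in>Basis. of_real (f b) * of_real (x \<bullet> b))"
    by (intro mono_span_sum mono_span.cmult mono_span_inner_Basis)
  then show ?case
  proof (rule mono_span.cong)
    fix x
    show "(\<Sum>b\<in>Basis. complex_of_real (f b) * of_real (x \<bullet> b)) = of_real (f x)"
      by (subst eq) (simp only: mult.commute)
  qed
next
  case (const c)
  show ?case by (rule mono_span_const)
next
  case (add f g)
  then show ?case using mono_span.add[OF add.IH] by simp
next
  case (mult f g)
  then show ?case using mono_span_mult[OF mult.IH] by simp
qed

lemma continuous_approx_eig_span:
  fixes u :: "mat2 \<Rightarrow> real"
  assumes "continuous_on UNIV u" "0 < \<epsilon>"
  shows "\<exists>h. eig_span h \<and> (\<forall>x\<in>SU2. cmod (of_real (u x) - h x) < \<epsilon>)"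
proof -
  obtain p where p: "polynomial_function p" "\<forall>x\<in>SU2. norm (u x - p x) < \<epsilon>"
    using Stone_Weierstrass_polynomial_function[OF compact_SU2 continuous_on_subset[OF assms(1)] assms(2)] by auto
  have "eig_span (\<lambda>x. of_real (p x))"
    using p(1) by (intro mono_span_imp_eig_span mono_span_real_polynomial) (simp add: real_polynomial_function_eq)
  moreover have "cmod (of_real (u x) - of_real (p x)) < \<epsilon>" if "x \<in> SU2" for x
    using p(2) that by (simp flip: of_real_diff)
  ultimately show ?thesis by blast
qed

section \<open>Enumeration of the eigenfunctions\<close>

definition eig_enum :: "nat \<Rightarrow> nat \<times> nat \<times> nat" where
  "eig_enum i = (case prod_decode i of (n, j) \<Rightarrow> (case prod_decode j of (k, l) \<Rightarrow> (n, k, l)))"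

lemma eig_enum_inj: "inj eig_enum"
proof (rule inj_on_inverseI)
  fix i
  show "(\<lambda>(n, k, l). prod_encode (n, prod_encode (k, l))) (eig_enum i) = i"
    by (cases "prod_decode i"; cases "prod_decode (snd (prod_decode i))")
      (simp add: eig_enum_def, metis prod_decode_inverse)
qed

text \<open>Triples outside the range k, l \<le> n receive the zero function, and later the
  eigenvalue 0, so that the pairing bijection can serve as the enumeration.\<close>

definition eigseq :: "nat \<Rightarrow> mat2 \<Rightarrow> complex" where
  "eigseq i = (case eig_enum i of (n, k, l) \<Rightarrow> if k \<le> n \<and> l \<le> n then eigfun n k l else (\<lambda>x. 0))"

lemma eig_enum_surj: "\<exists>i. eig_enum i = (n, k, l)"
  by (rule exI[of _ "prod_encode (n, prod_encode (k, l))"]) (simp add: eig_enum_def)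

lemma eig_span_imp_sum:
  assumes "eig_span f" shows "\<exists>N c. \<forall>x\<in>SU2. f x = (\<Sum>i<N. c i * eigseq i x)"
  using assms
proof (induction rule: eig_span.induct)
  case (gen k n l)
  obtain i where i: "eig_enum i = (n, k, l)" using eig_enum_surj by blast
  have "eigfun n k l x = (\<Sum>j<Suc i. (if j = i then 1 else 0) * eigseq j x)" for x
    using gen by (simp add: eigseq_def i)
  then show ?case by (intro exI[of _ "Suc i"] exI[of _ "\<lambda>j. if j = i then 1 else 0"]) simp
next
  case zero
  show ?case by (intro exI[of _ 0]) simp
next
  case (add f g)
  then obtain N c N' c' where f: "\<forall>x\<in>SU2. f x = (\<Sum>i<N. c i * eigseq i x)"
    and g: "\<forall>x\<in>SU2. g x = (\<Sum>i<N'. c' i * eigseq i x)" by blast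
  have pad: "(\<Sum>i<K. d i * eigseq i x) = (\<Sum>i<max N N'. (if i < K then d i else 0) * eigseq i x)"
    if "K \<le> max N N'" for K d x
    using that by (intro sum.mono_neutral_cong_left) auto
  have "\<forall>x\<in>SU2. f x + g x = (\<Sum>i<max N N'. ((if i < N then c i else 0) + (if i < N' then c' i else 0)) * eigseq i x)"
    using f g pad[of N c] pad[of N' c'] by (simp add: distrib_right sum.distrib)
  then show ?case by (intro exI)
next
  case (cmult f c)
  then obtain N d where "\<forall>x\<in>SU2. f x = (\<Sum>i<N. d i * eigseq i x)" by blast
  then have "\<forall>x\<in>SU2. c * f x = (\<Sum>i<N. (c * d i) * eigseq i x)"
    by (simp add: sum_distrib_left mult.assoc)
  then show ?case by (intro exI)
next
  case (cong f g)
  then show ?case by metis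
qed

lemma continuous_eigseq: "continuous_on UNIV (eigseq i)"
proof -
  obtain n k l where "eig_enum i = (n, k, l)" by (cases "eig_enum i")
  then show ?thesis by (simp add: eigseq_def continuous_eigfun)
qed

context haar_SU2
begin

section \<open>From uniform density on SU(2) to density in L2\<close>

lemma L2_eigseq: "L2 \<mu> (eigseq i)"
  by (intro L2_continuous continuous_eigseq)

definition approximable :: "(mat2 \<Rightarrow> complex) \<Rightarrow> bool" where
  "approximable g \<longleftrightarrow> L2 \<mu> g \<and> (\<forall>\<epsilon>>0. \<exists>N c. (\<integral>x. (cmod (g x - (\<Sum>i<N. c i * eigseq i x)))\<^sup>2 \<partial>\<mu>) < \<epsilon>)"

lemma integral_cmod_square_add_le:
  assumes "L2 \<mu> f" "L2 \<mu> g"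
  shows "(\<integral>x. (cmod (f x + g x))\<^sup>2 \<partial>\<mu>) \<le> 2 * (\<integral>x. (cmod (f x))\<^sup>2 \<partial>\<mu>) + 2 * (\<integral>x. (cmod (g x))\<^sup>2 \<partial>\<mu>)"
proof -
  have "(\<integral>x. (cmod (f x + g x))\<^sup>2 \<partial>\<mu>) \<le> (\<integral>x. 2 * (cmod (f x))\<^sup>2 + 2 * (cmod (g x))\<^sup>2 \<partial>\<mu>)"
    using assms L2_add[OF assms]
    by (intro integral_mono Bochner_Integration.integrable_add integrable_mult_right L2_square_integrable cmod_add_square_le)
  also have "\<dots> = 2 * (\<integral>x. (cmod (f x))\<^sup>2 \<partial>\<mu>) + 2 * (\<integral>x. (cmod (g x))\<^sup>2 \<partial>\<mu>)"
    using assms by (simp add: L2_square_integrable)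
  finally show ?thesis .
qed

lemma approximable_limit:
  assumes g: "L2 \<mu> g" and h: "\<And>\<epsilon>. 0 < \<epsilon> \<Longrightarrow> \<exists>h. approximable h \<and> (\<integral>x. (cmod (g x - h x))\<^sup>2 \<partial>\<mu>) < \<epsilon>"
  shows "approximable g"
  unfolding approximable_def
proof (intro conjI g allI impI)
  fix \<epsilon> :: real assume "0 < \<epsilon>"
  then obtain h where h: "approximable h" "(\<integral>x. (cmod (g x - h x))\<^sup>2 \<partial>\<mu>) < \<epsilon> / 4"
    using assms(2)[of "\<epsilon> / 4"] by auto
  then obtain N c where Nc: "(\<integral>x. (cmod (h x - (\<Sum>i<N. c i * eigseq i x)))\<^sup>2 \<partial>\<mu>) < \<epsilon> / 4"
    using \<open>0 < \<epsilon>\<close> unfolding approximable_def by (meson divide_pos_pos zero_less_numeral)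
  have L: "L2 \<mu> (\<lambda>x. g x - h x)" "L2 \<mu> (\<lambda>x. h x - (\<Sum>i<N. c i * eigseq i x))"
    using h(1) g by (auto simp: approximable_def intro!: L2_diff L2_sum L2_cmult L2_eigseq)
  have "(\<integral>x. (cmod (g x - (\<Sum>i<N. c i * eigseq i x)))\<^sup>2 \<partial>\<mu>) < \<epsilon>"
    using integral_cmod_square_add_le[OF L] h(2) Nc by simp
  then show "\<exists>N c. (\<integral>x. (cmod (g x - (\<Sum>i<N. c i * eigseq i x)))\<^sup>2 \<partial>\<mu>) < \<epsilon>" by blast
qed

lemma approximable_eig_span:
  assumes "eig_span h" "h \<in> borel_measurable \<mu>" shows "approximable h"
proof -
  obtain N c where Nc: "\<forall>x\<in>SU2. h x = (\<Sum>i<N. c i * eigseq i x)"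
    using eig_span_imp_sum[OF assms(1)] by blast
  have L: "L2 \<mu> (\<lambda>x. \<Sum>i<N. c i * eigseq i x)" by (intro L2_sum L2_cmult L2_eigseq)
  have "integrable \<mu> (\<lambda>x. (cmod (h x))\<^sup>2) \<longleftrightarrow> integrable \<mu> (\<lambda>x. (cmod (\<Sum>i<N. c i * eigseq i x))\<^sup>2)"
    using Nc by (intro Bochner_Integration.integrable_cong) auto
  then have "L2 \<mu> h" using L assms(2) by (simp add: L2_iff)
  moreover have "(\<integral>x. (cmod (h x - (\<Sum>i<N. c i * eigseq i x)))\<^sup>2 \<partial>\<mu>) = (\<integral>x. 0 \<partial>\<mu>)"
    using Nc by (intro Bochner_Integration.integral_cong) auto
  ultimately show ?thesis
    unfolding approximable_def by (auto intro!: exI[of _ N] exI[of _ c])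
qed

lemma approximable_add:
  assumes "approximable f" "approximable g" shows "approximable (\<lambda>x. f x + g x)"
  unfolding approximable_def
proof (intro conjI allI impI)
  have L: "L2 \<mu> f" "L2 \<mu> g" using assms by (auto simp: approximable_def)
  show "L2 \<mu> (\<lambda>x. f x + g x)" using L by (rule L2_add)
  fix \<epsilon> :: real assume "0 < \<epsilon>"
  then have "0 < \<epsilon> / 4" by simp
  then obtain N c N' c' where f: "(\<integral>x. (cmod (f x - (\<Sum>i<N. c i * eigseq i x)))\<^sup>2 \<partial>\<mu>) < \<epsilon> / 4"
    and g: "(\<integral>x. (cmod (g x - (\<Sum>i<N'. c' i * eigseq i x)))\<^sup>2 \<partial>\<mu>) < \<epsilon> / 4"
    using assms unfolding approximable_def by meson
  have pad: "(\<Sum>i<K. d i * eigseq i x) = (\<Sum>i<max N N'. (if i < K then d i else 0) * eigseq i x)"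
    if "K \<le> max N N'" for K d x
    using that by (intro sum.mono_neutral_cong_left) auto
  let ?c = "\<lambda>i. (if i < N then c i else 0) + (if i < N' then c' i else 0)"
  have eq: "(f x - (\<Sum>i<N. c i * eigseq i x)) + (g x - (\<Sum>i<N'. c' i * eigseq i x)) =
    f x + g x - (\<Sum>i<max N N'. ?c i * eigseq i x)" for x
    using pad[of N c x] pad[of N' c' x] by (simp add: distrib_right sum.distrib)
  have "(\<integral>x. (cmod (f x + g x - (\<Sum>i<max N N'. ?c i * eigseq i x)))\<^sup>2 \<partial>\<mu>) < \<epsilon>"
    using integral_cmod_square_add_le[of "\<lambda>x. f x - (\<Sum>i<N. c i * eigseq i x)" "\<lambda>x. g x - (\<Sum>i<N'. c' i * eigseq i x)"] f g
    unfolding eq by (simp add: L2_diff L2_sum L2_cmult L2_eigseq L)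
  then show "\<exists>N c. (\<integral>x. (cmod (f x + g x - (\<Sum>i<N. c i * eigseq i x)))\<^sup>2 \<partial>\<mu>) < \<epsilon>" by (intro exI)
qed

lemma approximable_zero: "approximable (\<lambda>x. 0)"
  by (intro approximable_eig_span eig_span.zero) simp

lemma approximable_cmult:
  assumes "approximable f" shows "approximable (\<lambda>x. a * f x)"
proof (cases "a = 0")
  case False
  show ?thesis unfolding approximable_def
  proof (intro conjI allI impI)
    show "L2 \<mu> (\<lambda>x. a * f x)" using assms by (auto simp: approximable_def intro: L2_cmult)
    fix \<epsilon> :: real assume "0 < \<epsilon>"
    then have "0 < \<epsilon> / (cmod a)\<^sup>2" using False by simp
    then obtain N c where Nc: "(\<integral>x. (cmod (f x - (\<Sum>i<N. c i * eigseq i x)))\<^sup>2 \<partial>\<mu>) < \<epsilon> / (cmod a)\<^sup>2"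
      using assms unfolding approximable_def by meson
    have "cmod (a * f x - (\<Sum>i<N. (a * c i) * eigseq i x)) = cmod a * cmod (f x - (\<Sum>i<N. c i * eigseq i x))" for x
      by (simp add: norm_mult[symmetric] right_diff_distrib sum_distrib_left mult.assoc)
    then have "(\<integral>x. (cmod (a * f x - (\<Sum>i<N. (a * c i) * eigseq i x)))\<^sup>2 \<partial>\<mu>) < \<epsilon>"
      using Nc False by (simp add: power_mult_distrib field_simps)
    then show "\<exists>N c. (\<integral>x. (cmod (a * f x - (\<Sum>i<N. c i * eigseq i x)))\<^sup>2 \<partial>\<mu>) < \<epsilon>" by (intro exI)
  qed
qed (simp add: approximable_zero)

lemma approximable_sum: "(\<And>i. i \<in> A \<Longrightarrow> approximable (f i)) \<Longrightarrow> approximable (\<lambda>x. \<Sum>i\<in>A. f i x)"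
  by (induction A rule: infinite_finite_induct) (auto intro: approximable_zero approximable_add)

lemma approximable_cong:
  assumes "approximable f" "\<And>x. x \<in> SU2 \<Longrightarrow> f x = g x" shows "approximable g"
proof -
  have "g \<in> borel_measurable \<mu> \<longleftrightarrow> f \<in> borel_measurable \<mu>"
    by (rule measurable_cong) (simp add: assms)
  moreover have "integrable \<mu> (\<lambda>x. (cmod (g x))\<^sup>2) \<longleftrightarrow> integrable \<mu> (\<lambda>x. (cmod (f x))\<^sup>2)"
    by (rule Bochner_Integration.integrable_cong) (simp_all add: assms)
  ultimately have "L2 \<mu> g" using assms(1) by (simp add: L2_iff approximable_def)
  moreover have "(\<integral>x. (cmod (g x - f x))\<^sup>2 \<partial>\<mu>) = (\<integral>x. 0 \<partial>\<mu>)"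
    using assms(2) by (intro Bochner_Integration.integral_cong) auto
  ultimately have "L2 \<mu> g" "(\<integral>x. (cmod (g x - f x))\<^sup>2 \<partial>\<mu>) = 0" by (auto simp only: Bochner_Integration.integral_zero)
  then show ?thesis using approximable_limit[of g] assms(1) by metis
qed

lemma approximable_continuous:
  fixes u :: "mat2 \<Rightarrow> real"
  assumes "continuous_on UNIV u" shows "approximable (\<lambda>x. of_real (u x))"
proof (rule approximable_limit)
  have cont: "continuous_on UNIV (\<lambda>x. complex_of_real (u x))"
    using assms by (intro continuous_intros)
  show L: "L2 \<mu> (\<lambda>x. of_real (u x))" using cont by (rule L2_continuous)
  fix \<epsilon> :: real assume \<epsilon>: "0 < \<epsilon>"
  define \<delta> where "\<delta> = sqrt (\<epsilon> / 2)"
  have \<delta>: "0 < \<delta>" "\<delta>\<^sup>2 = \<epsilon> / 2" using \<epsilon> by (auto simp: \<delta>_def)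
  obtain h where h: "eig_span h" "\<forall>x\<in>SU2. cmod (of_real (u x) - h x) < \<delta>"
    using continuous_approx_eig_span[OF assms \<delta>(1)] by blast
  obtain N c where Nc: "\<forall>x\<in>SU2. h x = (\<Sum>i<N. c i * eigseq i x)"
    using eig_span_imp_sum[OF h(1)] by blast
  \<comment> \<open>\<open>h'\<close> agrees with \<open>h\<close> on SU(2) and is a concrete finite
    combination, hence visibly in L2.\<close>
  define h' where "h' x = (\<Sum>i<N. c i * eigseq i x)" for x
  have "eig_span h'" using eig_span.cong[OF h(1), of h'] Nc by (simp add: h'_def)
  moreover have L': "L2 \<mu> h'" unfolding h'_def by (intro L2_sum L2_cmult L2_eigseq)
  ultimately have "approximable h'" by (intro approximable_eig_span L2_borel)
  moreover have "(\<integral>x. (cmod (of_real (u x) - h' x))\<^sup>2 \<partial>\<mu>) \<le> (\<integral>x. \<delta>\<^sup>2 \<partial>\<mu>)"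
    using h(2) Nc \<delta>
    by (intro integral_mono L2_square_integrable L2_diff L L') (auto simp: h'_def intro!: power_mono less_imp_le)
  moreover have "(\<integral>x. \<delta>\<^sup>2 \<partial>\<mu>) < \<epsilon>"
    using haar_facts(3)[OF haar] \<delta> \<epsilon> by (simp add: measure_def)
  ultimately show "\<exists>h. approximable h \<and> (\<integral>x. (cmod (of_real (u x) - h x))\<^sup>2 \<partial>\<mu>) < \<epsilon>"
    by (meson le_less_trans)
qed

text \<open>Dominated convergence for |g - u m|^2. Giving the majorant as an L2 function covers both
  bounded sequences and simple functions dominated by a multiple of \<open>g\<close>.\<close>

lemma approximable_dominated_limit:
  assumes u: "\<And>m. approximable (u m)" and g: "L2 \<mu> g" and w: "L2 \<mu> w"
    and lim: "\<And>x. x \<in> SU2 \<Longrightarrow> (\<lambda>m. u m x) \<longlonglongrightarrow> g x"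
    and le: "\<And>m x. x \<in> SU2 \<Longrightarrow> cmod (g x - u m x) \<le> cmod (w x)"
  shows "approximable g"
proof (rule approximable_limit[OF g])
  fix \<epsilon> :: real assume "0 < \<epsilon>"
  have [measurable]: "u m \<in> borel_measurable \<mu>" "g \<in> borel_measurable \<mu>" for m
    using u g by (auto simp: approximable_def L2_iff)
  have "(\<lambda>m. \<integral>x. (cmod (g x - u m x))\<^sup>2 \<partial>\<mu>) \<longlonglongrightarrow> (\<integral>x. 0 \<partial>\<mu>)"
  proof (rule integral_dominated_convergence)
    show "integrable \<mu> (\<lambda>x. (cmod (w x))\<^sup>2)" using w by (rule L2_square_integrable)
    show "AE x in \<mu>. (\<lambda>m. (cmod (g x - u m x))\<^sup>2) \<longlonglongrightarrow> 0"
    proof (rule AE_I2)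
      fix x assume "x \<in> space \<mu>"
      then have "(\<lambda>m. (cmod (g x - u m x))\<^sup>2) \<longlonglongrightarrow> (cmod (g x - g x))\<^sup>2"
        by (intro tendsto_intros lim) simp
      then show "(\<lambda>m. (cmod (g x - u m x))\<^sup>2) \<longlonglongrightarrow> 0" by simp
    qed
    show "AE x in \<mu>. norm ((cmod (g x - u m x))\<^sup>2) \<le> (cmod (w x))\<^sup>2" for m
      using le by (intro AE_I2) (auto intro!: power_mono)
  qed measurable
  then have "eventually (\<lambda>m. (\<integral>x. (cmod (g x - u m x))\<^sup>2 \<partial>\<mu>) < \<epsilon>) sequentially"
    using \<open>0 < \<epsilon>\<close> by (intro order_tendstoD) auto
  then obtain m where "(\<integral>x. (cmod (g x - u m x))\<^sup>2 \<partial>\<mu>) < \<epsilon>"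
    by (auto simp: eventually_sequentially)
  then show "\<exists>h. approximable h \<and> (\<integral>x. (cmod (g x - h x))\<^sup>2 \<partial>\<mu>) < \<epsilon>" using u by blast
qed

lemma measurable_indicator_haar: "B \<in> sets borel \<Longrightarrow> (indicator B :: mat2 \<Rightarrow> complex) \<in> borel_measurable \<mu>"
  by (intro measurable_haar_borel borel_measurable_indicator)

lemma L2_indicator: "B \<in> sets borel \<Longrightarrow> L2 \<mu> (indicator B)"
  by (intro L2_bounded[where B = 1] measurable_indicator_haar) (auto simp: indicator_def)

lemma L2_const: "L2 \<mu> (\<lambda>x. c)"
  by (intro L2_continuous continuous_intros)

text \<open>Truncated multiples of the distance to \<open>C\<close> give continuous functions
  decreasing to the indicator.\<close>

lemma approximable_indicator_closed:
  assumes "closed C" shows "approximable (indicator C)"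
proof (cases "C = {}")
  case False
  define u where "u m x = max 0 (1 - real m * infdist x C)" for m and x :: mat2
  have range: "0 \<le> u m x" "u m x \<le> 1" for m x by (auto simp: u_def infdist_nonneg)
  have inC: "u m x = 1" if "x \<in> C" for m x using that by (simp add: u_def)
  show ?thesis
  proof (rule approximable_dominated_limit)
    show "approximable (\<lambda>x. of_real (u m x))" for m
      unfolding u_def by (intro approximable_continuous continuous_intros)
    show "L2 \<mu> (indicator C)" using assms by (intro L2_indicator) auto
    show "L2 \<mu> (\<lambda>x. 1)" by (rule L2_const)
    show "cmod (indicator C x - of_real (u m x)) \<le> cmod 1" for m x
      using range[of m x] inC[of x m] by (cases "x \<in> C") auto
    show "(\<lambda>m. complex_of_real (u m x)) \<longlonglongrightarrow> indicator C x" for x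
    proof (cases "x \<in> C")
      case False
      then have d: "0 < infdist x C"
        using assms \<open>C \<noteq> {}\<close> infdist_nonneg[of x C] in_closed_iff_infdist_zero[of C x] by auto
      obtain N :: nat where N: "1 < real N * infdist x C" using reals_Archimedean3[OF d] by blast
      have "u m x = 0" if "N \<le> m" for m
      proof -
        have "real N * infdist x C \<le> real m * infdist x C" using that d by (intro mult_right_mono) auto
        then show ?thesis using N by (simp add: u_def)
      qed
      then have "eventually (\<lambda>m. complex_of_real (u m x) = indicator C x) sequentially"
        using False by (auto simp: eventually_sequentially)
      then show ?thesis by (rule tendsto_eventually)
    qed (simp add: inC)
  qed
qed (auto intro: approximable_cong[OF approximable_zero])

text \<open>Dynkin's pi-lambda argument with the closed sets as intersection-stable generator;
  disjoint unions are handled by dominated convergence.\<close>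

lemma approximable_indicator:
  assumes "B \<in> sets borel" shows "approximable (indicator B)"
proof -
  have sets: "sets (borel :: mat2 measure) = sigma_sets UNIV (Collect closed)"
    by (simp add: borel_eq_closed sets_measure_of)
  have "Int_stable (Collect closed :: mat2 set set)" "(Collect closed :: mat2 set set) \<subseteq> Pow UNIV"
    "B \<in> sigma_sets UNIV (Collect closed)"
    using assms unfolding sets by (auto simp: Int_stable_def)
  then show ?thesis
  proof (induction rule: sigma_sets_induct_disjoint)
    case (basic A)
    then show ?case by (auto intro: approximable_indicator_closed)
  next
    case empty
    show ?case by (auto intro: approximable_cong[OF approximable_zero])
  next
    case (compl A)
    have "approximable (\<lambda>x. indicator UNIV x + (-1) * indicator A x)"
      by (rule approximable_add[OF approximable_indicator_closed[OF closed_UNIV] approximable_cmult[OF compl(2)]])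
    then show ?case by (rule approximable_cong) (auto simp: indicator_def)
  next
    case (union A)
    have A: "A i \<in> sets borel" for i using union(2) unfolding sets by auto
    have part: "(\<Sum>i<m. indicator (A i) x) = (indicator (\<Union>i<m. A i) x :: complex)" for m x
      using union(1) by (subst indicator_UN_disjoint) (auto simp: disjoint_family_on_def)
    show ?case
    proof (rule approximable_dominated_limit)
      show "approximable (\<lambda>x. \<Sum>i<m. indicator (A i) x)" for m
        using union by (intro approximable_sum) auto
      show "L2 \<mu> (indicator (\<Union>i. A i))" using A by (intro L2_indicator) auto
      show "L2 \<mu> (\<lambda>x. 1)" by (rule L2_const)
      show "cmod (indicator (\<Union>i. A i) x - (\<Sum>i<m. indicator (A i) x)) \<le> cmod 1" for m x
        unfolding part by (auto simp: indicator_def)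
      show "(\<lambda>m. \<Sum>i<m. indicator (A i) x) \<longlonglongrightarrow> (indicator (\<Union>i. A i) x :: complex)" for x
        unfolding part by (rule LIMSEQ_indicator_UN)
    qed
  qed
qed

lemma approximable_L2:
  assumes g: "L2 \<mu> g" shows "approximable g"
proof -
  have "g \<in> borel_measurable \<mu>" using g by (rule L2_borel)
  from borel_measurable_implies_sequence_metric[OF this, of 0]
  obtain F where F: "\<And>i. simple_function \<mu> (F i)" "\<And>x. x \<in> space \<mu> \<Longrightarrow> (\<lambda>i. F i x) \<longlonglongrightarrow> g x"
    "\<And>i x. x \<in> space \<mu> \<Longrightarrow> dist (F i x) 0 \<le> 2 * dist (g x) 0" by blast
  show ?thesis
  proof (rule approximable_dominated_limit)
    show "approximable (F m)" for m
    proof -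
      have "approximable (\<lambda>x. \<Sum>y\<in>F m ` space \<mu>. y * indicator (F m -` {y} \<inter> space \<mu>) x)"
      proof (intro approximable_sum approximable_cmult)
        fix y assume "y \<in> F m ` space \<mu>"
        have "F m -` {y} \<inter> space \<mu> \<in> sets \<mu>" using F(1) by (rule simple_functionD)
        then obtain B where B: "B \<in> sets borel" "F m -` {y} \<inter> space \<mu> = SU2 \<inter> B"
          unfolding haar_facts(2)[OF haar] sets_restrict_space by auto
        show "approximable (indicator (F m -` {y} \<inter> space \<mu>))"
          unfolding B(2) using approximable_indicator[OF B(1)] by (rule approximable_cong) (auto simp: indicator_def)
      qed
      then show ?thesis
      proof (rule approximable_cong)
        fix x assume "x \<in> SU2"
        have "(\<Sum>y\<in>F m ` space \<mu>. y * indicator (F m -` {y} \<inter> space \<mu>) x) =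
          (\<Sum>y\<in>F m ` space \<mu>. indicator (F m -` {y} \<inter> space \<mu>) x *\<^sub>R y)"
          by (intro sum.cong refl) (simp add: indicator_def)
        also have "\<dots> = F m x"
          using \<open>x \<in> SU2\<close> by (intro simple_function_indicator_representation_banach[symmetric] F(1)) simp
        finally show "(\<Sum>y\<in>F m ` space \<mu>. y * indicator (F m -` {y} \<inter> space \<mu>) x) = F m x" .
      qed
    qed
    \<comment> \<open>The simple functions satisfy |F m| \<le> 2 |g|, so |g - F m| \<le> 3
      |g|.\<close>
    show "L2 \<mu> (\<lambda>x. 3 * g x)" using g by (rule L2_cmult)
    show "(\<lambda>m. F m x) \<longlonglongrightarrow> g x" if "x \<in> SU2" for x using F(2) that by simp
    show "cmod (g x - F m x) \<le> cmod (3 * g x)" if "x \<in> SU2" for m x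
      using F(3)[of x m] that norm_triangle_ineq4[of "g x" "F m x"] by (simp add: norm_mult)
  qed (rule g)
qed

end

subsection \<open>The Hoelder estimate\<close>

context haar_SU2
begin

lemma schatten_Sop_diff_le:
  assumes q: "10 < q"
  shows "schatten \<mu> q (\<lambda>\<xi> x. Sop \<theta>1 \<xi> x - Sop \<theta>2 \<xi> x)
    \<le> ennreal (768 * pi\<^sup>2 * (q - 10) powr (- 1 / q) * \<bar>\<theta>1 - \<theta>2\<bar> powr (1 / 4 - 5 / (2 * q)))"
proof -
  define \<delta> where "\<delta> = \<bar>\<theta>1 - \<theta>2\<bar>"
  have \<delta>: "0 \<le> \<delta>" by (simp add: \<delta>_def)
  define ev where "ev \<theta> i = (case eig_enum i of (n, k, l) \<Rightarrow> if k \<le> n \<and> l \<le> n then eigval n k \<theta> else 0)" for \<theta> i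
  define B where "B = 12 * pi * (4 * pi) powr q * (2 powr q * (2 * q / (q - 10)) * \<delta> powr (q / 4 - 5 / 2))"
  have eig: "Sop \<theta> (eigseq i) x = ev \<theta> i * eigseq i x" for \<theta> i x
  proof -
    obtain n k l where "eig_enum i = (n, k, l)" by (cases "eig_enum i")
    then show ?thesis by (simp add: eigseq_def ev_def Sop_eigfun) (simp add: Sop_eq)
  qed
  have adj: "l2inner \<mu> (Sop \<theta> g) (eigseq i) = ev \<theta> i * l2inner \<mu> g (eigseq i)" if "L2 \<mu> g" for \<theta> g i
  proof -
    obtain n k l where "eig_enum i = (n, k, l)" by (cases "eig_enum i")
    then show ?thesis using that by (simp add: eigseq_def ev_def Sop_adjoint_eigfun) (simp add: l2inner_def)
  qed
  have bound: "(\<Sum>i\<in>A. cmod (ev \<theta>1 i - ev \<theta>2 i) powr q) \<le> B" if "finite A" for A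
  proof -
    define g where "g = (\<lambda>(n, k, l :: nat). (jac n k * min 2 (n * \<delta>)) powr q)"
    \<comment> \<open>\<open>V\<close> drops the triples outside k, l \<le> n, where
      \<open>ev\<close> is 0 for both parameters. Injectivity of the enumeration then turns the sum
      into part of a triple sum over degrees up to some \<open>N\<close>.\<close>
    define V where "V = {i \<in> A. eig_enum i \<in> (SIGMA n:UNIV. {..n} \<times> {..n})}"
    obtain N where N: "fst (eig_enum i) \<le> N" if "i \<in> A" for i
      using finite_nat_set_iff_bounded_le[of "(\<lambda>i. fst (eig_enum i)) ` A"] \<open>finite A\<close> by auto
    have "(\<Sum>i\<in>A. cmod (ev \<theta>1 i - ev \<theta>2 i) powr q) = (\<Sum>i\<in>V. cmod (ev \<theta>1 i - ev \<theta>2 i) powr q)"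
      using \<open>finite A\<close> by (intro sum.mono_neutral_right) (auto simp: V_def ev_def split: prod.splits)
    also have "\<dots> \<le> (\<Sum>i\<in>V. g (eig_enum i))"
    proof (rule sum_mono)
      fix i assume i: "i \<in> V"
      obtain n k l where e: "eig_enum i = (n, k, l)" by (cases "eig_enum i")
      then have "k \<le> n" "l \<le> n" using i by (auto simp: V_def)
      then show "cmod (ev \<theta>1 i - ev \<theta>2 i) powr q \<le> g (eig_enum i)"
        using cmod_eigval_diff_le[of k n \<theta>1 \<theta>2] q by (auto simp: e ev_def g_def \<delta>_def intro!: powr_mono2)
    qed
    also have "\<dots> = sum g (eig_enum ` V)"
      using eig_enum_inj by (subst sum.reindex) (auto intro: inj_on_subset)
    also have "\<dots> \<le> sum g (SIGMA n:{..N}. {..n} \<times> {..n})"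
    proof (rule sum_mono2)
      show "eig_enum ` V \<subseteq> (SIGMA n:{..N}. {..n} \<times> {..n})"
        using N by (fastforce simp: V_def)
    qed (auto simp: g_def)
    also have "\<dots> = (\<Sum>n\<le>N. \<Sum>k\<le>n. \<Sum>l\<le>n. (jac n k * min 2 (n * \<delta>)) powr q)"
    proof -
      have "sum g (SIGMA n:{..N}. {..n} \<times> {..n}) = (\<Sum>n\<le>N. \<Sum>p\<in>{..n} \<times> {..n}. g (n, p))"
        by (subst sum.Sigma) (auto intro!: sum.cong)
      also have "\<dots> = (\<Sum>n\<le>N. \<Sum>k\<le>n. \<Sum>l\<le>n. g (n, k, l))"
        by (intro sum.cong refl) (simp only: sum.cartesian_product, intro sum.cong, auto)
      finally show ?thesis by (simp only: g_def prod.case)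
    qed
    also have "\<dots> \<le> B" unfolding B_def by (rule sum_eigenvalue_bound[OF q \<delta>])
    finally show ?thesis .
  qed
  have "schatten \<mu> q (\<lambda>\<xi> x. Sop \<theta>1 \<xi> x - Sop \<theta>2 \<xi> x) \<le> ennreal (2 * B powr (1 / q))"
  proof (rule schatten_le_eigenvalues[where f = eigseq and \<Lambda> = "\<lambda>i. ev \<theta>1 i - ev \<theta>2 i"])
    show "L2 \<mu> (\<lambda>x. Sop \<theta>1 g x - Sop \<theta>2 g x)" if "L2 \<mu> g" for g
      using that by (intro L2_diff L2_Sop)
    show "l2inner \<mu> (\<lambda>x. Sop \<theta>1 g x - Sop \<theta>2 g x) (eigseq i) = (ev \<theta>1 i - ev \<theta>2 i) * l2inner \<mu> g (eigseq i)"
      if "L2 \<mu> g" for g i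
      using that by (simp add: l2inner_diff_left L2_Sop L2_eigseq adj left_diff_distrib)
    show "\<exists>N c. (\<integral>x. (cmod (g x - (\<Sum>i<N. c i * eigseq i x)))\<^sup>2 \<partial>\<mu>) < \<epsilon>" if "L2 \<mu> g" "0 < \<epsilon>" for g \<epsilon>
      using approximable_L2[OF that(1)] that(2) unfolding approximable_def by blast
    show "0 < q" using q by simp
  qed (simp_all add: L2_eigseq eig left_diff_distrib bound)
  also have "\<dots> \<le> ennreal (768 * pi\<^sup>2 * (q - 10) powr (- 1 / q) * \<delta> powr (1 / 4 - 5 / (2 * q)))"
    unfolding B_def by (intro ennreal_leI schatten_constant_bound q \<delta>)
  finally show ?thesis unfolding \<delta>_def .
qed

end

theorem theoremA1:
  fixes \<mu> :: "mat2 measure"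
  assumes "is_haar_SU2 \<mu>"
  shows "\<exists>C::real. \<forall>q::real. q > 10 \<longrightarrow>
    (\<exists>Cq::real. Cq \<le> C * (q - 10) powr (- 1 / q) \<and>
      (\<forall>\<theta>1 \<theta>2::real.
         schatten \<mu> q (\<lambda>\<xi> x. Sop \<theta>1 \<xi> x - Sop \<theta>2 \<xi> x)
           \<le> ennreal (Cq * \<bar>\<theta>1 - \<theta>2\<bar> powr (1/4 - 5 / (2 * q)))))"
proof -
  interpret haar_SU2 \<mu> by standard (rule assms)
  \<comment> \<open>The same C serves every \<mu>, and the witness for \<open>Cq\<close> is C (q -
    10)^(-1/q) itself.\<close>
  show ?thesis using schatten_Sop_diff_le by (intro exI[of _ "768 * pi\<^sup>2"]) blast
qed

end
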